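(* Let $(M,g)$ be a complete finite-dimensional Riemannian manifold, let $E\subseteq M$ be star-shaped at $p_0\in E$, and let $f,g_1,\dots,g_m:E\to\mathbb{I}$ be interval-valued functions, $f=\langle f^c,f^w\rangle$, $g_i=\langle g_i^c,g_i^w\rangle$. Consider the problem of minimizing $f(p)$ (with respect to $\leq^{\min}$) subject to $g_i(p)\leq^{\min}0$, $i\in\{1,\dots,m\}$, with feasible set $X=\{p\in E:g_i(p)\leq^{\min} 0,\ 1\le i\le m\}$. Let $p_0\in X$ and $J=\{i:g_i(p_0)=0\}$. Suppose that for every geodesic $\gamma:I\to M$, $I$ an interval with $0\in I$, $\gamma(I)\subseteq E$ and $\gamma(0)=p_0$, the functions $g_i^w\circ\gamma$, $i\in\{1,\dots,m\}$, are non-decreasing on $I\cap[0,\infty)$. Suppose that the $g_i$, $i\in J$, are cw-convex at $p_0$ and that $g_i$, $i\in\{1,\dots,m\}$, are gH-directionally differentiable at $p_0$. Then the following hold. 1. Suppose that $f^c$ is directionally differentiable at $p_0$, convex at $p_0$, and non-constant on $X$ (in the sense defined in the context). If there exist real scalars $\mu_i\ge0$, $i\in\{1,\dots,m\}$, such that (i) $0\leq^{\min}Df^c(p_0;X_{p_0})+\sum_{i=1}^m\mu_i\,Dg_i(p_0;X_{p_0})$ for all $X_{p_0}\in T_{p_0}(E)$, and (ii) $\mu_ig_i(p_0)=0$ for all $i\in\{1,\dots,m\}$, then $p_0$ is a strict optimal solution of the problem. 2. Suppose that $f^c$ is constant on $X$ (i.e. takes a single value on $X$) and that $f^w$ is directionally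 differentiable at $p_0$ and convex at $p_0$. If there exist real scalars $\mu_i\ge0$, $i\in\{1,\dots,m\}$, such that (i) $0\leq^{\min}Df^w(p_0;X_{p_0})+\sum_{i=1}^m\mu_i\,Dg_i(p_0;X_{p_0})$ for all $X_{p_0}\in T_{p_0}(E)$, and (ii) $\mu_ig_i(p_0)=0$ for all $i\in\{1,\dots,m\}$, then $p_0$ is an optimal solution of the problem. Moreover, if $f^w$ is non-constant on $X$ (in the sense defined in the context), then $p_0$ is a strict optimal solution of the problem.
   Context: Intervals: $\mathbb{I}$ is the set of closed bounded intervals of $\mathbb{R}$. $T=[t^l,t^u]\in\mathbb{I}$ is written $T=\langle t^c,t^w\rangle$ with center $t^c=\frac{t^l+t^u}{2}$ and half-width $t^w=\frac{t^u-t^l}{2}\ge 0$. A real $s$ is identified with $\langle s,0\rangle$; in particular $0=\langle 0,0\rangle$. Sums and real multiples of intervals are taken elementwise, so $s_1T_1+s_2T_2=\langle s_1t_1^c+s_2t_2^c,\ |s_1|t_1^w+|s_2|t_2^w\rangle$. The total order $\leq^{\min}$: $T_1\leq^{\min}T_2$ iff $t_1^c<t_2^c$, or $t_1^c=t_2^c$ and $t_1^w\le t_2^w$; $T_1<^{\min}T_2$ iff $T_1\leq^{\min}T_2$ and $T_1\ne T_2$. The gH-difference is $T_1\ominus_{gH}T_2=\langle t_1^c-t_2^c,\ |t_1^w-t_2^w|\rangle$. Limits in $\mathbb{I}$ are with respect to the Hausdorff distance $d_H(T_1,T_2)=\max\{|t_1^l-t_2^l|,|t_1^u-t_2^u|\}$.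 An interval-valued function $f:E\to\mathbb{I}$ is written $f=\langle f^c,f^w\rangle$ with $f^c,f^w:E\to\mathbb{R}$, $f^w\ge0$. Star-shaped: $E\subseteq M$ is star-shaped at $p_0\in E$ if for every $p\in E$ and every geodesic $\gamma:[0,1]\to M$ with $\gamma(0)=p_0$, $\gamma(1)=p$, one has $\gamma(s)\in E$ for all $s\in(0,1)$. Convexity at a point: for $E$ star-shaped at $p_0$, $h:E\to\mathbb{R}$ is convex at $p_0$ if $h(\gamma(s))\le(1-s)h(p_0)+s\,h(p)$ for all $p\in E$, every geodesic $\gamma:[0,1]\to M$ with $\gamma(0)=p_0$, $\gamma(1)=p$, and all $s\in(0,1)$. An interval-valued function is cw-convex at $p_0$ if both its center function and its half-width function are convex at $p_0$. Tangent directions and derivatives: $T_{p_0}(E)$ denotes the set of vectors $X_{p_0}\in T_{p_0}M$ for which there is a geodesic $\gamma:I\to M$, $I\subseteq\mathbb{R}$ an interval containing $[0,\varepsilon)$ for some $\varepsilon>0$, with $\gamma(I)\subseteq E$, $\gamma(0)=p_0$, $\dot\gamma(0)=X_{p_0}$. For such $X_{p_0}$, $\gamma$: for real-valued $h$, $Dh(p_0;X_{p_0})=\lim_{s\to0^+}\frac{h(\gamma(s))-h(p_0)}{s}$; for interval-valued $h$, the gH-directional derivative is $Dh(p_0;X_{p_0})=\lim_{s\to0^+}\frac1s\big(h(\gamma(s))\ominus_{gH}h(p_0)\big)$. The function is (gH-)directionally differentiable at $p_0$ if this limit exists for every $X_{p_0}\in T_{p_0}(E)$. Non-constant (paper's definition):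 a function $h$ is non-constant on $X$ if $h(p)\neq h(q)$ for all $p,q\in X$ with $p\ne q$. Optimal solution: $p_0\in X$ is an optimal solution if there is no $p\in X$ with $f(p)<^{\min}f(p_0)$; it is a strict optimal solution if there is no $p\in X$, $p\ne p_0$, with $f(p)\leq^{\min}f(p_0)$. *)

theory Defs
  imports "HOL-Analysis.Analysis" "HOL-Library.Interval"
begin

section \<open>Closed bounded intervals of the real line\<close>

text \<open>
  The type \<open>real interval\<close> consists of the nonempty closed bounded intervals. Its addition and
  multiplication are the elementwise ones, so the real multiple \<open>s T\<close> is \<open>interval_of s * T\<close>
  (see the lemmas below). The library order on intervals is inclusion and is not used here.
\<close>

definition ctr :: "real interval \<Rightarrow> real" where
  "ctr T = (lower T + upper T) / 2"

definition hw :: "real interval \<Rightarrow> real" where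
  "hw T = (upper T - lower T) / 2"

text \<open>Only meaningful for \<open>w \<ge> 0\<close>.\<close>

definition cw_interval :: "real \<Rightarrow> real \<Rightarrow> real interval" where
  "cw_interval c w = Interval (c - w, c + w)"

definition le_min :: "real interval \<Rightarrow> real interval \<Rightarrow> bool"  (infix \<open>\<le>\<^sub>m\<^sub>i\<^sub>n\<close> 50) where
  "S \<le>\<^sub>m\<^sub>i\<^sub>n T \<longleftrightarrow> ctr S < ctr T \<or> (ctr S = ctr T \<and> hw S \<le> hw T)"

definition less_min :: "real interval \<Rightarrow> real interval \<Rightarrow> bool"  (infix \<open><\<^sub>m\<^sub>i\<^sub>n\<close> 50) where
  "S <\<^sub>m\<^sub>i\<^sub>n T \<longleftrightarrow> S \<le>\<^sub>m\<^sub>i\<^sub>n T \<and> S \<noteq> T"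

definition gH_diff :: "real interval \<Rightarrow> real interval \<Rightarrow> real interval"  (infixl \<open>\<ominus>\<^sub>g\<^sub>H\<close> 65) where
  "S \<ominus>\<^sub>g\<^sub>H T = cw_interval (ctr S - ctr T) \<bar>hw S - hw T\<bar>"

definition hausdorff_dist :: "real interval \<Rightarrow> real interval \<Rightarrow> real" where
  "hausdorff_dist S T = max \<bar>lower S - lower T\<bar> \<bar>upper S - upper T\<bar>"

definition interval_tendsto :: "('b \<Rightarrow> real interval) \<Rightarrow> real interval \<Rightarrow> 'b filter \<Rightarrow> bool" where
  "interval_tendsto F L net \<longleftrightarrow> ((\<lambda>x. hausdorff_dist (F x) L) \<longlongrightarrow> 0) net"

lemma hw_nonneg: "0 \<le> hw T"
  by (simp add: hw_def)

lemma lower_cw_interval: "0 \<le> w \<Longrightarrow> lower (cw_interval c w) = c - w"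
  and upper_cw_interval: "0 \<le> w \<Longrightarrow> upper (cw_interval c w) = c + w"
  by (simp_all add: cw_interval_def lower.rep_eq upper.rep_eq Interval_inverse)

lemma ctr_cw_interval: "0 \<le> w \<Longrightarrow> ctr (cw_interval c w) = c"
  and hw_cw_interval: "0 \<le> w \<Longrightarrow> hw (cw_interval c w) = w"
  by (simp_all add: ctr_def hw_def lower_cw_interval upper_cw_interval)

lemma interval_eq_iff_ctr_hw: "S = T \<longleftrightarrow> ctr S = ctr T \<and> hw S = hw T"
  by (auto simp: interval_eq_iff ctr_def hw_def)

lemma ctr_zero: "ctr 0 = 0" and hw_zero: "hw 0 = 0"
  by (simp_all add: ctr_def hw_def)

lemma ctr_interval_of: "ctr (interval_of s) = s" and hw_interval_of: "hw (interval_of s) = 0"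
  by (simp_all add: ctr_def hw_def)

lemma ctr_add: "ctr (S + T) = ctr S + ctr T" and hw_add: "hw (S + T) = hw S + hw T"
  by (simp_all add: ctr_def hw_def field_simps)

lemma ctr_mult: "ctr (interval_of s * T) = s * ctr T"
  and hw_mult: "hw (interval_of s * T) = \<bar>s\<bar> * hw T"
proof -
  have *: "lower T \<le> upper T" by simp
  have l: "lower (interval_of s * T) = min (s * lower T) (s * upper T)"
    and u: "upper (interval_of s * T) = max (s * lower T) (s * upper T)"
    by (simp_all add: lower_times upper_times insert_commute)
  show "ctr (interval_of s * T) = s * ctr T"
    unfolding ctr_def l u by (simp add: min_def max_def field_simps)
  show "hw (interval_of s * T) = \<bar>s\<bar> * hw T"
  proof (cases "0 \<le> s")
    case True
    then have "s * lower T \<le> s * upper T" using * by (rule mult_left_mono[rotated])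
    then show ?thesis unfolding hw_def l u using True by (simp add: field_simps)
  next
    case False
    then have "s * upper T \<le> s * lower T" using * by (intro mult_left_mono_neg) auto
    then show ?thesis unfolding hw_def l u using False by (simp add: field_simps)
  qed
qed


section \<open>Smooth manifolds\<close>

text \<open>For open \<open>U\<close>, \<open>C_k_on k U f\<close> says that \<open>f\<close> is k times continuously differentiable.\<close>

fun C_k_on :: "nat \<Rightarrow> 'b::real_normed_vector set \<Rightarrow> ('b \<Rightarrow> 'c::real_normed_vector) \<Rightarrow> bool" where
  "C_k_on 0 U f \<longleftrightarrow> continuous_on U f"
| "C_k_on (Suc k) U f \<longleftrightarrow> (\<forall>x\<in>U. f differentiable (at x)) \<and>
     (\<forall>v. C_k_on k U (\<lambda>x. frechet_derivative f (at x) v))"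

definition smooth_on :: "'b::real_normed_vector set \<Rightarrow> ('b \<Rightarrow> 'c::real_normed_vector) \<Rightarrow> bool" where
  "smooth_on U f \<longleftrightarrow> (\<forall>k. C_k_on k U f)"

text \<open>
  A chart is a domain together with a coordinate map into the model space \<open>'e\<close>, which will be
  a Euclidean space; the values of the map off the domain are irrelevant. The manifold is the
  whole type \<open>'a\<close>.
\<close>

type_synonym ('a, 'e) chart = "'a set \<times> ('a \<Rightarrow> 'e)"

abbreviation chart_dom :: "('a, 'e) chart \<Rightarrow> 'a set" where
  "chart_dom c \<equiv> fst c"

abbreviation chart_map :: "('a, 'e) chart \<Rightarrow> 'a \<Rightarrow> 'e" where
  "chart_map c \<equiv> snd c"

definition chart_inv :: "('a, 'e) chart \<Rightarrow> 'e \<Rightarrow> 'a" where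
  "chart_inv c = inv_into (chart_dom c) (chart_map c)"

definition is_chart :: "('a::topological_space, 'e::euclidean_space) chart \<Rightarrow> bool" where
  "is_chart c \<longleftrightarrow> open (chart_dom c) \<and> open (chart_map c ` chart_dom c) \<and>
     homeomorphism (chart_dom c) (chart_map c ` chart_dom c) (chart_map c) (chart_inv c)"

definition transition :: "('a, 'e) chart \<Rightarrow> ('a, 'e) chart \<Rightarrow> 'e \<Rightarrow> 'e" where
  "transition c d = chart_map d \<circ> chart_inv c"

definition smooth_atlas :: "('a::topological_space, 'e::euclidean_space) chart set \<Rightarrow> bool" where
  "smooth_atlas A \<longleftrightarrow> (\<forall>c\<in>A. is_chart c) \<and> (\<Union>c\<in>A. chart_dom c) = UNIV \<and>
     (\<forall>c\<in>A. \<forall>d\<in>A. smooth_on (chart_map c ` (chart_dom c \<inter> chart_dom d)) (transition c d))"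


section \<open>Tangent vectors\<close>

text \<open>
  A tangent vector at \<open>p\<close> assigns to every chart of the atlas around \<open>p\<close> a coordinate vector, the
  coordinate vectors being related by the derivatives of the transition maps. It is normalised
  to be zero on all other arguments, so that equal tangent vectors are equal functions.
\<close>

type_synonym ('a, 'e) tangent = "('a, 'e) chart \<Rightarrow> 'e"

definition charts_at :: "('a, 'e) chart set \<Rightarrow> 'a \<Rightarrow> ('a, 'e) chart set" where
  "charts_at A p = {c \<in> A. p \<in> chart_dom c}"

definition coord_change ::
  "('a, 'e::euclidean_space) chart \<Rightarrow> ('a, 'e) chart \<Rightarrow> 'a \<Rightarrow> 'e \<Rightarrow> 'e" where
  "coord_change c d p = frechet_derivative (transition c d) (at (chart_map c p))"

definition tangent_space ::
  "('a, 'e::euclidean_space) chart set \<Rightarrow> 'a \<Rightarrow> ('a, 'e) tangent set" where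
  "tangent_space A p = {X.
     (\<forall>c\<in>charts_at A p. \<forall>d\<in>charts_at A p. X d = coord_change c d p (X c)) \<and>
     (\<forall>c. c \<notin> charts_at A p \<longrightarrow> X c = 0)}"

text \<open>The tangent vector at \<open>p\<close> with coordinate vector \<open>v\<close> in the chart \<open>c\<close>:\<close>

definition tangent_of_coord ::
  "('a, 'e::euclidean_space) chart set \<Rightarrow> ('a, 'e) chart \<Rightarrow> 'a \<Rightarrow> 'e \<Rightarrow> ('a, 'e) tangent" where
  "tangent_of_coord A c p v = (\<lambda>d. if d \<in> charts_at A p then coord_change c d p v else 0)"

text \<open>
  The velocity at time \<open>t\<close> of a curve with parameter set \<open>I\<close>; at an endpoint of \<open>I\<close> this is the
  one-sided derivative.
\<close>

definition velocity ::
  "('a, 'e::euclidean_space) chart set \<Rightarrow> real set \<Rightarrow> (real \<Rightarrow> 'a) \<Rightarrow> real \<Rightarrow> ('a, 'e) tangent" where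
  "velocity A I \<gamma> t = (\<lambda>c. if c \<in> charts_at A (\<gamma> t)
      then vector_derivative (chart_map c \<circ> \<gamma>) (at t within I) else 0)"


section \<open>Riemannian metrics and completeness\<close>

type_synonym ('a, 'e) metric_field = "'a \<Rightarrow> ('a, 'e) tangent \<Rightarrow> ('a, 'e) tangent \<Rightarrow> real"

text \<open>The metric in the coordinates of the chart \<open>c\<close>, as a bilinear form at each coordinate point:\<close>

definition metric_coord ::
  "('a, 'e::euclidean_space) chart set \<Rightarrow> ('a, 'e) metric_field \<Rightarrow> ('a, 'e) chart \<Rightarrow>
    'e \<Rightarrow> 'e \<Rightarrow> 'e \<Rightarrow> real" where
  "metric_coord A \<gg> c x v w =
     \<gg> (chart_inv c x) (tangent_of_coord A c (chart_inv c x) v)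
                        (tangent_of_coord A c (chart_inv c x) w)"

definition riemannian_metric ::
  "('a::topological_space, 'e::euclidean_space) chart set \<Rightarrow> ('a, 'e) metric_field \<Rightarrow> bool" where
  "riemannian_metric A \<gg> \<longleftrightarrow>
     (\<forall>p. \<forall>X\<in>tangent_space A p. \<forall>Y\<in>tangent_space A p. \<gg> p X Y = \<gg> p Y X) \<and>
     (\<forall>p. \<forall>X\<in>tangent_space A p. \<forall>Y\<in>tangent_space A p. \<forall>Z\<in>tangent_space A p. \<forall>a b.
        \<gg> p (\<lambda>c. a *\<^sub>R X c + b *\<^sub>R Y c) Z = a * \<gg> p X Z + b * \<gg> p Y Z) \<and>
     (\<forall>p. \<forall>X\<in>tangent_space A p. X \<noteq> (\<lambda>_. 0) \<longrightarrow> 0 < \<gg> p X X) \<and>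
     (\<forall>c\<in>A. \<forall>v w. smooth_on (chart_map c ` chart_dom c) (\<lambda>x. metric_coord A \<gg> c x v w))"

text \<open>
  The underlying space of a Riemannian manifold is Hausdorff, second countable and connected.
  (Without connectedness the distance below is not defined.) Completeness is that of the metric
  space given by the Riemannian distance.
\<close>

definition riemannian_manifold ::
  "('a::{t2_space, second_countable_topology}, 'e::euclidean_space) chart set \<Rightarrow>
    ('a, 'e) metric_field \<Rightarrow> bool" where
  "riemannian_manifold A \<gg> \<longleftrightarrow>
     connected (UNIV :: 'a set) \<and> smooth_atlas A \<and> riemannian_metric A \<gg>"

definition C1_curve_on ::
  "('a::topological_space, 'e::euclidean_space) chart set \<Rightarrow> real set \<Rightarrow> (real \<Rightarrow> 'a) \<Rightarrow> bool" where
  "C1_curve_on A I \<gamma> \<longleftrightarrow> continuous_on I \<gamma> \<and>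
     (\<forall>c\<in>A. \<exists>x'. \<forall>t\<in>I. \<gamma> t \<in> chart_dom c \<longrightarrow>
        ((chart_map c \<circ> \<gamma>) has_vector_derivative x' t) (at t within I) \<and>
        continuous (at t within I) x')"

definition piecewise_C1_curve ::
  "('a::topological_space, 'e::euclidean_space) chart set \<Rightarrow> (real \<Rightarrow> 'a) \<Rightarrow> bool" where
  "piecewise_C1_curve A \<gamma> \<longleftrightarrow> (\<exists>n \<tau>. \<tau> 0 = 0 \<and> \<tau> n = 1 \<and>
     (\<forall>i<n. \<tau> i < \<tau> (Suc i) \<and> C1_curve_on A {\<tau> i..\<tau> (Suc i)} \<gamma>))"

definition curve_length ::
  "('a, 'e::euclidean_space) chart set \<Rightarrow> ('a, 'e) metric_field \<Rightarrow> (real \<Rightarrow> 'a) \<Rightarrow> real" where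
  "curve_length A \<gg> \<gamma> = integral {0..1}
     (\<lambda>t. sqrt (\<gg> (\<gamma> t) (velocity A {0..1} \<gamma> t) (velocity A {0..1} \<gamma> t)))"

definition riemannian_dist ::
  "('a::topological_space, 'e::euclidean_space) chart set \<Rightarrow> ('a, 'e) metric_field \<Rightarrow>
    'a \<Rightarrow> 'a \<Rightarrow> real" where
  "riemannian_dist A \<gg> p q =
     Inf {curve_length A \<gg> \<gamma> | \<gamma>. piecewise_C1_curve A \<gamma> \<and> \<gamma> 0 = p \<and> \<gamma> 1 = q}"

definition complete_riemannian_manifold ::
  "('a::{t2_space, second_countable_topology}, 'e::euclidean_space) chart set \<Rightarrow>
    ('a, 'e) metric_field \<Rightarrow> bool" where
  "complete_riemannian_manifold A \<gg> \<longleftrightarrow> riemannian_manifold A \<gg> \<and>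
     Metric_space.mcomplete UNIV (riemannian_dist A \<gg>)"


section \<open>Geodesics\<close>

text \<open>
  The Christoffel symbols of the Levi-Civita connection in the chart \<open>c\<close>, as a vector-valued
  bilinear map: \<open>christoffel A \<gg> c x u w\<close> has k-th component \<open>\<Gamma>\<^sup>k\<^sub>i\<^sub>j u\<^sup>i w\<^sup>j\<close>, with the index raised
  by nondegeneracy of the metric.
\<close>

definition christoffel ::
  "('a, 'e::euclidean_space) chart set \<Rightarrow> ('a, 'e) metric_field \<Rightarrow> ('a, 'e) chart \<Rightarrow>
    'e \<Rightarrow> 'e \<Rightarrow> 'e \<Rightarrow> 'e" where
  "christoffel A \<gg> c x u w = (THE z. \<forall>v. metric_coord A \<gg> c x z v =
     (frechet_derivative (\<lambda>y. metric_coord A \<gg> c y w v) (at x) u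
      + frechet_derivative (\<lambda>y. metric_coord A \<gg> c y u v) (at x) w
      - frechet_derivative (\<lambda>y. metric_coord A \<gg> c y u w) (at x) v) / 2)"

text \<open>
  The parameter set of a geodesic is an arbitrary interval, with one-sided derivatives at the
  endpoints belonging to it.
\<close>

definition geodesic_on ::
  "('a::topological_space, 'e::euclidean_space) chart set \<Rightarrow> ('a, 'e) metric_field \<Rightarrow>
    real set \<Rightarrow> (real \<Rightarrow> 'a) \<Rightarrow> bool" where
  "geodesic_on A \<gg> I \<gamma> \<longleftrightarrow> is_interval I \<and> continuous_on I \<gamma> \<and>
     (\<forall>c\<in>A. \<exists>x' x''. \<forall>t\<in>I. \<gamma> t \<in> chart_dom c \<longrightarrow>
        ((chart_map c \<circ> \<gamma>) has_vector_derivative x' t) (at t within I) \<and>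
        (x' has_vector_derivative x'' t) (at t within I) \<and>
        x'' t + christoffel A \<gg> c (chart_map c (\<gamma> t)) (x' t) (x' t) = 0)"


section \<open>Star-shaped sets, convexity and derivatives at a point\<close>

definition star_shaped_at ::
  "('a::topological_space, 'e::euclidean_space) chart set \<Rightarrow> ('a, 'e) metric_field \<Rightarrow>
    'a set \<Rightarrow> 'a \<Rightarrow> bool" where
  "star_shaped_at A \<gg> E p0 \<longleftrightarrow> p0 \<in> E \<and>
     (\<forall>p\<in>E. \<forall>\<gamma>. geodesic_on A \<gg> {0..1} \<gamma> \<and> \<gamma> 0 = p0 \<and> \<gamma> 1 = p \<longrightarrow>
        (\<forall>s\<in>{0<..<1}. \<gamma> s \<in> E))"

definition convex_at ::
  "('a::topological_space, 'e::euclidean_space) chart set \<Rightarrow> ('a, 'e) metric_field \<Rightarrow>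
    'a set \<Rightarrow> ('a \<Rightarrow> real) \<Rightarrow> 'a \<Rightarrow> bool" where
  "convex_at A \<gg> E h p0 \<longleftrightarrow>
     (\<forall>p\<in>E. \<forall>\<gamma>. geodesic_on A \<gg> {0..1} \<gamma> \<and> \<gamma> 0 = p0 \<and> \<gamma> 1 = p \<longrightarrow>
        (\<forall>s\<in>{0<..<1}. h (\<gamma> s) \<le> (1 - s) * h p0 + s * h p))"

definition cw_convex_at ::
  "('a::topological_space, 'e::euclidean_space) chart set \<Rightarrow> ('a, 'e) metric_field \<Rightarrow>
    'a set \<Rightarrow> ('a \<Rightarrow> real interval) \<Rightarrow> 'a \<Rightarrow> bool" where
  "cw_convex_at A \<gg> E h p0 \<longleftrightarrow>
     convex_at A \<gg> E (\<lambda>p. ctr (h p)) p0 \<and> convex_at A \<gg> E (\<lambda>p. hw (h p)) p0"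

definition geodesic_in_direction ::
  "('a::topological_space, 'e::euclidean_space) chart set \<Rightarrow> ('a, 'e) metric_field \<Rightarrow>
    'a set \<Rightarrow> 'a \<Rightarrow> ('a, 'e) tangent \<Rightarrow> real set \<Rightarrow> (real \<Rightarrow> 'a) \<Rightarrow> bool" where
  "geodesic_in_direction A \<gg> E p0 X I \<gamma> \<longleftrightarrow>
     geodesic_on A \<gg> I \<gamma> \<and> (\<exists>\<epsilon>>0. {0..<\<epsilon>} \<subseteq> I) \<and> \<gamma> ` I \<subseteq> E \<and> \<gamma> 0 = p0 \<and> velocity A I \<gamma> 0 = X"

definition tangent_directions ::
  "('a::topological_space, 'e::euclidean_space) chart set \<Rightarrow> ('a, 'e) metric_field \<Rightarrow>
    'a set \<Rightarrow> 'a \<Rightarrow> ('a, 'e) tangent set" where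
  "tangent_directions A \<gg> E p0 =
     {X \<in> tangent_space A p0. \<exists>I \<gamma>. geodesic_in_direction A \<gg> E p0 X I \<gamma>}"

text \<open>
  The derivative in direction \<open>X\<close> is the limit along any geodesic in \<open>E\<close> with initial velocity
  \<open>X\<close>. Two such geodesics agree near 0 on the right, by uniqueness for the geodesic equation, so
  "along every one" and "along one" mean the same.
\<close>

definition has_dir_deriv ::
  "('a::topological_space, 'e::euclidean_space) chart set \<Rightarrow> ('a, 'e) metric_field \<Rightarrow>
    'a set \<Rightarrow> ('a \<Rightarrow> real) \<Rightarrow> 'a \<Rightarrow> ('a, 'e) tangent \<Rightarrow> real \<Rightarrow> bool" where
  "has_dir_deriv A \<gg> E h p0 X L \<longleftrightarrow>
     (\<forall>I \<gamma>. geodesic_in_direction A \<gg> E p0 X I \<gamma> \<longrightarrow>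
        ((\<lambda>s. (h (\<gamma> s) - h p0) / s) \<longlongrightarrow> L) (at_right 0))"

definition dir_differentiable ::
  "('a::topological_space, 'e::euclidean_space) chart set \<Rightarrow> ('a, 'e) metric_field \<Rightarrow>
    'a set \<Rightarrow> ('a \<Rightarrow> real) \<Rightarrow> 'a \<Rightarrow> bool" where
  "dir_differentiable A \<gg> E h p0 \<longleftrightarrow>
     (\<forall>X\<in>tangent_directions A \<gg> E p0. \<exists>L. has_dir_deriv A \<gg> E h p0 X L)"

definition dir_deriv ::
  "('a::topological_space, 'e::euclidean_space) chart set \<Rightarrow> ('a, 'e) metric_field \<Rightarrow>
    'a set \<Rightarrow> ('a \<Rightarrow> real) \<Rightarrow> 'a \<Rightarrow> ('a, 'e) tangent \<Rightarrow> real" where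
  "dir_deriv A \<gg> E h p0 X = (THE L. has_dir_deriv A \<gg> E h p0 X L)"

definition has_gH_dir_deriv ::
  "('a::topological_space, 'e::euclidean_space) chart set \<Rightarrow> ('a, 'e) metric_field \<Rightarrow>
    'a set \<Rightarrow> ('a \<Rightarrow> real interval) \<Rightarrow> 'a \<Rightarrow> ('a, 'e) tangent \<Rightarrow> real interval \<Rightarrow> bool" where
  "has_gH_dir_deriv A \<gg> E h p0 X L \<longleftrightarrow>
     (\<forall>I \<gamma>. geodesic_in_direction A \<gg> E p0 X I \<gamma> \<longrightarrow>
        interval_tendsto (\<lambda>s. interval_of (1 / s) * (h (\<gamma> s) \<ominus>\<^sub>g\<^sub>H h p0)) L (at_right 0))"

definition gH_dir_differentiable ::
  "('a::topological_space, 'e::euclidean_space) chart set \<Rightarrow> ('a, 'e) metric_field \<Rightarrow>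
    'a set \<Rightarrow> ('a \<Rightarrow> real interval) \<Rightarrow> 'a \<Rightarrow> bool" where
  "gH_dir_differentiable A \<gg> E h p0 \<longleftrightarrow>
     (\<forall>X\<in>tangent_directions A \<gg> E p0. \<exists>L. has_gH_dir_deriv A \<gg> E h p0 X L)"

definition gH_dir_deriv ::
  "('a::topological_space, 'e::euclidean_space) chart set \<Rightarrow> ('a, 'e) metric_field \<Rightarrow>
    'a set \<Rightarrow> ('a \<Rightarrow> real interval) \<Rightarrow> 'a \<Rightarrow> ('a, 'e) tangent \<Rightarrow> real interval" where
  "gH_dir_deriv A \<gg> E h p0 X = (THE L. has_gH_dir_deriv A \<gg> E h p0 X L)"


section \<open>The optimization problem\<close>

text \<open>
  "Non-constant" is used in the sense of taking distinct values at distinct points, which is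
  stronger than not being constant.
\<close>

definition nonconstant_on :: "('a \<Rightarrow> 'b) \<Rightarrow> 'a set \<Rightarrow> bool" where
  "nonconstant_on h X \<longleftrightarrow> (\<forall>p\<in>X. \<forall>q\<in>X. p \<noteq> q \<longrightarrow> h p \<noteq> h q)"

definition feasible_set :: "'a set \<Rightarrow> nat \<Rightarrow> (nat \<Rightarrow> 'a \<Rightarrow> real interval) \<Rightarrow> 'a set" where
  "feasible_set E m g = {p \<in> E. \<forall>i\<in>{1..m}. g i p \<le>\<^sub>m\<^sub>i\<^sub>n 0}"

definition optimal_solution :: "('a \<Rightarrow> real interval) \<Rightarrow> 'a set \<Rightarrow> 'a \<Rightarrow> bool" where
  "optimal_solution f X p0 \<longleftrightarrow> p0 \<in> X \<and> \<not> (\<exists>p\<in>X. f p <\<^sub>m\<^sub>i\<^sub>n f p0)"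

definition strict_optimal_solution :: "('a \<Rightarrow> real interval) \<Rightarrow> 'a set \<Rightarrow> 'a \<Rightarrow> bool" where
  "strict_optimal_solution f X p0 \<longleftrightarrow> p0 \<in> X \<and> \<not> (\<exists>p\<in>X. p \<noteq> p0 \<and> f p \<le>\<^sub>m\<^sub>i\<^sub>n f p0)"

end

theory Submission
  imports Defs
begin

text \<open>
  The theorem rests on the Hopf-Rinow theorem: in a complete Riemannian manifold any two points are
  joined by a geodesic. Along a geodesic from \<open>p0\<close> to a feasible point \<open>p\<close>, convexity at \<open>p0\<close> bounds
  the directional derivatives by \<open>h p - h p0\<close> and, for the active constraints, by the center of
  \<open>g i p\<close>, which is nonpositive; complementary slackness removes the inactive constraints, and the
  stationarity condition gives \<open>h p0 \<le> h p\<close>.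

  For Hopf-Rinow, short geodesics between nearby points of a chart are obtained from the contraction
  principle applied to the boundary value problem. At such a geodesic \<open>q\<close> the first variation of the
  energy is exact and the second variation is dominated by its leading term, so a curve \<open>c\<close> with the
  same endpoints has energy at least that of \<open>q\<close> plus a multiple of \<open>sup |c - q|\<^sup>2\<close>. Hence short
  geodesics are the unique minimisers. Completeness and a maximality argument produce a curve
  realising the distance between two given points, and locally this curve is a short geodesic.
\<close>

subsection \<open>Integration of piecewise continuous functions\<close>

text \<open>Geodesics are built from their two endpoints rather than from initial data, since both
  the local comparison and the final argument start from a pair of points. The comparison uses
  energy because it is quadratic in the velocity, so that the constants \<open>lam\<close>
  (coercivity) and \<open>M\<close> (size and variation of the metric) control every term. Lengths
  follow after a change of parameter. The excess term in the energy bound is essential. The curve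
  produced by the maximality argument is only known to be an isometric image of an interval, without
  any derivative, so it cannot be inserted into a variational argument. It is identified with a
  short geodesic point by point: each of its points splits a distance additively, the two short
  geodesics through that point have together the energy of the direct one, and the excess term
  forces the point onto the latter. Metric completeness enters as the convergence of a Cauchy
  sequence of points on a partial ray. In the optimality part one geodesic per feasible point is
  enough: star-shapedness keeps it in \<open>E\<close>, so its initial velocity is an admissible
  direction.\<close>

lemma integrable_bounded_off_finite:
  fixes f :: "real \<Rightarrow> 'b::euclidean_space"
  assumes S: "finite S" and cont: "continuous_on ({a..b} - S) f"
    and B: "\<And>x. x \<in> {a..b} - S \<Longrightarrow> norm (f x) \<le> B"
  shows "f integrable_on {a..b}"
proof -
  let ?T = "{a..b} - S"
  have T: "?T \<in> sets lebesgue" using S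
    by (intro sets.Diff) (auto intro: negligible_imp_sets)
  have neg: "negligible (({a..b} - ?T) \<union> (?T - {a..b}))"
    using S by (auto intro: negligible_subset[of S])
  have "(\<lambda>x. B) integrable_on ?T"
    using integrable_spike_set_eq[OF neg, of "\<lambda>x. B"] by (simp add: integrable_const_ivl)
  then have "f integrable_on ?T"
    by (rule measurable_bounded_by_integrable_imp_integrable[OF
          continuous_imp_measurable_on_sets_lebesgue[OF cont T]]) (use T B in auto)
  then show ?thesis using integrable_spike_set_eq[OF neg] by blast
qed

lemma integral_le_off_finite:
  fixes f g :: "real \<Rightarrow> real"
  assumes S: "finite S" and f: "f integrable_on {a..b}" and g: "g integrable_on {a..b}"
    and le: "\<And>x. x \<in> {a..b} - S \<Longrightarrow> f x \<le> g x"
  shows "integral {a..b} f \<le> integral {a..b} g"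
proof -
  define f2 where "f2 x = (if x \<in> S then g x else f x)" for x
  have "(f2 has_integral integral {a..b} f) {a..b}"
    by (rule has_integral_spike_finite[OF S _ integrable_integral[OF f]]) (simp add: f2_def)
  then show ?thesis
    by (rule has_integral_le[OF _ integrable_integral[OF g]]) (use le in \<open>auto simp: f2_def\<close>)
qed

text \<open>Cauchy-Schwarz against the constant 1, obtained by integrating the square of the
  deviation of \<open>f\<close> from its mean.\<close>

lemma integral_square_le:
  fixes f :: "real \<Rightarrow> real"
  assumes f: "f integrable_on {0..1}" and f2: "(\<lambda>x. (f x)\<^sup>2) integrable_on {0..1}"
  shows "(integral {0..1} f)\<^sup>2 \<le> integral {0..1} (\<lambda>x. (f x)\<^sup>2)"
proof -
  define m where "m = integral {0..1} f"
  have "((\<lambda>x. (f x)\<^sup>2 - 2 * m * f x + m\<^sup>2) has_integral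
      (integral {0..1} (\<lambda>x. (f x)\<^sup>2) - 2 * m * m + m\<^sup>2 * (1 - 0))) {0..1}"
    unfolding m_def
    by (intro has_integral_add has_integral_diff has_integral_mult_right integrable_integral f f2)
      (use has_integral_const_real[of "(integral {0..1} f)\<^sup>2" 0 1] in simp)
  then have "0 \<le> integral {0..1} (\<lambda>x. (f x)\<^sup>2) - 2 * m * m + m\<^sup>2 * (1 - 0)"
  proof (rule has_integral_nonneg)
    fix x :: real
    have "(f x)\<^sup>2 - 2 * m * f x + m\<^sup>2 = (f x - m)\<^sup>2" by (simp add: power2_eq_square algebra_simps)
    then show "0 \<le> (f x)\<^sup>2 - 2 * m * f x + m\<^sup>2" by simp
  qed
  then show ?thesis by (simp add: m_def power2_eq_square)
qed

lemma has_vector_derivative_within_interior_ivl: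
  fixes f :: "real \<Rightarrow> 'b::real_normed_vector"
  assumes "(f has_vector_derivative D) (at t within {a..b})" "a < t" "t < b"
  shows "(f has_vector_derivative D) (at t)"
  using assms by (metis at_within_interior greaterThanLessThan_iff interior_atLeastAtMost_real)


subsection \<open>A metric tensor on a convex region of Euclidean space\<close>

text \<open>Reduces continuity and differentiability of the tensor along a curve to those of
  finitely many scalar components.\<close>

lemma bilinear_expand:
  fixes B :: "'e::euclidean_space \<Rightarrow> 'e \<Rightarrow> real"
  assumes "bilinear B"
  shows "B u w = (\<Sum>i\<in>Basis. \<Sum>j\<in>Basis. (u \<bullet> i) * (w \<bullet> j) * B i j)"
proof -
  have "B u w = B (\<Sum>i\<in>Basis. (u \<bullet> i) *\<^sub>R i) (\<Sum>j\<in>Basis. (w \<bullet> j) *\<^sub>R j)"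
    by (simp add: euclidean_representation)
  also have "\<dots> = (\<Sum>i\<in>Basis. \<Sum>j\<in>Basis. B ((u \<bullet> i) *\<^sub>R i) ((w \<bullet> j) *\<^sub>R j))"
    by (simp add: bilinear_sum[OF assms] sum.cartesian_product)
  finally show ?thesis by (simp add: bilinear_lmul[OF assms] bilinear_rmul[OF assms] mult_ac)
qed

text \<open>Derivatives are taken within \<open>K\<close>, so a closed coordinate ball qualifies,
  and convexity of \<open>K\<close> makes the mean value theorem available. The single constant
  \<open>M\<close> bounds the tensor, its derivative and the Lipschitz constant of that derivative.
  The last argument of \<open>DG\<close> is the direction of differentiation.\<close>

locale metric_region =
  fixes K :: "'e::euclidean_space set" and G :: "'e \<Rightarrow> 'e \<Rightarrow> 'e \<Rightarrow> real"
    and DG :: "'e \<Rightarrow> 'e \<Rightarrow> 'e \<Rightarrow> 'e \<Rightarrow> real" and lam M :: real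
  assumes K: "convex K"
    and lam: "0 < lam" and M: "0 < M"
    and bil: "x \<in> K \<Longrightarrow> bilinear (G x)"
    and sym: "x \<in> K \<Longrightarrow> G x v w = G x w v"
    and coercive: "x \<in> K \<Longrightarrow> lam * (norm v)\<^sup>2 \<le> G x v v"
    and bound: "x \<in> K \<Longrightarrow> \<bar>G x v w\<bar> \<le> M * norm v * norm w"
    and deriv: "x \<in> K \<Longrightarrow> ((\<lambda>y. G y v w) has_derivative DG x v w) (at x within K)"
    and Dbil: "x \<in> K \<Longrightarrow> bilinear (\<lambda>v w. DG x v w u)"
    and Dbound: "x \<in> K \<Longrightarrow> \<bar>DG x v w u\<bar> \<le> M * norm v * norm w * norm u"
    and DLip: "x \<in> K \<Longrightarrow> y \<in> K \<Longrightarrow>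
      \<bar>DG x v w u - DG y v w u\<bar> \<le> M * norm (x - y) * norm v * norm w * norm u"
begin

lemma Dlin: "x \<in> K \<Longrightarrow> linear (DG x v w)"
  using deriv has_derivative_linear by blast

lemmas G_simps =
  bilinear_ladd[OF bil] bilinear_radd[OF bil] bilinear_lsub[OF bil] bilinear_rsub[OF bil]
  bilinear_lmul[OF bil] bilinear_rmul[OF bil] bilinear_lzero[OF bil] bilinear_rzero[OF bil]
  bilinear_lneg[OF bil] bilinear_rneg[OF bil]

lemmas DG_simps =
  bilinear_ladd[OF Dbil] bilinear_radd[OF Dbil] bilinear_lsub[OF Dbil] bilinear_rsub[OF Dbil]
  bilinear_lmul[OF Dbil] bilinear_rmul[OF Dbil] bilinear_lneg[OF Dbil] bilinear_rneg[OF Dbil]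
  linear_add[OF Dlin] linear_diff[OF Dlin] linear_cmul[OF Dlin] linear_neg[OF Dlin]

lemma G_nonneg: "x \<in> K \<Longrightarrow> 0 \<le> G x v v"
  using coercive[of x v] lam by (meson less_imp_le mult_nonneg_nonneg order_trans zero_le_power2)

lemma G_Lip:
  assumes "x \<in> K" "y \<in> K"
  shows "\<bar>G x v w - G y v w\<bar> \<le> M * norm (x - y) * norm v * norm w"
proof -
  have "norm (G x v w - G y v w) \<le> M * norm v * norm w * norm (x - y)"
    using K
  proof (rule differentiable_bound[where f' = "\<lambda>x. DG x v w"])
    show "\<And>z. z \<in> K \<Longrightarrow> ((\<lambda>y. G y v w) has_derivative DG z v w) (at z within K)" by (rule deriv)
    show "\<And>z. z \<in> K \<Longrightarrow> onorm (DG z v w) \<le> M * norm v * norm w"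
      by (rule onorm_le) (use Dbound in auto)
  qed (use assms in auto)
  then show ?thesis by (simp add: mult_ac)
qed

text \<open>The mean value theorem is applied on the segment to the tensor minus its linear part.
  The derivative of this difference is a difference of values of \<open>DG\<close>, hence of order
  \<open>norm u\<close> by \<open>DLip\<close>, and multiplying by the direction makes the error
  quadratic in \<open>u\<close>.\<close>

lemma G_Taylor:
  assumes x: "x \<in> K" "x + u \<in> K"
  shows "\<bar>G (x + u) v v - G x v v - DG x v v u\<bar> \<le> M * (norm u)\<^sup>2 * (norm v)\<^sup>2"
proof -
  define \<phi> where "\<phi> t = G (x + t *\<^sub>R u) v v - t * DG x v v u" for t :: real
  have in_K: "x + t *\<^sub>R u \<in> K" if "t \<in> {0..1}" for t
  proof -
    have "(1 - t) *\<^sub>R x + t *\<^sub>R (x + u) \<in> K" using K x that by (auto simp: convex_alt)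
    then show ?thesis by (simp add: algebra_simps)
  qed
  have d: "(\<phi> has_derivative (\<lambda>s. s * (DG (x + t *\<^sub>R u) v v u - DG x v v u))) (at t within {0..1})"
    if t: "t \<in> {0..1}" for t
  proof -
    have "((\<lambda>t. G (x + t *\<^sub>R u) v v) has_derivative (\<lambda>s. DG (x + t *\<^sub>R u) v v (s *\<^sub>R u)))
        (at t within {0..1})"
      by (rule has_derivative_in_compose2[OF deriv, where s = "{0..1}"])
        (use in_K t in \<open>auto intro!: derivative_eq_intros\<close>)
    then show ?thesis unfolding \<phi>_def
      by (auto intro!: derivative_eq_intros simp: linear_cmul[OF Dlin[OF in_K[OF t]]] algebra_simps)
  qed
  have "norm (\<phi> 1 - \<phi> 0) \<le> (M * norm u * norm v * norm v * norm u) * norm (1 - 0 :: real)"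
  proof (rule differentiable_bound[OF _ d])
    show "onorm (\<lambda>s. s * (DG (x + t *\<^sub>R u) v v u - DG x v v u)) \<le> M * norm u * norm v * norm v * norm u"
      if t: "t \<in> {0..1}" for t
    proof (rule onorm_le)
      fix s :: real
      have "\<bar>DG (x + t *\<^sub>R u) v v u - DG x v v u\<bar> \<le> M * norm (x + t *\<^sub>R u - x) * norm v * norm v * norm u"
        by (rule DLip) (use in_K t x in auto)
      also have "\<dots> \<le> M * norm u * norm v * norm v * norm u"
        using t M by (intro mult_right_mono mult_left_mono) (auto simp: mult_left_le_one_le)
      finally show "norm (s * (DG (x + t *\<^sub>R u) v v u - DG x v v u))
          \<le> M * norm u * norm v * norm v * norm u * norm s"
        by (simp add: abs_mult mult.commute mult_left_mono)
    qed
  qed auto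
  then show ?thesis by (simp add: \<phi>_def power2_eq_square mult_ac)
qed

lemma G_continuous:
  assumes c: "continuous_on T c" and u: "continuous_on T u" and w: "continuous_on T w"
    and K': "\<And>s. s \<in> T \<Longrightarrow> c s \<in> K"
  shows "continuous_on T (\<lambda>s. G (c s) (u s) (w s))"
proof -
  have "continuous_on K (\<lambda>x. G x i j)" for i j
    using deriv has_derivative_continuous continuous_on_eq_continuous_within by metis
  then have "continuous_on T (\<lambda>s. G (c s) i j)" for i j
    using continuous_on_compose2[OF _ c] K' by blast
  then have "continuous_on T (\<lambda>s. \<Sum>i\<in>Basis. \<Sum>j\<in>Basis. (u s \<bullet> i) * (w s \<bullet> j) * G (c s) i j)"
    by (intro continuous_intros u w)
  then show ?thesis
    by (rule continuous_on_eq) (use bilinear_expand[OF bil[OF K']] in auto)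
qed

lemma G_has_vector_derivative:
  assumes q: "(q has_vector_derivative q') (at t within T)"
    and u: "(u has_vector_derivative u') (at t within T)"
    and w: "(w has_vector_derivative w') (at t within T)"
    and K': "\<And>s. s \<in> T \<Longrightarrow> q s \<in> K" and t: "t \<in> T"
  shows "((\<lambda>s. G (q s) (u s) (w s)) has_vector_derivative
      DG (q t) (u t) (w t) q' + G (q t) u' (w t) + G (q t) (u t) w') (at t within T)"
proof -
  have qt: "q t \<in> K" using K' t by auto
  have G': "((\<lambda>s. G (q s) i j) has_real_derivative DG (q t) i j q') (at t within T)" for i j
  proof -
    have "((\<lambda>s. G (q s) i j) has_derivative (\<lambda>s. DG (q t) i j (s *\<^sub>R q'))) (at t within T)"
      by (rule has_derivative_in_compose2[OF deriv, where s = T])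
        (use K' t q[unfolded has_vector_derivative_def] in auto)
    then show ?thesis
      by (simp add: has_field_derivative_def linear_cmul[OF Dlin[OF qt]] mult_commute_abs)
  qed
  have u2: "((\<lambda>s. u s \<bullet> i) has_real_derivative u' \<bullet> i) (at t within T)"
    and w2: "((\<lambda>s. w s \<bullet> i) has_real_derivative w' \<bullet> i) (at t within T)" for i
    using bounded_linear.has_vector_derivative[OF bounded_linear_inner_left u, of i]
      bounded_linear.has_vector_derivative[OF bounded_linear_inner_left w, of i]
    by (simp_all add: has_real_derivative_iff_has_vector_derivative)
  have "((\<lambda>s. \<Sum>i\<in>Basis. \<Sum>j\<in>Basis. (u s \<bullet> i) * (w s \<bullet> j) * G (q s) i j) has_real_derivative
     (\<Sum>i\<in>Basis. \<Sum>j\<in>Basis. (u t \<bullet> i) * (w t \<bullet> j) * DG (q t) i j q'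
        + ((u' \<bullet> i) * (w t \<bullet> j) + (u t \<bullet> i) * (w' \<bullet> j)) * G (q t) i j)) (at t within T)"
    by (auto intro!: derivative_eq_intros G' u2 w2 sum.cong simp: algebra_simps)
  also have "(\<Sum>i\<in>Basis. \<Sum>j\<in>Basis. (u t \<bullet> i) * (w t \<bullet> j) * DG (q t) i j q'
        + ((u' \<bullet> i) * (w t \<bullet> j) + (u t \<bullet> i) * (w' \<bullet> j)) * G (q t) i j)
      = DG (q t) (u t) (w t) q' + G (q t) u' (w t) + G (q t) (u t) w'"
    unfolding bilinear_expand[OF Dbil[OF qt], of "u t" "w t"]
      bilinear_expand[OF bil[OF qt], of u' "w t"] bilinear_expand[OF bil[OF qt], of "u t" w']
    by (simp add: sum.distrib algebra_simps)
  finally have "((\<lambda>s. \<Sum>i\<in>Basis. \<Sum>j\<in>Basis. (u s \<bullet> i) * (w s \<bullet> j) * G (q s) i j)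
      has_vector_derivative DG (q t) (u t) (w t) q' + G (q t) u' (w t) + G (q t) (u t) w') (at t within T)"
    by (simp add: has_real_derivative_iff_has_vector_derivative)
  then show ?thesis
    by (rule has_vector_derivative_transform[rotated 2]) (use t bilinear_expand[OF bil[OF K']] in auto)
qed


subsection \<open>The geodesic spray\<close>

text \<open>The quadratic Christoffel term \<open>Gamma(u,u)\<close> with its index lowered, that
  is, the Koszul formula with equal arguments. The geodesic equation is
  \<open>q'' = - spray q q'\<close>.\<close>

definition spray :: "'e \<Rightarrow> 'e \<Rightarrow> 'e" where
  "spray x u = (THE z. \<forall>v. G x z v = (DG x u v u + DG x u v u - DG x u u v) / 2)"

lemma G_inject:
  assumes x: "x \<in> K" and eq: "\<And>v. G x z v = G x z' v"
  shows "z = z'"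
proof -
  have "lam * (norm (z - z'))\<^sup>2 \<le> G x (z - z') (z - z')" by (rule coercive[OF x])
  also have "\<dots> = 0" using eq by (simp add: bilinear_lsub[OF bil[OF x]])
  finally show ?thesis using lam by (simp add: mult_le_0_iff)
qed

text \<open>The map \<open>T\<close> lists the values of the functional \<open>G x z\<close> on the
  basis. It is injective by nondegeneracy, hence surjective in finite dimension.\<close>

lemma G_Riesz:
  assumes x: "x \<in> K" and l: "linear l"
  shows "\<exists>!z. \<forall>v. G x z v = l v"
proof -
  define T where "T z = (\<Sum>b\<in>Basis. G x z b *\<^sub>R b)" for z
  have T_b: "T z \<bullet> b = G x z b" if "b \<in> Basis" for z b
    using that by (simp add: T_def inner_sum_left inner_Basis if_distrib if_distribR sum.delta cong: if_cong)
  have lin: "linear T" unfolding T_def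
    by (rule linearI)
      (simp_all add: bilinear_ladd[OF bil[OF x]] bilinear_lmul[OF bil[OF x]] scaleR_add_left
        sum.distrib scaleR_sum_right)
  have ext: "\<forall>v. G x z v = l' v" if "linear l'" "\<And>b. b \<in> Basis \<Longrightarrow> G x z b = l' b" for z l'
  proof -
    have "linear (G x z)" using bil[OF x] by (simp add: bilinear_def)
    then show ?thesis using linear_eq_stdbasis[OF _ that(1)] that(2) by metis
  qed
  have "inj T"
  proof (rule injI)
    fix z z' assume "T z = T z'"
    then have "\<And>b. b \<in> Basis \<Longrightarrow> G x z b = G x z' b" using T_b by metis
    moreover have "linear (G x z')" using bil[OF x] by (simp add: bilinear_def)
    ultimately show "z = z'" using ext G_inject[OF x] by blast
  qed
  then have "surj T" using linear_injective_imp_surjective[OF lin] by blast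
  then obtain z where z: "T z = (\<Sum>b\<in>Basis. l b *\<^sub>R b)" by (metis surjD)
  have "G x z b = l b" if "b \<in> Basis" for b
    unfolding T_b[OF that, symmetric] z using that
    by (simp add: inner_sum_left inner_Basis if_distrib if_distribR sum.delta cong: if_cong)
  then have "\<forall>v. G x z v = l v" using ext[OF l] by blast
  then show ?thesis using G_inject[OF x] by metis
qed

lemma spray_eq:
  assumes x: "x \<in> K"
  shows "G x (spray x u) v = DG x u v u - DG x u u v / 2"
proof -
  have "linear (\<lambda>v. (DG x u v u + DG x u v u - DG x u u v) / 2)"
    by (rule linearI) (simp_all add: DG_simps x algebra_simps add_divide_distrib diff_divide_distrib)
  from theI'[OF G_Riesz[OF x this]] show ?thesis unfolding spray_def by (simp add: field_simps)
qed

text \<open>Homogeneity of degree two is what makes the geodesic equation invariant under affine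
  changes of time.\<close>

lemma spray_scaleR:
  assumes x: "x \<in> K"
  shows "spray x (k *\<^sub>R u) = k\<^sup>2 *\<^sub>R spray x u"
  by (rule G_inject[OF x])
    (simp add: spray_eq G_simps DG_simps x power2_eq_square algebra_simps)

text \<open>The constant of \<open>spray_Lip\<close>. There \<open>2 * M\<close> rounds up the
  factor \<open>3/2 * M\<close> from changing point and velocity in the derivative terms,
  \<open>2 * M * M / lam\<close> comes from changing the metric in front of a spray of size
  \<open>2 * M / lam\<close>, and the outer division by \<open>lam\<close> is coercivity.\<close>

definition spray_const :: real where
  "spray_const = (2 * M + 2 * M * M / lam) / lam"

lemma spray_const_pos: "0 < spray_const" and spray_const_ge: "2 * M / lam \<le> spray_const"
  using lam M by (auto simp: spray_const_def add_pos_pos intro!: divide_right_mono)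

text \<open>The defining identity is tested with the spray itself and one factor of its norm is
  cancelled.\<close>

lemma spray_bound:
  assumes x: "x \<in> K"
  shows "norm (spray x u) \<le> 2 * M / lam * (norm u)\<^sup>2"
proof -
  let ?z = "spray x u"
  have "lam * (norm ?z)\<^sup>2 \<le> DG x u ?z u - DG x u u ?z / 2"
    using coercive[OF x] spray_eq[OF x] by metis
  also have "\<dots> \<le> M * norm u * norm ?z * norm u + M * norm u * norm u * norm ?z / 2"
    using Dbound[OF x, of u ?z u] Dbound[OF x, of u u ?z] by linarith
  also have "\<dots> \<le> 2 * M * (norm u)\<^sup>2 * norm ?z"
    using M by (simp add: power2_eq_square)
  finally have *: "lam * norm ?z * norm ?z \<le> 2 * M * (norm u)\<^sup>2 * norm ?z"
    by (simp add: power2_eq_square mult_ac)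
  show ?thesis
  proof (cases "?z = 0")
    case True
    then show ?thesis using M lam by simp
  next
    case False
    with * have "lam * norm ?z \<le> 2 * M * (norm u)\<^sup>2" by simp
    then show ?thesis using lam by (simp add: field_simps)
  qed
qed

text \<open>The difference \<open>z\<close> of the two sprays is tested with itself. By coercivity
  \<open>lam * |z|^2\<close> is at most a sum of three terms, caused by the change of base point in
  the derivative terms, the change of velocity in them, and the change of the metric applied to
  \<open>spray y w\<close>. Each term carries a factor \<open>|z|\<close>, which cancels.\<close>

lemma spray_Lip:
  assumes x: "x \<in> K" and y: "y \<in> K"
  shows "norm (spray x u - spray y w) \<le>
    spray_const * (norm (x - y) * ((norm u)\<^sup>2 + (norm w)\<^sup>2) + norm (u - w) * (norm u + norm w))"
proof -
  define z where "z = spray x u - spray y w"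
  define k where "k x u = DG x u z u - DG x u u z / 2" for x u
  define nu nw nz n m where "nu = norm u" and "nw = norm w" and "nz = norm z"
    and "n = norm (x - y)" and "m = norm (u - w)"
  note nn = nu_def nw_def nz_def n_def m_def
  have nonneg: "0 \<le> nu" "0 \<le> nw" "0 \<le> nz" "0 \<le> n" "0 \<le> m" by (simp_all add: nn)
  have "k x u - k y u \<le> 3/2 * M * n * nu\<^sup>2 * nz"
    using DLip[OF x y, of u z u] DLip[OF x y, of u u z]
    unfolding k_def nn power2_eq_square by (simp add: mult_ac)
  moreover have "k y u - k y w \<le> 3/2 * M * m * (nu + nw) * nz"
  proof -
    have "k y u - k y w = DG y (u - w) z u + DG y w z (u - w)
        - (DG y (u - w) u z + DG y w (u - w) z) / 2"
      using y unfolding k_def by (simp add: DG_simps field_simps)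
    moreover have "\<bar>DG y (u - w) z u\<bar> \<le> M * m * nu * nz" "\<bar>DG y w z (u - w)\<bar> \<le> M * m * nw * nz"
      "\<bar>DG y (u - w) u z\<bar> \<le> M * m * nu * nz" "\<bar>DG y w (u - w) z\<bar> \<le> M * m * nw * nz"
      using Dbound[OF y, of "u - w" z u] Dbound[OF y, of w z "u - w"]
        Dbound[OF y, of "u - w" u z] Dbound[OF y, of w "u - w" z]
      unfolding nn by (simp_all only: mult_ac)
    ultimately have "k y u - k y w \<le> 3/2 * (M * m * nu * nz) + 3/2 * (M * m * nw * nz)"
      unfolding abs_le_iff by argo
    then show ?thesis by (simp add: algebra_simps)
  qed
  moreover have "G y (spray y w) z - G x (spray y w) z \<le> M * n * (2 * M / lam * nw\<^sup>2) * nz"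
  proof -
    have "G y (spray y w) z - G x (spray y w) z \<le> M * n * norm (spray y w) * nz"
      using G_Lip[OF x y, of "spray y w" z] unfolding nn by linarith
    also have "\<dots> \<le> M * n * (2 * M / lam * nw\<^sup>2) * nz"
      using spray_bound[OF y, of w] M nonneg unfolding nw_def
      by (intro mult_right_mono mult_left_mono) auto
    finally show ?thesis .
  qed
  moreover have "lam * nz\<^sup>2 \<le> k x u - k y w + (G y (spray y w) z - G x (spray y w) z)"
  proof -
    have "G x z z = k x u - G x (spray y w) z"
      using spray_eq[OF x, of u z] unfolding k_def
      by (subst z_def) (simp add: bilinear_lsub[OF bil[OF x]])
    moreover have "G y (spray y w) z = k y w" using spray_eq[OF y] by (simp add: k_def)
    ultimately show ?thesis using coercive[OF x, of z] by (simp add: nz_def)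
  qed
  ultimately have "lam * nz\<^sup>2 \<le> 3/2 * M * n * nu\<^sup>2 * nz + 3/2 * M * m * (nu + nw) * nz
      + M * n * (2 * M / lam * nw\<^sup>2) * nz"
    by linarith
  then have *: "lam * nz\<^sup>2 \<le>
      (3/2 * M * n * nu\<^sup>2 + 3/2 * M * m * (nu + nw) + M * n * (2 * M / lam * nw\<^sup>2)) * nz"
    by (simp add: algebra_simps)
  define Q where "Q = n * (nu\<^sup>2 + nw\<^sup>2) + m * (nu + nw)"
  have "3/2 * M * n * nu\<^sup>2 + 3/2 * M * m * (nu + nw) + M * n * (2 * M / lam * nw\<^sup>2)
      \<le> (2 * M + 2 * M * M / lam) * Q"
  proof -
    define L a b c where "L = 2 * M * M / lam" and "a = n * nu\<^sup>2" and "b = n * nw\<^sup>2"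
      and "c = m * (nu + nw)"
    have "0 \<le> M * a" "0 \<le> M * b" "0 \<le> M * c" "0 \<le> L * a" "0 \<le> L * c"
      using M lam nonneg by (simp_all add: L_def a_def b_def c_def)
    then have "3/2 * (M * a) + 3/2 * (M * c) + L * b \<le> (2 * M + L) * (a + b + c)"
      unfolding distrib_left distrib_right by argo
    moreover have "a + b + c = Q" by (simp add: Q_def a_def b_def c_def distrib_left)
    ultimately show ?thesis by (simp add: L_def a_def b_def c_def mult_ac)
  qed
  with * have "lam * nz\<^sup>2 \<le> (2 * M + 2 * M * M / lam) * Q * nz"
    using nonneg by (meson mult_right_mono order_trans)
  then have le: "lam * nz * nz \<le> (2 * M + 2 * M * M / lam) * Q * nz"
    by (simp add: power2_eq_square)
  have "nz \<le> spray_const * Q"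
  proof (cases "nz = 0")
    case True
    have "0 \<le> Q" unfolding Q_def using nonneg by simp
    then show ?thesis using True spray_const_pos by simp
  next
    case False
    with le nonneg have "lam * nz \<le> (2 * M + 2 * M * M / lam) * Q" by simp
    then show ?thesis unfolding spray_const_def using lam by (simp add: field_simps)
  qed
  then show ?thesis unfolding z_def Q_def nn .
qed


subsection \<open>Short geodesics between prescribed endpoints\<close>

text \<open>The second-order equation is written as a first-order system with the velocity as a
  separate function. The Euclidean bound \<open>h\<close> on the velocity is the small parameter of
  the comparison estimates.\<close>

definition short_geodesic :: "(real \<Rightarrow> 'e) \<Rightarrow> (real \<Rightarrow> 'e) \<Rightarrow> real \<Rightarrow> bool" where
  "short_geodesic q q' h \<longleftrightarrow> (\<forall>s\<in>{0..1}. q s \<in> K \<and> norm (q' s) \<le> h \<and>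
     (q has_vector_derivative q' s) (at s within {0..1}) \<and>
     (q' has_vector_derivative - spray (q s) (q' s)) (at s within {0..1}))"

lemma short_geodesic_continuous:
  assumes "short_geodesic q q' h"
  shows "continuous_on {0..1} q" "continuous_on {0..1} q'"
  using assms unfolding short_geodesic_def continuous_on_eq_continuous_within
  by (blast intro: has_vector_derivative_continuous)+

lemma spray_continuous:
  assumes u: "continuous_on T u" and w: "continuous_on T w"
    and K': "\<And>s. s \<in> T \<Longrightarrow> u s \<in> K"
  shows "continuous_on T (\<lambda>s. spray (u s) (w s))"
  unfolding continuous_on_def
proof
  fix t assume t: "t \<in> T"
  have ut: "(u \<longlongrightarrow> u t) (at t within T)" and wt: "(w \<longlongrightarrow> w t) (at t within T)"
    using u w t by (auto simp: continuous_on_def)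
  have "((\<lambda>s. spray_const * (norm (u s - u t) * ((norm (w s))\<^sup>2 + (norm (w t))\<^sup>2)
      + norm (w s - w t) * (norm (w s) + norm (w t)))) \<longlongrightarrow>
     spray_const * (norm (u t - u t) * ((norm (w t))\<^sup>2 + (norm (w t))\<^sup>2)
      + norm (w t - w t) * (norm (w t) + norm (w t)))) (at t within T)"
    by (intro tendsto_intros ut wt)
  then have "((\<lambda>s. spray_const * (norm (u s - u t) * ((norm (w s))\<^sup>2 + (norm (w t))\<^sup>2)
      + norm (w s - w t) * (norm (w s) + norm (w t)))) \<longlongrightarrow> 0) (at t within T)" by simp
  moreover have "eventually (\<lambda>s. norm (spray (u s) (w s) - spray (u t) (w t)) \<le>
      spray_const * (norm (u s - u t) * ((norm (w s))\<^sup>2 + (norm (w t))\<^sup>2)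
      + norm (w s - w t) * (norm (w s) + norm (w t)))) (at t within T)"
    unfolding eventually_at_filter using spray_Lip K' t by (auto intro!: eventuallyI)
  ultimately have "((\<lambda>s. spray (u s) (w s) - spray (u t) (w t)) \<longlongrightarrow> 0) (at t within T)"
    by (rule Lim_null_comparison[rotated])
  then show "((\<lambda>s. spray (u s) (w s)) \<longlongrightarrow> spray (u t) (w t)) (at t within T)"
    by (simp add: LIM_zero_iff)
qed

text \<open>The velocity \<open>w\<close> of the sought geodesic is a fixed point of
  \<open>w \<mapsto> y - x + (\<lambda>s. \<integral>\<^sub>0\<^sup>s F w - m w)\<close>, where \<open>F w\<close> is minus the spray along the curve with velocity
  \<open>w\<close> and \<open>m w\<close> is the mean of \<open>\<integral>\<^sub>0\<^sup>s F w\<close>. This is a contraction on the functions bounded by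
  \<open>2 |y - x|\<close>.\<close>

lemma short_geodesic_exists:
  assumes n: "norm (y - x) \<le> 1" "48 * spray_const * norm (y - x) \<le> 1"
    and sub: "cball x (2 * norm (y - x)) \<subseteq> K"
  obtains q q' where "short_geodesic q q' (2 * norm (y - x))" "q 0 = x" "q 1 = y"
proof -
  define v where "v = y - x"
  define n where "n = norm v"
  define C where "C = spray_const"
  define P where "P w s = x + integral {0..s} (apply_bcontfun w)" for w :: "real \<Rightarrow>\<^sub>C 'e" and s :: real
  define F where "F w r = - spray (P w r) (w r)" for w r
  define I where "I w s = integral {0..s} (F w)" for w s
  define m where "m w = integral {0..1} (I w)" for w
  \<comment> \<open>Bounded continuous functions live on the whole line, so the argument is clamped
    to \<open>[0,1]\<close>, outside of which the values carry no information. Subtracting the mean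
    makes the integral of \<open>T w\<close> over \<open>[0,1]\<close> equal to \<open>v\<close>, so
    a fixed point is the velocity of a curve that ends in \<open>y\<close>.\<close>
  define T where "T w = Bcontfun (\<lambda>s. v + I w (min 1 (max 0 s)) - m w)" for w
  define W where "W = {w :: real \<Rightarrow>\<^sub>C 'e. \<forall>s. norm (w s) \<le> 2 * n}"
  have C: "0 < C" "2 * M / lam \<le> C" using spray_const_pos spray_const_ge by (auto simp: C_def)
  have n0: "0 \<le> n" "n \<le> 1" "48 * C * n \<le> 1" using n by (simp_all add: n_def v_def C_def)
  have Cn2: "0 \<le> C * n\<^sup>2" "48 * (C * n\<^sup>2) \<le> n"
  proof -
    have "48 * C * n * n \<le> 1 * n" using n0 by (intro mult_right_mono) auto
    then show "48 * (C * n\<^sup>2) \<le> n" by (simp add: power2_eq_square mult_ac)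
  qed (use C in simp)
  have wint: "(apply_bcontfun w) integrable_on {a..b}" for w :: "real \<Rightarrow>\<^sub>C 'e" and a b
    by (rule integrable_continuous_interval) simp
  have norm_int: "norm (integral {0..s} f) \<le> B"
    if "f integrable_on {0..s}" "s \<in> {0..1}" "0 \<le> B" "\<And>r. r \<in> {0..s} \<Longrightarrow> norm (f r) \<le> B"
    for f :: "real \<Rightarrow> 'e" and s B
  proof -
    have "norm (integral {0..s} f) \<le> B * Henstock_Kurzweil_Integration.content {0..s}"
      by (rule has_integral_bound_real[OF that(3) finite.emptyI integrable_integral[OF that(1)]])
        (use that in auto)
    also have "\<dots> \<le> B" using that by (simp add: mult_left_le)
    finally show ?thesis .
  qed
  have P_K: "P w s \<in> K" if "w \<in> W" "s \<in> {0..1}" for w s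
  proof -
    have "norm (integral {0..s} w) \<le> 2 * n"
      by (rule norm_int) (use that wint n0 in \<open>auto simp: W_def\<close>)
    then have "P w s \<in> cball x (2 * n)" by (simp add: P_def dist_norm)
    then show ?thesis using sub by (auto simp: n_def v_def)
  qed
  have P_deriv: "(P w has_vector_derivative w s) (at s within {0..1})" if "s \<in> {0..1}" for w s
    unfolding P_def using integral_has_vector_derivative[OF continuous_on_apply_bcontfun that, of w]
    by (auto intro!: derivative_eq_intros)
  have P_cont: "continuous_on {0..1} (P w)" for w
    using P_deriv has_vector_derivative_continuous continuous_on_eq_continuous_within by blast
  have F_cont: "continuous_on {0..1} (F w)" if "w \<in> W" for w
    unfolding F_def using P_K[OF that] by (intro continuous_intros spray_continuous P_cont) auto
  have F_int: "F w integrable_on {0..s}" if "w \<in> W" "s \<in> {0..1}" for w s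
    by (rule integrable_continuous_interval, rule continuous_on_subset[OF F_cont]) (use that in auto)
  have I_deriv: "(I w has_vector_derivative F w s) (at s within {0..1})"
    if "w \<in> W" "s \<in> {0..1}" for w s
    unfolding I_def by (rule integral_has_vector_derivative[OF F_cont]) (use that in auto)
  have I_cont: "continuous_on {0..1} (I w)" if "w \<in> W" for w
    using I_deriv[OF that] has_vector_derivative_continuous continuous_on_eq_continuous_within by blast
  have F_bound: "norm (F w s) \<le> 4 * (C * n\<^sup>2)" if w: "w \<in> W" and s: "s \<in> {0..1}" for w s
  proof -
    have "norm (F w s) \<le> 2 * M / lam * (norm (w s))\<^sup>2"
      using spray_bound[OF P_K[OF w s]] by (simp add: F_def)
    also have "\<dots> \<le> C * (2 * n)\<^sup>2"
      using w C by (intro mult_mono power_mono) (auto simp: W_def)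
    finally show ?thesis by (simp add: power2_eq_square)
  qed
  have I_bound: "norm (I w s) \<le> 4 * (C * n\<^sup>2)" if w: "w \<in> W" and s: "s \<in> {0..1}" for w s
    unfolding I_def by (rule norm_int[OF F_int[OF w s] s]) (use Cn2 F_bound[OF w] s in auto)
  have m_bound: "norm (m w) \<le> 4 * (C * n\<^sup>2)" if w: "w \<in> W" for w
    unfolding m_def
    by (rule norm_int[OF integrable_continuous_interval[OF I_cont[OF w]]])
      (use Cn2 I_bound[OF w] in auto)
  have clamp: "min 1 (max 0 s) \<in> {0..1::real}" for s by auto
  have T_apply: "T w s = v + I w (min 1 (max 0 s)) - m w"
    and T_norm: "norm (T w s) \<le> 2 * n" if w: "w \<in> W" for w s
  proof -
    have b: "norm (v + I w (min 1 (max 0 s)) - m w) \<le> 2 * n" for s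
    proof -
      have "norm (v + I w (min 1 (max 0 s)) - m w) \<le> n + 4 * (C * n\<^sup>2) + 4 * (C * n\<^sup>2)"
        unfolding n_def
        by (intro order_trans[OF norm_triangle_ineq4] order_trans[OF norm_triangle_ineq] add_mono
            order_refl I_bound[OF w clamp, unfolded n_def] m_bound[OF w, unfolded n_def])
      also have "\<dots> \<le> 2 * n" using Cn2 by linarith
      finally show ?thesis .
    qed
    have "continuous_on UNIV (\<lambda>s. v + I w (min 1 (max 0 s)) - m w)"
      by (intro continuous_intros continuous_on_compose2[OF I_cont[OF w]]) auto
    then have "(\<lambda>s. v + I w (min 1 (max 0 s)) - m w) \<in> bcontfun"
      using b by (rule bcontfun_normI)
    then show "T w s = v + I w (min 1 (max 0 s)) - m w"
      by (simp add: T_def Bcontfun_inverse)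
    then show "norm (T w s) \<le> 2 * n" using b by simp
  qed
  have lip: "dist (T w1) (T w2) \<le> 1/2 * dist w1 w2" if w: "w1 \<in> W" "w2 \<in> W" for w1 w2
  proof -
    define D where "D = dist w1 w2"
    have D: "0 \<le> D" "norm (w1 r - w2 r) \<le> D" for r
      using dist_bounded[of w1 r w2] by (simp_all add: D_def dist_norm)
    \<comment> \<open>Origin of the constant 48: the factor here is
      \<open>8 * n^2 + 4 * n <= 12 * n\<close>, and it occurs once for \<open>I\<close> and once for
      \<open>m\<close>. The total \<open>24 * C * n\<close> has to be at most
      \<open>1/2\<close>.\<close>
    have F_diff: "norm (F w1 r - F w2 r) \<le> 12 * C * n * D" if r: "r \<in> {0..1}" for r
    proof -
      have "P w1 r - P w2 r = integral {0..r} (\<lambda>s. w1 s - w2 s)"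
        by (simp add: P_def integral_diff wint)
      then have Pd: "norm (P w1 r - P w2 r) \<le> D"
        using norm_int[of "\<lambda>s. w1 s - w2 s" r D] r D by (simp add: integrable_diff wint)
      have wn: "norm (w1 r) \<le> 2 * n" "norm (w2 r) \<le> 2 * n" using w by (auto simp: W_def)
      then have wn2: "(norm (w1 r))\<^sup>2 \<le> (2 * n)\<^sup>2" "(norm (w2 r))\<^sup>2 \<le> (2 * n)\<^sup>2"
        using power_mono[OF _ norm_ge_zero] by blast+
      have "norm (F w1 r - F w2 r) = norm (spray (P w1 r) (w1 r) - spray (P w2 r) (w2 r))"
        by (simp add: F_def norm_minus_commute)
      also have "\<dots> \<le> C * (norm (P w1 r - P w2 r) * ((norm (w1 r))\<^sup>2 + (norm (w2 r))\<^sup>2)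
          + norm (w1 r - w2 r) * (norm (w1 r) + norm (w2 r)))"
        unfolding C_def by (rule spray_Lip) (use P_K w r in auto)
      also have "\<dots> \<le> C * (D * ((2 * n)\<^sup>2 + (2 * n)\<^sup>2) + D * (2 * n + 2 * n))"
        using C D wn wn2 Pd n0 by (intro mult_left_mono add_mono mult_mono) auto
      also have "\<dots> = C * D * (8 * (n * n) + 4 * n)" by (simp add: power2_eq_square algebra_simps)
      also have "\<dots> \<le> C * D * (8 * (1 * n) + 4 * n)"
        using C D n0 by (intro mult_left_mono add_mono mult_right_mono) auto
      finally show ?thesis by (simp add: mult_ac)
    qed
    have nn: "0 \<le> 12 * C * n * D" using C D n0 by simp
    have I_diff: "norm (I w1 s - I w2 s) \<le> 12 * C * n * D" if s: "s \<in> {0..1}" for s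
    proof -
      have "I w1 s - I w2 s = integral {0..s} (\<lambda>r. F w1 r - F w2 r)"
        by (simp add: I_def integral_diff[OF F_int[OF w(1) s] F_int[OF w(2) s]])
      then show ?thesis
        using norm_int[of "\<lambda>r. F w1 r - F w2 r" s "12 * C * n * D"] s nn F_diff
          integrable_diff[OF F_int[OF w(1) s] F_int[OF w(2) s]]
        by simp
    qed
    have m_diff: "norm (m w1 - m w2) \<le> 12 * C * n * D"
    proof -
      have ii: "I w integrable_on {0..1}" if "w \<in> W" for w
        using integrable_continuous_interval[OF I_cont[OF that]] .
      have "m w1 - m w2 = integral {0..1} (\<lambda>r. I w1 r - I w2 r)"
        by (simp add: m_def integral_diff[OF ii[OF w(1)] ii[OF w(2)]])
      then show ?thesis
        using norm_int[of "\<lambda>r. I w1 r - I w2 r" 1 "12 * C * n * D"] nn I_diff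
          integrable_diff[OF ii[OF w(1)] ii[OF w(2)]]
        by simp
    qed
    have "dist (T w1 s) (T w2 s) \<le> 1/2 * D" for s
    proof -
      have "T w1 s - T w2 s = (I w1 (min 1 (max 0 s)) - I w2 (min 1 (max 0 s))) - (m w1 - m w2)"
        by (simp add: T_apply w)
      moreover have "norm (I w1 (min 1 (max 0 s)) - I w2 (min 1 (max 0 s)) - (m w1 - m w2))
          \<le> 12 * C * n * D + 12 * C * n * D"
        using norm_triangle_ineq4[of "I w1 (min 1 (max 0 s)) - I w2 (min 1 (max 0 s))" "m w1 - m w2"]
          I_diff[OF clamp, of s] m_diff
        by argo
      ultimately have "dist (T w1 s) (T w2 s) \<le> 12 * C * n * D + 12 * C * n * D"
        by (simp only: dist_norm)
      also have "\<dots> = (48 * C * n) * (D / 2)" by simp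
      also have "\<dots> \<le> 1 * (D / 2)" using n0 D by (intro mult_right_mono) auto
      finally show ?thesis by simp
    qed
    then show ?thesis unfolding D_def by (rule dist_bound)
  qed
  have "\<exists>!w\<in>W. T w = w"
  proof (rule Banach_fix[of W "1/2"])
    have "closed {w :: real \<Rightarrow>\<^sub>C 'e. norm (w s) \<le> 2 * n}" for s
    proof -
      have "continuous_on UNIV (\<lambda>w :: real \<Rightarrow>\<^sub>C 'e. w s)"
        unfolding continuous_on_iff by (metis dist_bounded le_less_trans)
      then show ?thesis by (intro closed_Collect_le continuous_intros)
    qed
    then have "closed (\<Inter>s. {w :: real \<Rightarrow>\<^sub>C 'e. norm (w s) \<le> 2 * n})" by blast
    moreover have "(\<Inter>s. {w :: real \<Rightarrow>\<^sub>C 'e. norm (w s) \<le> 2 * n}) = W" by (auto simp: W_def)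
    ultimately show "complete W" by (simp add: complete_eq_closed)
    have "const_bcontfun 0 \<in> W" using n0 by (auto simp: W_def const_bcontfun.rep_eq)
    then show "W \<noteq> {}" by blast
    show "T ` W \<subseteq> W" using T_norm by (auto simp: W_def)
  qed (use lip in auto)
  then obtain w where w: "w \<in> W" "T w = w" by blast
  have w_eq: "w s = v + I w s - m w" if "s \<in> {0..1}" for s
    using T_apply[OF w(1), of s] w(2) that by (simp add: min_absorb2 max_absorb2)
  have w_deriv: "(apply_bcontfun w has_vector_derivative F w s) (at s within {0..1})"
    if s: "s \<in> {0..1}" for s
  proof -
    have "((\<lambda>s. v + I w s - m w) has_vector_derivative F w s) (at s within {0..1})"
      by (auto intro!: derivative_eq_intros I_deriv[OF w(1) s])
    then show ?thesis
      by (rule has_vector_derivative_transform[OF s, rotated]) (simp add: w_eq)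
  qed
  show thesis
  proof (rule that)
    show "short_geodesic (P w) w (2 * norm (y - x))"
      unfolding short_geodesic_def
      using P_K[OF w(1)] P_deriv w_deriv w(1) by (auto simp: W_def n_def v_def F_def)
    show "P w 0 = x" by (simp add: P_def)
    have "integral {0..1} w = integral {0..1} (\<lambda>s. v + I w s - m w)"
      by (rule integral_cong) (rule w_eq)
    also have "\<dots> = v"
      using integrable_continuous_interval[OF I_cont[OF w(1)]]
      by (simp add: integral_diff integral_add integrable_add integrable_const_ivl m_def)
    finally show "P w 1 = y" by (simp add: P_def v_def)
  qed
qed

text \<open>Differentiation gives \<open>DG\<close> in the velocity minus twice the lowered spray.
  By \<open>spray_eq\<close> with equal arguments the lowered spray is half of that same
  \<open>DG\<close>, so everything cancels.\<close>

lemma short_geodesic_speed: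
  assumes "short_geodesic q q' h" "s \<in> {0..1}"
  shows "G (q s) (q' s) (q' s) = G (q 0) (q' 0) (q' 0)"
proof -
  have "\<exists>c. \<forall>s\<in>{0..1}. G (q s) (q' s) (q' s) = c"
  proof (rule has_derivative_zero_constant)
  show "((\<lambda>s. G (q s) (q' s) (q' s)) has_derivative (\<lambda>_. 0)) (at t within {0..1})"
    if t: "t \<in> {0..1}" for t
  proof -
    have q: "q t \<in> K" using assms(1) t by (auto simp: short_geodesic_def)
    have "((\<lambda>s. G (q s) (q' s) (q' s)) has_vector_derivative
        DG (q t) (q' t) (q' t) (q' t) + G (q t) (- spray (q t) (q' t)) (q' t)
        + G (q t) (q' t) (- spray (q t) (q' t))) (at t within {0..1})"
      using assms(1) t by (intro G_has_vector_derivative) (auto simp: short_geodesic_def)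
    moreover have "G (q t) (q' t) (spray (q t) (q' t)) = G (q t) (spray (q t) (q' t)) (q' t)"
      using sym[OF q] .
    ultimately show ?thesis
      by (simp add: spray_eq G_simps q has_vector_derivative_def)
  qed
  qed simp
  then show ?thesis using assms(2) by (metis atLeastAtMost_iff order_refl zero_le_one)
qed


subsection \<open>Short geodesics minimise energy and length\<close>

text \<open>\<open>S\<close> holds the corners, where \<open>c'\<close> may take any value. The
  bound \<open>B\<close> is there to make speed and energy integrable.\<close>

definition piecewise_curve :: "(real \<Rightarrow> 'e) \<Rightarrow> (real \<Rightarrow> 'e) \<Rightarrow> real set \<Rightarrow> real \<Rightarrow> bool" where
  "piecewise_curve c c' S B \<longleftrightarrow> finite S \<and> continuous_on {0..1} c \<and> c ` {0..1} \<subseteq> K \<and>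
     (\<forall>t\<in>{0<..<1} - S. (c has_vector_derivative c' t) (at t)) \<and>
     continuous_on ({0..1} - S) c' \<and> (\<forall>t\<in>{0..1} - S. norm (c' t) \<le> B)"

lemma piecewise_curve_energy_integrable:
  assumes c: "piecewise_curve c c' S B"
  shows "(\<lambda>s. G (c s) (c' s) (c' s)) integrable_on {0..1}"
proof (rule integrable_bounded_off_finite)
  show "finite S" using c by (simp add: piecewise_curve_def)
  have "continuous_on ({0..1} - S) c" "continuous_on ({0..1} - S) c'"
    using c continuous_on_subset[of "{0..1}" c "{0..1} - S"] by (auto simp: piecewise_curve_def)
  then show "continuous_on ({0..1} - S) (\<lambda>s. G (c s) (c' s) (c' s))"
    using c by (intro G_continuous) (auto simp: piecewise_curve_def)
  fix t assume t: "t \<in> {0..1} - S"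
  have "norm (G (c t) (c' t) (c' t)) \<le> M * norm (c' t) * norm (c' t)"
    using c t bound[of "c t"] by (auto simp: piecewise_curve_def image_subset_iff)
  also have "\<dots> \<le> M * B * B"
  proof -
    have B: "norm (c' t) \<le> B" using c t by (simp add: piecewise_curve_def)
    show ?thesis using M B order_trans[OF norm_ge_zero B] by (intro mult_mono) auto
  qed
  finally show "norm (G (c t) (c' t) (c' t)) \<le> M * B * B" .
qed

lemma piecewise_curve_speed_integrable:
  assumes c: "piecewise_curve c c' S B"
  shows "(\<lambda>s. sqrt (G (c s) (c' s) (c' s))) integrable_on {0..1}"
proof (rule integrable_bounded_off_finite)
  show "finite S" using c by (simp add: piecewise_curve_def)
  have "continuous_on ({0..1} - S) c" "continuous_on ({0..1} - S) c'"
    using c continuous_on_subset[of "{0..1}" c "{0..1} - S"] by (auto simp: piecewise_curve_def)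
  then show "continuous_on ({0..1} - S) (\<lambda>s. sqrt (G (c s) (c' s) (c' s)))"
    using c by (intro continuous_on_real_sqrt G_continuous) (auto simp: piecewise_curve_def)
  fix t assume t: "t \<in> {0..1} - S"
  have K': "c t \<in> K" and B: "norm (c' t) \<le> B" using c t by (auto simp: piecewise_curve_def)
  have "G (c t) (c' t) (c' t) \<le> M * norm (c' t) * norm (c' t)"
    using bound[OF K', of "c' t" "c' t"] by linarith
  also have "\<dots> \<le> M * B * B"
    using B M order_trans[OF norm_ge_zero B] by (intro mult_mono) auto
  finally show "norm (sqrt (G (c t) (c' t) (c' t))) \<le> sqrt (M * B * B)"
    using G_nonneg[OF K'] by simp
qed

text \<open>With \<open>\<eta> = c - q\<close> and \<open>w\<close> its derivative, the energy
  density of \<open>c\<close> is expanded around \<open>q\<close>. The constant part is the energy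
  of \<open>q\<close>, the linear part \<open>L\<close> integrates to zero, and the quadratic part
  is at least \<open>lam * |w|^2\<close> up to losses of order \<open>h\<close>. Since
  \<open>\<eta>\<close> vanishes at 0, the integral \<open>N\<close> of \<open>|w|^2\<close>
  controls \<open>\<eta>\<close> uniformly, which absorbs the losses and yields the excess
  term.\<close>

lemma energy_comparison:
  assumes q: "short_geodesic q q' h" and h: "0 \<le> h" "h \<le> 1" "6 * M * h \<le> lam"
    and c: "piecewise_curve c c' S B" and ends: "c 0 = q 0" "c 1 = q 1" and t: "t \<in> {0..1}"
  shows "G (q 0) (q' 0) (q' 0) + lam / 2 * (norm (c t - q t))\<^sup>2
    \<le> integral {0..1} (\<lambda>s. G (c s) (c' s) (c' s))"
proof -
  define \<eta> where "\<eta> s = c s - q s" for s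
  define w where "w s = c' s - q' s" for s
  define L where "L s = DG (q s) (q' s) (q' s) (\<eta> s) + 2 * G (q s) (q' s) (w s)" for s
  define N where "N = integral {0..1} (\<lambda>s. (norm (w s))\<^sup>2)"
  define E0 where "E0 = G (q 0) (q' 0) (q' 0)"
  have S: "finite S" and ccont: "continuous_on {0..1} c" and cK: "\<And>s. s \<in> {0..1} \<Longrightarrow> c s \<in> K"
    and c'cont: "continuous_on ({0..1} - S) c'" and c'B: "\<And>s. s \<in> {0..1} - S \<Longrightarrow> norm (c' s) \<le> B"
    and cder: "\<And>s. s \<in> {0<..<1} - S \<Longrightarrow> (c has_vector_derivative c' s) (at s)"
    using c by (auto simp: piecewise_curve_def)
  have qK: "q s \<in> K" and q'h: "norm (q' s) \<le> h" if "s \<in> {0..1}" for s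
    using q that by (auto simp: short_geodesic_def)
  have qder: "(q has_vector_derivative q' s) (at s)"
    and q'der: "(q' has_vector_derivative - spray (q s) (q' s)) (at s)" if "s \<in> {0<..<1}" for s
    using q that has_vector_derivative_within_interior_ivl[of q "q' s" s 0 1]
      has_vector_derivative_within_interior_ivl[of q' "- spray (q s) (q' s)" s 0 1]
    by (auto simp: short_geodesic_def)
  note qcont = short_geodesic_continuous[OF q]
  have \<eta>cont: "continuous_on {0..1} \<eta>" unfolding \<eta>_def by (intro continuous_intros ccont qcont)
  have wcont: "continuous_on ({0..1} - S) w" unfolding w_def
    by (intro continuous_intros c'cont continuous_on_subset[OF qcont(2)]) auto
  have wB: "norm (w s) \<le> B + h" if "s \<in> {0..1} - S" for s
    unfolding w_def using norm_triangle_ineq4[of "c' s" "q' s"] c'B[OF that] q'h that by force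
  have \<eta>der: "(\<eta> has_vector_derivative w s) (at s)" if "s \<in> {0<..<1} - S" for s
    unfolding \<eta>_def w_def using that by (auto intro!: derivative_eq_intros cder qder)
  have wint: "(\<lambda>s. norm (w s)) integrable_on {0..1}"
    by (rule integrable_bounded_off_finite[OF S, where B = "B + h"])
      (use wB in \<open>auto intro!: continuous_intros wcont\<close>)
  have w2int: "(\<lambda>s. (norm (w s))\<^sup>2) integrable_on {0..1}"
    by (rule integrable_bounded_off_finite[OF S, where B = "(B + h)\<^sup>2"])
      (use wB in \<open>auto intro!: continuous_intros wcont power_mono\<close>)
  \<comment> \<open>A Poincare inequality: \<open>\<eta>\<close> is the integral of \<open>w\<close>
    from 0, and Cauchy-Schwarz passes to the square.\<close>
  have \<eta>N: "(norm (\<eta> s))\<^sup>2 \<le> N" if s: "s \<in> {0..1}" for s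
  proof -
    have "(w has_integral \<eta> s - \<eta> 0) {0..s}"
      by (rule fundamental_theorem_of_calculus_interior_strong[OF S])
        (use s \<eta>der continuous_on_subset[OF \<eta>cont, of "{0..s}"] in auto)
    then have int: "(w has_integral \<eta> s) {0..s}" using ends by (simp add: \<eta>_def)
    have "norm (\<eta> s) = norm (integral {0..s} w)" using int by (simp add: integral_unique)
    also have "\<dots> \<le> integral {0..s} (\<lambda>s. norm (w s))"
      using int s
      by (intro Henstock_Kurzweil_Integration.integral_norm_bound_integral
          integrable_on_subinterval[OF wint] has_integral_integrable) auto
    also have "\<dots> \<le> integral {0..1} (\<lambda>s. norm (w s))"
      using s by (intro integral_subset_le integrable_on_subinterval[OF wint] wint) auto
    finally have "(norm (\<eta> s))\<^sup>2 \<le> (integral {0..1} (\<lambda>s. norm (w s)))\<^sup>2"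
      by (rule power_mono) simp
    also have "\<dots> \<le> N" unfolding N_def by (rule integral_square_le[OF wint w2int])
    finally show ?thesis .
  qed
  have N0: "0 \<le> N" using order_trans[OF zero_le_power2 \<eta>N[of 0]] by simp
  \<comment> \<open>The first variation of the energy at a geodesic is the integral of an exact derivative.\<close>
  have Lint: "(L has_integral 0) {0..1}"
  proof -
    have "(L has_integral (2 * G (q 1) (q' 1) (\<eta> 1) - 2 * G (q 0) (q' 0) (\<eta> 0))) {0..1}"
    proof (rule fundamental_theorem_of_calculus_interior_strong[OF S,
          where f = "\<lambda>s. 2 * G (q s) (q' s) (\<eta> s)"])
      show "continuous_on {0..1} (\<lambda>s. 2 * G (q s) (q' s) (\<eta> s))"
        by (rule continuous_on_mult[OF continuous_on_const G_continuous[OF qcont \<eta>cont qK]])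
      fix s assume s: "s \<in> {0<..<1} - S"
      then have s': "s \<in> {0<..<1}" and s1: "s \<in> {0..1}" by auto
      have "((\<lambda>s. G (q s) (q' s) (\<eta> s)) has_vector_derivative
          DG (q s) (q' s) (\<eta> s) (q' s) + G (q s) (- spray (q s) (q' s)) (\<eta> s)
          + G (q s) (q' s) (w s)) (at s within {0<..<1})"
        by (rule G_has_vector_derivative[OF has_vector_derivative_at_within[OF qder[OF s']]
            has_vector_derivative_at_within[OF q'der[OF s']]
            has_vector_derivative_at_within[OF \<eta>der[OF s]]])
          (use s' qK in auto)
      then have "((\<lambda>s. G (q s) (q' s) (\<eta> s)) has_vector_derivative
          DG (q s) (q' s) (\<eta> s) (q' s) + G (q s) (- spray (q s) (q' s)) (\<eta> s)
          + G (q s) (q' s) (w s)) (at s)"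
        by (simp only: at_within_open[OF s' open_greaterThanLessThan])
      from has_vector_derivative_mult_right[OF this, of 2]
      show "((\<lambda>s. 2 * G (q s) (q' s) (\<eta> s)) has_vector_derivative L s) (at s)"
        by (simp add: L_def spray_eq[OF qK[OF s1]] bilinear_lneg[OF bil[OF qK[OF s1]]])
    qed simp
    moreover have "G (q 1) (q' 1) (\<eta> 1) = 0" "G (q 0) (q' 0) (\<eta> 0) = 0"
      using bilinear_rzero[OF bil[OF qK]] ends by (simp_all add: \<eta>_def)
    ultimately show ?thesis by simp
  qed
  \<comment> \<open>Two sources of loss. Replacing \<open>q s\<close> by \<open>c s\<close> in the
    mixed term costs \<open>2 * M * h * |\<eta>| * |w|\<close>, split evenly between the two
    squares. The second-order Taylor remainder in the pure velocity term costs
    \<open>M * h^2 * |\<eta>|^2\<close>.\<close>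
  have pointwise: "E0 + L s + (lam - M * h) * (norm (w s))\<^sup>2 - (M * h + M * h\<^sup>2) * N
      \<le> G (c s) (c' s) (c' s)" if s: "s \<in> {0..1} - S" for s
  proof -
    have s1: "s \<in> {0..1}" using s by simp
    note K1 = qK[OF s1] cK[OF s1]
    define v e n where "v = q' s" and "e = norm (\<eta> s)" and "n = norm (w s)"
    have e0: "0 \<le> e" "0 \<le> n" by (auto simp: e_def n_def)
    have cs: "c s = q s + \<eta> s" and c's: "c' s = v + w s" by (simp_all add: \<eta>_def w_def v_def)
    have vh: "norm v \<le> h" using q'h[OF s1] by (simp add: v_def)
    have "\<bar>G (c s) v v - G (q s) v v - DG (q s) v v (\<eta> s)\<bar> \<le> M * e\<^sup>2 * (norm v)\<^sup>2"
      unfolding cs e_def by (rule G_Taylor) (use K1 cs in auto)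
    also have "\<dots> \<le> M * e\<^sup>2 * h\<^sup>2"
      using vh M by (intro mult_left_mono power_mono) auto
    finally have 1: "G (c s) v v \<ge> G (q s) v v + DG (q s) v v (\<eta> s) - M * e\<^sup>2 * h\<^sup>2" by linarith
    have "\<bar>G (c s) v (w s) - G (q s) v (w s)\<bar> \<le> M * e * norm v * n"
      using G_Lip[OF K1(2,1), of v "w s"] by (simp add: e_def n_def \<eta>_def)
    also have "\<dots> \<le> M * e * h * n"
      using vh M e0 by (intro mult_right_mono mult_left_mono) auto
    finally have 2: "G (c s) v (w s) \<ge> G (q s) v (w s) - M * e * h * n" by linarith
    have 3: "G (c s) (w s) (w s) \<ge> lam * n\<^sup>2" using coercive[OF K1(2)] by (simp add: n_def)
    have 4: "G (c s) (c' s) (c' s) = G (c s) v v + 2 * G (c s) v (w s) + G (c s) (w s) (w s)"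
      unfolding c's using sym[OF K1(2), of v "w s"]
      by (simp add: bilinear_ladd[OF bil[OF K1(2)]] bilinear_radd[OF bil[OF K1(2)]])
    have 5: "G (q s) v v = E0"
      using short_geodesic_speed[OF q s1] by (simp add: v_def E0_def)
    have 6: "2 * (M * e * h * n) \<le> M * h * e\<^sup>2 + M * h * n\<^sup>2"
    proof -
      have "0 \<le> M * h * (e - n)\<^sup>2" using M h by simp
      then show ?thesis by (simp add: power2_eq_square algebra_simps)
    qed
    have 7: "(M * h + M * h\<^sup>2) * e\<^sup>2 \<le> (M * h + M * h\<^sup>2) * N"
      using \<eta>N[OF s1] M h by (intro mult_left_mono) (auto simp: e_def)
    have 8: "(M * h + M * h\<^sup>2) * e\<^sup>2 = M * h * e\<^sup>2 + M * e\<^sup>2 * h\<^sup>2"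
      "(lam - M * h) * n\<^sup>2 = lam * n\<^sup>2 - M * h * n\<^sup>2" by (simp_all add: algebra_simps)
    have "L s = DG (q s) v v (\<eta> s) + 2 * G (q s) v (w s)" by (simp add: L_def v_def)
    then show ?thesis using 1 2 3 4 5 6 7 8 unfolding n_def[symmetric] by linarith
  qed
  have "((\<lambda>s. E0 + L s + (lam - M * h) * (norm (w s))\<^sup>2 - (M * h + M * h\<^sup>2) * N)
      has_integral (E0 + 0 + (lam - M * h) * N - (M * h + M * h\<^sup>2) * N)) {0..1}"
    unfolding N_def
    by (intro has_integral_add has_integral_diff has_integral_mult_right integrable_integral
        w2int Lint)
      (use has_integral_const_real[of _ 0 1] in \<open>auto simp del: has_integral_const_real\<close>)
  note bnd = this
  have "E0 + 0 + (lam - M * h) * N - (M * h + M * h\<^sup>2) * N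
      \<le> integral {0..1} (\<lambda>s. G (c s) (c' s) (c' s))"
    using integral_le_off_finite[OF S has_integral_integrable[OF bnd]
        piecewise_curve_energy_integrable[OF c] pointwise]
    unfolding integral_unique[OF bnd] by blast
  \<comment> \<open>As \<open>h^2 <= h\<close>, the losses add up to at most
    \<open>3 * M * h\<close>, and the hypothesis \<open>6 * M * h <= lam\<close> makes this at most
    half of \<open>lam\<close>.\<close>
  moreover have "lam / 2 * N \<le> (lam - M * h) * N - (M * h + M * h\<^sup>2) * N"
  proof -
    have "M * h\<^sup>2 \<le> M * h" using M h by (simp add: power2_eq_square mult_left_le)
    then have "lam / 2 \<le> lam - M * h - (M * h + M * h\<^sup>2)" using h by linarith
    from mult_right_mono[OF this N0] show ?thesis by (simp add: algebra_simps)
  qed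
  moreover have "lam / 2 * (norm (c t - q t))\<^sup>2 \<le> lam / 2 * N"
    using \<eta>N[OF t] lam by (intro mult_left_mono) (auto simp: \<eta>_def)
  ultimately show ?thesis unfolding E0_def by linarith
qed

text \<open>Reparametrisation by the arc length of a slightly elongated curve, whose speed
  \<open>sqrt (|c'|\<^sup>2 + \<epsilon>\<^sup>2)\<close> does not vanish.\<close>

lemma piecewise_curve_reparametrize:
  assumes c: "piecewise_curve c c' S B" and \<epsilon>: "0 < \<epsilon>"
  obtains d d' S' B' where "piecewise_curve d d' S' B'" "d 0 = c 0" "d 1 = c 1"
    "integral {0..1} (\<lambda>s. G (d s) (d' s) (d' s))
      \<le> (integral {0..1} (\<lambda>s. sqrt (G (c s) (c' s) (c' s))) + \<epsilon>)\<^sup>2"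
proof -
  define g where "g t = G (c t) (c' t) (c' t)" for t
  define F where "F t = sqrt (g t + \<epsilon>\<^sup>2)" for t
  define \<phi> where "\<phi> t = integral {0..t} F" for t
  define l where "l = \<phi> 1"
  have S: "finite S" and ccont: "continuous_on {0..1} c" and cK: "\<And>s. s \<in> {0..1} \<Longrightarrow> c s \<in> K"
    and c'cont: "continuous_on ({0..1} - S) c'" and c'B: "\<And>s. s \<in> {0..1} - S \<Longrightarrow> norm (c' s) \<le> B"
    and cder: "\<And>s. s \<in> {0<..<1} - S \<Longrightarrow> (c has_vector_derivative c' s) (at s)"
    using c by (auto simp: piecewise_curve_def)
  have g0: "0 \<le> g t" if "t \<in> {0..1}" for t unfolding g_def by (rule G_nonneg[OF cK[OF that]])
  have gcont: "continuous_on ({0..1} - S) g" unfolding g_def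
    by (intro G_continuous continuous_on_subset[OF ccont] c'cont) (use cK in auto)
  have gB: "g t \<le> M * B * B" if t: "t \<in> {0..1} - S" for t
  proof -
    have "g t \<le> M * norm (c' t) * norm (c' t)"
      using bound[OF cK, of t "c' t" "c' t"] t by (auto simp: g_def)
    also have "\<dots> \<le> M * B * B"
      using c'B[OF t] M order_trans[OF norm_ge_zero c'B[OF t]] by (intro mult_mono) auto
    finally show ?thesis .
  qed
  have F_ge: "\<epsilon> \<le> F t" if "t \<in> {0..1}" for t
    unfolding F_def using g0[OF that] \<epsilon> by (intro real_le_rsqrt) simp
  have Fcont: "continuous_on ({0..1} - S) F" unfolding F_def by (intro continuous_intros gcont)
  have Fint: "F integrable_on {0..1}"
  proof (rule integrable_bounded_off_finite[OF S Fcont])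
    fix t assume t: "t \<in> {0..1} - S"
    then show "norm (F t) \<le> sqrt (M * B * B + \<epsilon>\<^sup>2)"
      using gB[OF t] g0[of t] by (simp add: F_def)
  qed
  have Fint': "F integrable_on {a..b}" if "0 \<le> a" "b \<le> 1" for a b
    by (rule integrable_on_subinterval[OF Fint]) (use that in auto)
  have \<phi>_diff: "\<epsilon> * (b - a) \<le> \<phi> b - \<phi> a" if "0 \<le> a" "a \<le> b" "b \<le> 1" for a b
  proof -
    have "\<phi> b - \<phi> a = integral {a..b} F"
      unfolding \<phi>_def
      using Henstock_Kurzweil_Integration.integral_combine[of 0 a b F] Fint'[of 0 b] that by simp
    moreover have "integral {a..b} (\<lambda>_. \<epsilon>) \<le> integral {a..b} F"
      by (rule integral_le) (use that Fint' F_ge in auto)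
    ultimately show ?thesis using that by (simp add: mult.commute)
  qed
  have \<phi>0: "\<phi> 0 = 0" by (simp add: \<phi>_def)
  have l: "0 < l" using \<phi>_diff[of 0 1] \<epsilon> \<phi>0 by (simp add: l_def)
  have \<phi>cont: "continuous_on {0..1} \<phi>"
    unfolding \<phi>_def by (rule indefinite_integral_continuous_1[OF Fint])
  have \<phi>der: "(\<phi> has_vector_derivative F t) (at t)" if t: "t \<in> {0<..<1} - S" for t
  proof -
    have "(\<phi> has_vector_derivative F t) (at t within ({0..1} - S))"
      unfolding \<phi>_def using t Fcont
      by (intro integral_has_vector_derivative_continuous_at[OF Fint _ S])
        (auto simp: continuous_on_eq_continuous_within)
    moreover have "at t within ({0..1} - S) = at t"
    proof (rule at_within_interior)
      have "t \<in> {0<..<1} - S" "open ({0<..<1::real} - S)"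
        using t S by (auto intro: open_Diff finite_imp_closed)
      then show "t \<in> interior ({0..1} - S)"
        by (intro interiorI[of "{0<..<1} - S"]) auto
    qed
    ultimately show ?thesis by simp
  qed
  have \<phi>_less: "\<phi> a < \<phi> b" if "0 \<le> a" "a < b" "b \<le> 1" for a b
    using \<phi>_diff[of a b] that \<epsilon> by (smt (verit) mult_pos_pos)
  have \<phi>inj: "inj_on \<phi> {0..1}"
  proof (rule inj_onI)
    fix a b :: real assume "a \<in> {0..1}" "b \<in> {0..1}" "\<phi> a = \<phi> b"
    then show "a = b" using \<phi>_less[of a b] \<phi>_less[of b a] by (cases a b rule: linorder_cases) auto
  qed
  have \<phi>img: "\<phi> ` {0..1} = {0..l}"
  proof
    show "\<phi> ` {0..1} \<subseteq> {0..l}"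
    proof safe
      fix t :: real assume "t \<in> {0..1}"
      then have "0 \<le> \<epsilon> * (t - 0)" "0 \<le> \<epsilon> * (1 - t)" using \<epsilon> by auto
      then show "\<phi> t \<in> {0..l}"
        using \<phi>_diff[of 0 t] \<phi>_diff[of t 1] \<phi>0 \<open>t \<in> {0..1}\<close> by (simp add: l_def)
    qed
    show "{0..l} \<subseteq> \<phi> ` {0..1}"
      using IVT'[OF _ _ _ \<phi>cont] \<phi>0 unfolding l_def by force
  qed
  define \<psi> where "\<psi> = the_inv_into {0..1} \<phi>"
  have \<psi>\<phi>: "\<psi> (\<phi> t) = t" if "t \<in> {0..1}" for t
    unfolding \<psi>_def by (rule the_inv_into_f_f[OF \<phi>inj that])
  have \<phi>\<psi>: "\<phi> (\<psi> u) = u" and \<psi>_in: "\<psi> u \<in> {0..1}" if "u \<in> {0..l}" for u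
  proof -
    have "u \<in> \<phi> ` {0..1}" using that by (simp only: \<phi>img)
    then obtain t where t: "u = \<phi> t" "t \<in> {0..1}" by (rule imageE)
    show "\<phi> (\<psi> u) = u" "\<psi> u \<in> {0..1}" unfolding t(1) \<psi>\<phi>[OF t(2)] by (rule refl, rule t(2))
  qed
  have \<psi>cont: "continuous_on {0..l} \<psi>"
    unfolding \<phi>img[symmetric]
    by (rule continuous_on_inv[OF \<phi>cont compact_Icc]) (simp add: \<psi>\<phi>)
  have \<psi>0: "\<psi> 0 = 0" and \<psi>l: "\<psi> l = 1" using \<psi>\<phi>[of 0] \<psi>\<phi>[of 1] \<phi>0 by (auto simp: l_def)
  define d where "d s = c (\<psi> (l * s))" for s
  define d' where "d' s = (l / F (\<psi> (l * s))) *\<^sub>R c' (\<psi> (l * s))" for s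
  define S' where "S' = (\<lambda>t. \<phi> t / l) ` S"
  have ls: "l * s \<in> {0..l}" if "s \<in> {0..1}" for s using that l by (auto simp: mult_left_le)
  have notS: "\<psi> (l * s) \<in> {0..1} - S" if "s \<in> {0..1} - S'" for s
  proof -
    have s: "s \<in> {0..1}" using that by simp
    have "\<psi> (l * s) \<notin> S"
    proof
      assume "\<psi> (l * s) \<in> S"
      then have "\<phi> (\<psi> (l * s)) / l \<in> S'" unfolding S'_def by (rule imageI)
      then show False using that l unfolding \<phi>\<psi>[OF ls[OF s]] by simp
    qed
    then show ?thesis using \<psi>_in[OF ls[OF s]] by simp
  qed
  have \<psi>lcont: "continuous_on {0..1} (\<lambda>s. \<psi> (l * s))"
    by (rule continuous_on_compose2[OF \<psi>cont continuous_on_mult_left[OF continuous_on_id]])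
      (use ls in blast)
  have dcont: "continuous_on {0..1} d" unfolding d_def
    by (rule continuous_on_compose2[OF ccont \<psi>lcont]) (use ls \<psi>_in in blast)
  have Fpos: "0 < F (\<psi> (l * s))" if "s \<in> {0..1}" for s
    using F_ge[OF \<psi>_in[OF ls[OF that]]] \<epsilon> by linarith
  have \<psi>lcont': "continuous_on ({0..1} - S') (\<lambda>s. \<psi> (l * s))"
    by (rule continuous_on_subset[OF \<psi>lcont]) simp
  have d'cont: "continuous_on ({0..1} - S') d'"
    unfolding d'_def
  proof (intro continuous_on_scaleR continuous_on_divide continuous_on_const)
    show "continuous_on ({0..1} - S') (\<lambda>s. F (\<psi> (l * s)))"
      by (rule continuous_on_compose2[OF Fcont \<psi>lcont']) (use notS in blast)
    show "continuous_on ({0..1} - S') (\<lambda>s. c' (\<psi> (l * s)))"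
      by (rule continuous_on_compose2[OF c'cont \<psi>lcont']) (use notS in blast)
    show "\<forall>s\<in>{0..1} - S'. F (\<psi> (l * s)) \<noteq> 0" using Fpos by (simp add: less_imp_neq[symmetric])
  qed
  have F2: "(F t)\<^sup>2 = g t + \<epsilon>\<^sup>2" if "t \<in> {0..1}" for t
    using g0[OF that] by (simp add: F_def)
  have d'B: "norm (d' s) \<le> l / sqrt lam" if s: "s \<in> {0..1} - S'" for s
  proof -
    let ?t = "\<psi> (l * s)"
    have t: "?t \<in> {0..1}" using notS[OF s] by simp
    have "lam * (norm (c' ?t))\<^sup>2 \<le> g ?t" unfolding g_def by (rule coercive[OF cK[OF t]])
    also have "\<dots> \<le> (F ?t)\<^sup>2" using F2[OF t] by simp
    finally have "(sqrt lam * norm (c' ?t))\<^sup>2 \<le> (F ?t)\<^sup>2"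
      using lam by (simp add: power_mult_distrib)
    moreover have Ft: "0 < F ?t" using Fpos[of s] s by simp
    ultimately have le: "sqrt lam * norm (c' ?t) \<le> F ?t"
      by (meson less_imp_le power2_le_imp_le)
    have "norm (d' s) = l * norm (c' ?t) / F ?t" using l Ft by (simp add: d'_def)
    also have "\<dots> \<le> l / sqrt lam"
      using mult_left_mono[OF le, of l] l lam Ft by (simp add: divide_le_eq le_divide_eq mult_ac)
    finally show ?thesis .
  qed
  have dder: "(d has_vector_derivative d' s) (at s)" if s: "s \<in> {0<..<1} - S'" for s
  proof -
    let ?t = "\<psi> (l * s)"
    have s1: "s \<in> {0..1}" using s by auto
    have ls': "0 < l * s" "l * s < l" using s l by auto
    have "?t \<noteq> 0" "?t \<noteq> 1" using \<phi>\<psi>[OF ls[OF s1]] \<phi>0 l_def ls' by auto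
    moreover have "?t \<in> {0..1} - S" using s by (intro notS) auto
    ultimately have t: "?t \<in> {0<..<1} - S" by auto
    have "(\<psi> has_real_derivative inverse (F ?t)) (at (l * s))"
    proof (rule DERIV_inverse_function[where f = \<phi> and a = 0 and b = l])
      show "(\<phi> has_real_derivative F ?t) (at ?t)"
        using \<phi>der[OF t] by (simp add: has_real_derivative_iff_has_vector_derivative)
      show "isCont \<psi> (l * s)"
        by (rule continuous_on_interior[OF \<psi>cont]) (use ls' in simp)
    qed (use Fpos[OF s1] ls' \<phi>\<psi> in auto)
    then have "((\<lambda>s. \<psi> (l * s)) has_real_derivative inverse (F ?t) * (l * 1)) (at s)"
      by (rule DERIV_chain2) (auto intro!: derivative_eq_intros)
    then have "((\<lambda>s. \<psi> (l * s)) has_vector_derivative l / F ?t) (at s)"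
      by (simp add: has_real_derivative_iff_has_vector_derivative divide_inverse mult.commute)
    from vector_diff_chain_at[OF this cder[OF t]]
    show ?thesis unfolding d_def d'_def comp_def .
  qed
  have d: "piecewise_curve d d' S' (l / sqrt lam)"
    unfolding piecewise_curve_def
    using S dcont dder d'cont d'B cK \<psi>_in ls by (auto simp: S'_def d_def)
  \<comment> \<open>The squared speed of \<open>d\<close> is \<open>l^2 * g / F^2\<close>, which is
    at most \<open>l^2\<close> because \<open>g <= F^2\<close>.\<close>
  have energy: "integral {0..1} (\<lambda>s. G (d s) (d' s) (d' s)) \<le> l\<^sup>2"
  proof -
    have "integral {0..1} (\<lambda>s. G (d s) (d' s) (d' s)) \<le> integral {0..1::real} (\<lambda>_. l\<^sup>2)"
    proof (rule integral_le[OF piecewise_curve_energy_integrable[OF d]])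
      fix s :: real assume s: "s \<in> {0..1}"
      let ?t = "\<psi> (l * s)"
      have t: "?t \<in> {0..1}" by (rule \<psi>_in[OF ls[OF s]])
      have "G (d s) (d' s) (d' s) = (l / F ?t)\<^sup>2 * g ?t"
        using cK[OF t] by (simp add: d_def d'_def g_def G_simps power2_eq_square)
      also have "\<dots> \<le> (l / F ?t)\<^sup>2 * (F ?t)\<^sup>2" using F2[OF t] by (intro mult_left_mono) auto
      also have "\<dots> = l\<^sup>2" using Fpos[OF s] by (simp add: power_divide)
      finally show "G (d s) (d' s) (d' s) \<le> l\<^sup>2" .
    qed auto
    then show ?thesis by simp
  qed
  have "l \<le> integral {0..1} (\<lambda>s. sqrt (G (c s) (c' s) (c' s))) + \<epsilon>"
  proof -
    have sint: "(\<lambda>s. sqrt (g s)) integrable_on {0..1}"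
      unfolding g_def by (rule piecewise_curve_speed_integrable[OF c])
    have "l \<le> integral {0..1} (\<lambda>s. sqrt (g s) + \<epsilon>)"
      unfolding l_def \<phi>_def
    proof (rule integral_le[OF Fint])
      show "(\<lambda>s. sqrt (g s) + \<epsilon>) integrable_on {0..1}"
        by (intro integrable_add sint integrable_const_ivl)
      fix t :: real assume "t \<in> {0..1}"
      then show "F t \<le> sqrt (g t) + \<epsilon>"
        unfolding F_def using g0 \<epsilon> by (intro real_le_lsqrt) (auto simp: power2_sum)
    qed
    also have "\<dots> = integral {0..1} (\<lambda>s. sqrt (g s)) + \<epsilon>"
      using sint by (simp add: integral_add integrable_const_ivl)
    finally show ?thesis by (simp add: g_def)
  qed
  then have "l\<^sup>2 \<le> (integral {0..1} (\<lambda>s. sqrt (G (c s) (c' s) (c' s))) + \<epsilon>)\<^sup>2"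
    using l by (intro power_mono) auto
  with energy show thesis
    using that[OF d] by (simp add: d_def \<psi>0 \<psi>l)
qed

text \<open>Cauchy-Schwarz bounds the square of a length by the energy, which is the wrong direction
  for this purpose. After reparametrisation the energy of the competitor is at most
  \<open>(length + \<epsilon>)^2\<close>, and then the energy comparison applies.\<close>

lemma length_comparison:
  assumes q: "short_geodesic q q' h" and h: "0 \<le> h" "h \<le> 1" "6 * M * h \<le> lam"
    and c: "piecewise_curve c c' S B" and ends: "c 0 = q 0" "c 1 = q 1"
  shows "sqrt (G (q 0) (q' 0) (q' 0)) \<le> integral {0..1} (\<lambda>s. sqrt (G (c s) (c' s) (c' s)))"
proof (rule field_le_epsilon)
  fix \<epsilon> :: real assume \<epsilon>: "0 < \<epsilon>"
  let ?L = "integral {0..1} (\<lambda>s. sqrt (G (c s) (c' s) (c' s)))"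
  obtain d d' S' B' where d: "piecewise_curve d d' S' B'" "d 0 = c 0" "d 1 = c 1"
    and e: "integral {0..1} (\<lambda>s. G (d s) (d' s) (d' s)) \<le> (?L + \<epsilon>)\<^sup>2"
    using piecewise_curve_reparametrize[OF c \<epsilon>] by blast
  have "G (q 0) (q' 0) (q' 0) + lam / 2 * (norm (d 0 - q 0))\<^sup>2
      \<le> integral {0..1} (\<lambda>s. G (d s) (d' s) (d' s))"
    by (rule energy_comparison[OF q h d(1)]) (use d ends in auto)
  with e have "G (q 0) (q' 0) (q' 0) \<le> (?L + \<epsilon>)\<^sup>2"
    using d ends by simp
  moreover have "0 \<le> ?L"
    using c by (intro integral_nonneg piecewise_curve_speed_integrable[OF c])
      (auto simp: piecewise_curve_def image_subset_iff intro!: G_nonneg)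
  ultimately show "sqrt (G (q 0) (q' 0) (q' 0)) \<le> ?L + \<epsilon>"
    using \<epsilon> by (intro real_le_lsqrt) auto
qed

end


subsection \<open>Smooth maps\<close>

lemma smooth_on_has_derivative:
  assumes "smooth_on U f" "x \<in> U"
  shows "(f has_derivative frechet_derivative f (at x)) (at x)"
proof -
  have "C_k_on (Suc 0) U f" using assms(1) unfolding smooth_on_def by blast
  then show ?thesis using assms(2) frechet_derivative_works by auto
qed

lemma smooth_on_frechet_derivative:
  assumes "smooth_on U f"
  shows "smooth_on U (\<lambda>x. frechet_derivative f (at x) v)"
  unfolding smooth_on_def
proof
  fix k
  have "C_k_on (Suc k) U f" using assms unfolding smooth_on_def by blast
  then show "C_k_on k U (\<lambda>x. frechet_derivative f (at x) v)" by simp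
qed

lemma smooth_on_continuous_on: "smooth_on U f \<Longrightarrow> continuous_on U f"
  unfolding smooth_on_def by (metis C_k_on.simps(1))

text \<open>In finite dimension, convergence of linear maps on basis vectors gives joint convergence
  in map and argument. It is needed because smoothness of metric and transition derivatives is given
  only for frozen vectors.\<close>

lemma tendsto_linear_family:
  fixes L :: "'b::topological_space \<Rightarrow> 'e::euclidean_space \<Rightarrow> 'f::real_normed_vector"
  assumes lin: "eventually (\<lambda>s. linear (L (c s))) F" "linear (L c0)"
    and u: "(u \<longlongrightarrow> u0) F" and comp: "\<And>i. i \<in> Basis \<Longrightarrow> ((\<lambda>s. L (c s) i) \<longlongrightarrow> L c0 i) F"
  shows "((\<lambda>s. L (c s) (u s)) \<longlongrightarrow> L c0 u0) F"
proof -
  have expand: "l w = (\<Sum>i\<in>Basis. (w \<bullet> i) *\<^sub>R l i)" if "linear l" for l :: "'e \<Rightarrow> 'f" and w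
    using linear_sum[OF that, of "\<lambda>i. (w \<bullet> i) *\<^sub>R i" Basis] linear_cmul[OF that]
    by (simp add: euclidean_representation)
  have "((\<lambda>s. \<Sum>i\<in>Basis. (u s \<bullet> i) *\<^sub>R L (c s) i) \<longlongrightarrow> (\<Sum>i\<in>Basis. (u0 \<bullet> i) *\<^sub>R L c0 i)) F"
    by (intro tendsto_intros u comp)
  moreover have "eventually (\<lambda>s. (\<Sum>i\<in>Basis. (u s \<bullet> i) *\<^sub>R L (c s) i) = L (c s) (u s)) F"
    using lin(1) by eventually_elim (metis expand)
  ultimately show ?thesis
    unfolding expand[OF lin(2), of u0] by (rule Lim_transform_eventually)
qed


subsection \<open>Charts, tangent vectors and speed\<close>

locale riemannian =
  fixes A :: "('a::{t2_space, second_countable_topology}, 'e::euclidean_space) chart set"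
    and \<gg> :: "('a, 'e) metric_field"
  assumes manifold: "riemannian_manifold A \<gg>"
begin

abbreviation "U c \<equiv> chart_map c ` chart_dom c"
abbreviation "G c \<equiv> metric_coord A \<gg> c"

lemma atlas: "smooth_atlas A" and metric: "riemannian_metric A \<gg>"
  using manifold by (auto simp: riemannian_manifold_def)

lemma is_chartA: "c \<in> A \<Longrightarrow> is_chart c"
  using atlas by (auto simp: smooth_atlas_def)

lemma chart_exists: obtains c where "c \<in> A" "p \<in> chart_dom c"
proof -
  have "p \<in> (\<Union>c\<in>A. chart_dom c)" using atlas by (simp only: smooth_atlas_def UNIV_I)
  then show ?thesis using that by (rule UN_E)
qed

lemma open_dom: "c \<in> A \<Longrightarrow> open (chart_dom c)" and open_U: "c \<in> A \<Longrightarrow> open (U c)"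
  using is_chartA by (auto simp: is_chart_def)

lemma chart_inv_map: "c \<in> A \<Longrightarrow> p \<in> chart_dom c \<Longrightarrow> chart_inv c (chart_map c p) = p"
  and chart_map_inv: "c \<in> A \<Longrightarrow> x \<in> U c \<Longrightarrow> chart_map c (chart_inv c x) = x"
  and chart_inv_in: "c \<in> A \<Longrightarrow> x \<in> U c \<Longrightarrow> chart_inv c x \<in> chart_dom c"
  and continuous_chart_map: "c \<in> A \<Longrightarrow> continuous_on (chart_dom c) (chart_map c)"
  and continuous_chart_inv: "c \<in> A \<Longrightarrow> continuous_on (U c) (chart_inv c)"
  using is_chartA[of c] by (auto simp: is_chart_def homeomorphism_def)

lemma open_overlap:
  assumes "c \<in> A" "d \<in> A"
  shows "open (chart_map c ` (chart_dom c \<inter> chart_dom d))"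
proof -
  have "chart_map c ` (chart_dom c \<inter> chart_dom d) = U c \<inter> chart_inv c -` chart_dom d"
    using chart_inv_map[OF assms(1)] by force
  then show ?thesis
    using continuous_open_preimage[OF continuous_chart_inv open_U open_dom] assms by metis
qed

lemma transition_has_derivative:
  assumes "c \<in> A" "d \<in> A" "p \<in> chart_dom c" "p \<in> chart_dom d"
  shows "(transition c d has_derivative coord_change c d p) (at (chart_map c p))"
  unfolding coord_change_def
  by (rule smooth_on_has_derivative[of "chart_map c ` (chart_dom c \<inter> chart_dom d)"])
    (use assms atlas in \<open>auto simp: smooth_atlas_def\<close>)

lemma coord_change_linear:
  assumes "c \<in> A" "d \<in> A" "p \<in> chart_dom c" "p \<in> chart_dom d"
  shows "linear (coord_change c d p)"
  using transition_has_derivative[OF assms] has_derivative_linear by blast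

text \<open>Chain rule for transition maps. They compose only over the part where the first two
  charts overlap, which is open, and this suffices for derivatives. The cocycle identity makes
  \<open>tangent_of_coord\<close> produce tangent vectors.\<close>

lemma coord_change_comp:
  assumes cde: "c \<in> A" "d \<in> A" "e \<in> A" and p: "p \<in> chart_dom c" "p \<in> chart_dom d" "p \<in> chart_dom e"
  shows "coord_change d e p (coord_change c d p v) = coord_change c e p v"
proof -
  let ?x = "chart_map c p"
  have tx: "transition c d ?x = chart_map d p"
    using cde p by (simp add: transition_def chart_inv_map)
  have "(transition d e has_derivative coord_change d e p) (at (transition c d ?x))"
    unfolding tx using cde p by (intro transition_has_derivative)
  with transition_has_derivative[OF cde(1,2) p(1,2)]
  have "(transition d e \<circ> transition c d has_derivative coord_change d e p \<circ> coord_change c d p) (at ?x)"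
    by (rule diff_chain_at)
  note comp = this
  have eq: "(transition d e \<circ> transition c d) y = transition c e y"
    if y: "y \<in> chart_map c ` (chart_dom c \<inter> chart_dom d)" for y
  proof -
    obtain r where "y = chart_map c r" "r \<in> chart_dom c" "r \<in> chart_dom d" using y by blast
    then show ?thesis using cde by (simp add: transition_def chart_inv_map)
  qed
  have "?x \<in> chart_map c ` (chart_dom c \<inter> chart_dom d)" using p by simp
  then have "(transition c e has_derivative coord_change d e p \<circ> coord_change c d p) (at ?x)"
    by (rule has_derivative_transform_within_open[OF comp open_overlap[OF cde(1,2)] _ eq])
  then have "coord_change d e p \<circ> coord_change c d p = coord_change c e p"
    using transition_has_derivative[OF cde(1,3) p(1,3)] has_derivative_unique by blast
  then show ?thesis by (metis comp_apply)
qed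

lemma coord_change_self:
  assumes c: "c \<in> A" and p: "p \<in> chart_dom c"
  shows "coord_change c c p v = v"
proof -
  have "((\<lambda>x. x) has_derivative (\<lambda>v. v)) (at (chart_map c p))" by (rule has_derivative_ident)
  then have "(transition c c has_derivative (\<lambda>v. v)) (at (chart_map c p))"
    by (rule has_derivative_transform_within_open[OF _ open_U[OF c]])
      (use p c in \<open>auto simp: transition_def chart_inv_map\<close>)
  then show ?thesis
    using transition_has_derivative[OF c c p p] has_derivative_unique by metis
qed

lemma charts_at_iff: "c \<in> charts_at A p \<longleftrightarrow> c \<in> A \<and> p \<in> chart_dom c"
  by (simp add: charts_at_def)

lemma tangent_of_coord_in:
  assumes "c \<in> A" "p \<in> chart_dom c"
  shows "tangent_of_coord A c p v \<in> tangent_space A p"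
  using assms by (auto simp: tangent_space_def tangent_of_coord_def charts_at_iff coord_change_comp)

lemma tangent_of_coord_self:
  assumes "c \<in> A" "p \<in> chart_dom c"
  shows "tangent_of_coord A c p v c = v"
  using assms by (simp add: tangent_of_coord_def charts_at_iff coord_change_self)

lemma tangent_of_coord_lincomb:
  assumes c: "c \<in> A" "p \<in> chart_dom c"
  shows "tangent_of_coord A c p (a *\<^sub>R v + b *\<^sub>R w) =
    (\<lambda>d. a *\<^sub>R tangent_of_coord A c p v d + b *\<^sub>R tangent_of_coord A c p w d)"
proof
  fix d
  show "tangent_of_coord A c p (a *\<^sub>R v + b *\<^sub>R w) d =
      a *\<^sub>R tangent_of_coord A c p v d + b *\<^sub>R tangent_of_coord A c p w d"
  proof (cases "d \<in> charts_at A p")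
    case True
    then have "linear (coord_change c d p)"
      using c by (intro coord_change_linear) (auto simp: charts_at_iff)
    then show ?thesis using True by (simp add: tangent_of_coord_def linear_add linear_cmul)
  qed (simp add: tangent_of_coord_def)
qed

lemma G_sym:
  assumes "c \<in> A" "x \<in> U c"
  shows "G c x v w = G c x w v"
  using metric tangent_of_coord_in[OF assms(1) chart_inv_in[OF assms]]
  by (simp add: riemannian_metric_def metric_coord_def)

lemma G_lincomb:
  assumes "c \<in> A" "x \<in> U c"
  shows "G c x (a *\<^sub>R v + b *\<^sub>R v') w = a * G c x v w + b * G c x v' w"
  using metric tangent_of_coord_in[OF assms(1) chart_inv_in[OF assms]]
  by (simp add: riemannian_metric_def metric_coord_def
      tangent_of_coord_lincomb[OF assms(1) chart_inv_in[OF assms]])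

lemma G_bilinear:
  assumes c: "c \<in> A" "x \<in> U c"
  shows "bilinear (G c x)"
proof -
  have l: "linear (\<lambda>v. G c x v w)" for w
    using G_lincomb[OF c, of 1 _ 1 _ w] G_lincomb[OF c, of _ _ 0 0 w] by (intro linearI) auto
  have "G c x v = (\<lambda>w. G c x w v)" for v using G_sym[OF c] by blast
  then have "linear (G c x v)" for v using l by metis
  then show ?thesis using l by (simp add: bilinear_def)
qed

lemma G_pos:
  assumes c: "c \<in> A" "x \<in> U c" and v: "v \<noteq> 0"
  shows "0 < G c x v v"
proof -
  let ?p = "chart_inv c x"
  have "tangent_of_coord A c ?p v \<noteq> (\<lambda>_. 0)"
    using tangent_of_coord_self[OF c(1) chart_inv_in[OF c], of v] v by metis
  then show ?thesis
    using metric tangent_of_coord_in[OF c(1) chart_inv_in[OF c]]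
    by (simp add: riemannian_metric_def metric_coord_def)
qed

lemma G_nonneg: "c \<in> A \<Longrightarrow> x \<in> U c \<Longrightarrow> 0 \<le> G c x v v"
  using G_pos[of c x v] bilinear_lzero[OF G_bilinear[of c x], of v] by (cases "v = 0") auto

lemma G_smooth: "c \<in> A \<Longrightarrow> smooth_on (U c) (\<lambda>x. G c x v w)"
  using metric by (simp add: riemannian_metric_def)

text \<open>\<open>tendsto_linear_family\<close> is used once per vector argument. In the second use
  the pair of base point and other vector plays the role of the parameter.\<close>

lemma G_tendsto:
  assumes c: "c \<in> A" and x: "(x \<longlongrightarrow> x0) F" "x0 \<in> U c"
    and u: "(u \<longlongrightarrow> u0) F" and w: "(w \<longlongrightarrow> w0) F"
  shows "((\<lambda>s. G c (x s) (u s) (w s)) \<longlongrightarrow> G c x0 u0 w0) F"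
proof -
  have ev: "eventually (\<lambda>s. x s \<in> U c) F"
    using topological_tendstoD[OF x(1) open_U[OF c] x(2)] .
  have comp: "((\<lambda>s. G c (x s) i j) \<longlongrightarrow> G c x0 i j) F" for i j
  proof -
    have "isCont (\<lambda>x. G c x i j) x0"
      using smooth_on_continuous_on[OF G_smooth[OF c], of i j] x(2)
        continuous_on_eq_continuous_at[OF open_U[OF c]] by blast
    from isCont_tendsto_compose[OF this x(1)] show ?thesis .
  qed
  have lin: "linear (G c x v)" "linear (\<lambda>v. G c x v w)" if "x \<in> U c" for x v w
    using G_bilinear[OF c that] by (auto simp: bilinear_def)
  have 1: "((\<lambda>s. G c (x s) i (w s)) \<longlongrightarrow> G c x0 i w0) F" for i
    by (rule tendsto_linear_family[where L = "\<lambda>x. G c x i"])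
      (use lin x(2) ev w comp in \<open>auto elim: eventually_mono\<close>)
  show ?thesis
    by (rule tendsto_linear_family[where L = "\<lambda>z v. G c (fst z) v (snd z)"
          and c = "\<lambda>s. (x s, w s)" and ?c0.0 = "(x0, w0)", simplified])
      (use lin x(2) ev u 1 in \<open>auto elim: eventually_mono\<close>)
qed

lemma eventually_in_dom:
  assumes "(\<gamma> \<longlongrightarrow> \<gamma> t) (at t within I)" "c \<in> A" "\<gamma> t \<in> chart_dom c"
  shows "eventually (\<lambda>s. \<gamma> s \<in> chart_dom c) (at t within I)"
  using topological_tendstoD[OF assms(1) open_dom[OF assms(2)] assms(3)] .

lemma curve_chart_change:
  assumes cont: "(\<gamma> \<longlongrightarrow> \<gamma> t) (at t within I)"
    and c: "c \<in> A" "\<gamma> t \<in> chart_dom c" and d: "d \<in> A" "\<gamma> t \<in> chart_dom d" and t: "t \<in> I"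
    and der: "((chart_map c \<circ> \<gamma>) has_vector_derivative x') (at t within I)"
  shows "((chart_map d \<circ> \<gamma>) has_vector_derivative coord_change c d (\<gamma> t) x') (at t within I)"
proof -
  have D: "(transition c d has_derivative coord_change c d (\<gamma> t))
      (at ((chart_map c \<circ> \<gamma>) t) within (chart_map c \<circ> \<gamma>) ` I)"
    unfolding comp_def
    by (rule has_derivative_at_withinI[OF transition_has_derivative[OF c(1) d(1) c(2) d(2)]])
  have "(transition c d \<circ> (chart_map c \<circ> \<gamma>) has_derivative
      coord_change c d (\<gamma> t) \<circ> (\<lambda>s. s *\<^sub>R x')) (at t within I)"
    by (rule diff_chain_within[OF der[unfolded has_vector_derivative_def] D])
  then have "(transition c d \<circ> (chart_map c \<circ> \<gamma>) has_vector_derivative coord_change c d (\<gamma> t) x')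
      (at t within I)"
    using linear_cmul[OF coord_change_linear[OF c(1) d(1) c(2) d(2)]]
    by (simp add: has_vector_derivative_def comp_def)
  then show ?thesis
    unfolding has_vector_derivative_def
  proof (rule has_derivative_transform_eventually)
    show "eventually (\<lambda>s. (transition c d \<circ> (chart_map c \<circ> \<gamma>)) s = (chart_map d \<circ> \<gamma>) s) (at t within I)"
      using eventually_in_dom[OF cont c]
      by eventually_elim (simp add: transition_def chart_inv_map c)
  qed (use c t in \<open>auto simp: transition_def chart_inv_map\<close>)
qed

lemma velocity_eq:
  assumes cont: "(\<gamma> \<longlongrightarrow> \<gamma> t) (at t within I)"
    and c: "c \<in> A" "\<gamma> t \<in> chart_dom c" and t: "t \<in> I" "at t within I \<noteq> bot"
    and der: "((chart_map c \<circ> \<gamma>) has_vector_derivative x') (at t within I)"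
  shows "velocity A I \<gamma> t = tangent_of_coord A c (\<gamma> t) x'"
proof
  fix d
  show "velocity A I \<gamma> t d = tangent_of_coord A c (\<gamma> t) x' d"
    using vector_derivative_within[OF t(2) curve_chart_change[OF cont c _ _ t(1) der, of d]]
    by (auto simp: velocity_def tangent_of_coord_def charts_at_iff)
qed

lemma velocity_in_tangent_space:
  assumes "(\<gamma> \<longlongrightarrow> \<gamma> t) (at t within I)"
    "c \<in> A" "\<gamma> t \<in> chart_dom c" "t \<in> I" "at t within I \<noteq> bot"
    "((chart_map c \<circ> \<gamma>) has_vector_derivative x') (at t within I)"
  shows "velocity A I \<gamma> t \<in> tangent_space A (\<gamma> t)"
  unfolding velocity_eq[OF assms] by (rule tangent_of_coord_in[OF assms(2,3)])

text \<open>Lengths are computed with the two-sided \<open>speed\<close>. It does not depend on the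
  interval under consideration, so additivity of length is that of the integral. On a closed
  interval the one-sided version can differ from it only at the two ends.\<close>

definition speed_within :: "real set \<Rightarrow> (real \<Rightarrow> 'a) \<Rightarrow> real \<Rightarrow> real" where
  "speed_within I \<gamma> t = sqrt (\<gg> (\<gamma> t) (velocity A I \<gamma> t) (velocity A I \<gamma> t))"

abbreviation "speed \<equiv> speed_within UNIV"

lemma speed_eq:
  assumes "(\<gamma> \<longlongrightarrow> \<gamma> t) (at t within I)"
    "c \<in> A" "\<gamma> t \<in> chart_dom c" "t \<in> I" "at t within I \<noteq> bot"
    "((chart_map c \<circ> \<gamma>) has_vector_derivative x') (at t within I)"
  shows "speed_within I \<gamma> t = sqrt (G c (chart_map c (\<gamma> t)) x' x')"
  unfolding speed_within_def velocity_eq[OF assms] metric_coord_def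
  using assms(2,3) by (simp add: chart_inv_map)

text \<open>Speed is local in the curve and in the parameter set. This justifies restricting,
  extending and gluing curves away from finitely many times.\<close>

lemma speed_within_cong:
  assumes "open J" "t \<in> J" "I \<inter> J = I' \<inter> J" "\<And>s. s \<in> J \<Longrightarrow> \<gamma> s = \<delta> s"
  shows "speed_within I \<gamma> t = speed_within I' \<delta> t"
proof -
  have at: "at t within I = at t within I'"
    by (rule at_within_nhd[OF assms(2,1)]) (use assms(3) in auto)
  have ev: "eventually (\<lambda>s. \<gamma> s = \<delta> s) (nhds t)"
    using assms(1,2,4) unfolding eventually_nhds by blast
  have "((chart_map c \<circ> \<gamma>) has_vector_derivative x) (at t within I') \<longleftrightarrow>
      ((chart_map c \<circ> \<delta>) has_vector_derivative x) (at t within I')" for c :: "('a,'e) chart" and x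
    by (rule has_vector_derivative_cong_ev)
      (use ev assms(2,4) in \<open>auto elim: eventually_mono\<close>)
  then have "velocity A I \<gamma> t = velocity A I' \<delta> t"
    unfolding velocity_def vector_derivative_def at assms(4)[OF assms(2)] by presburger
  then show ?thesis using assms(2,4) by (simp add: speed_within_def)
qed


subsection \<open>Piecewise differentiable curves\<close>

lemma C1_curve_onD:
  assumes "C1_curve_on A I \<gamma>" "c \<in> A"
  obtains x' where "\<And>t. t \<in> I \<Longrightarrow> \<gamma> t \<in> chart_dom c \<Longrightarrow>
      ((chart_map c \<circ> \<gamma>) has_vector_derivative x' t) (at t within I)"
    "\<And>t. t \<in> I \<Longrightarrow> \<gamma> t \<in> chart_dom c \<Longrightarrow> (x' \<longlongrightarrow> x' t) (at t within I)"
  using assms unfolding C1_curve_on_def continuous_within by (metis (no_types))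

lemma C1_curve_on_continuous: "C1_curve_on A I \<gamma> \<Longrightarrow> continuous_on I \<gamma>"
  by (simp add: C1_curve_on_def)

lemma C1_curve_on_affine:
  assumes \<gamma>: "C1_curve_on A I \<gamma>" and sub: "\<And>s. s \<in> J \<Longrightarrow> k * s + m \<in> I"
    and eq: "\<And>s. s \<in> J \<Longrightarrow> \<delta> s = \<gamma> (k * s + m)"
  shows "C1_curve_on A J \<delta>"
  unfolding C1_curve_on_def
proof (intro conjI ballI)
  let ?f = "\<lambda>s. k * s + m"
  have "continuous_on J (\<lambda>s. \<gamma> (?f s))"
    by (rule continuous_on_compose2[OF C1_curve_on_continuous[OF \<gamma>]])
      (use sub in \<open>auto intro!: continuous_intros\<close>)
  then show "continuous_on J \<delta>" by (rule continuous_on_eq) (simp add: eq)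
  fix c assume c: "c \<in> A"
  obtain x' where x': "\<And>t. t \<in> I \<Longrightarrow> \<gamma> t \<in> chart_dom c \<Longrightarrow>
      ((chart_map c \<circ> \<gamma>) has_vector_derivative x' t) (at t within I)"
    "\<And>t. t \<in> I \<Longrightarrow> \<gamma> t \<in> chart_dom c \<Longrightarrow> (x' \<longlongrightarrow> x' t) (at t within I)"
    using C1_curve_onD[OF \<gamma> c] by blast
  show "\<exists>y'. \<forall>t\<in>J. \<delta> t \<in> chart_dom c \<longrightarrow>
      ((chart_map c \<circ> \<delta>) has_vector_derivative y' t) (at t within J) \<and> continuous (at t within J) y'"
  proof (intro exI ballI impI conjI)
    fix t assume t: "t \<in> J" and dom: "\<delta> t \<in> chart_dom c"
    have dom': "\<gamma> (?f t) \<in> chart_dom c" using dom eq[OF t] by simp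
    have "(?f has_vector_derivative k) (at t within J)" by (auto intro!: derivative_eq_intros)
    moreover have "((chart_map c \<circ> \<gamma>) has_vector_derivative x' (?f t)) (at (?f t) within ?f ` J)"
      by (rule has_vector_derivative_within_subset[OF x'(1)[OF sub[OF t] dom']]) (use sub in blast)
    ultimately have "((chart_map c \<circ> \<gamma>) \<circ> ?f has_vector_derivative k *\<^sub>R x' (?f t)) (at t within J)"
      by (rule vector_diff_chain_within)
    then show "((chart_map c \<circ> \<delta>) has_vector_derivative k *\<^sub>R x' (k * t + m)) (at t within J)"
      by (rule has_vector_derivative_transform[OF t, rotated]) (simp add: eq)
    have "continuous (at (?f t) within ?f ` J) x'"
      unfolding continuous_within
      by (rule tendsto_within_subset[OF x'(2)[OF sub[OF t] dom']]) (use sub in blast)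
    moreover have "continuous (at t within J) ?f" by (intro continuous_intros)
    ultimately have "continuous (at t within J) (x' \<circ> ?f)"
      by (rule continuous_within_compose[rotated])
    then show "continuous (at t within J) (\<lambda>t. k *\<^sub>R x' (k * t + m))"
      unfolding comp_def by (rule continuous_scaleR[OF continuous_const])
  qed
qed

lemma C1_curve_on_subset: "C1_curve_on A I \<gamma> \<Longrightarrow> J \<subseteq> I \<Longrightarrow> C1_curve_on A J \<gamma>"
  by (rule C1_curve_on_affine[where k = 1 and m = 0 and I = I and \<gamma> = \<gamma>]) auto

text \<open>Piecewise \<open>C1\<close> curves on an arbitrary interval, generated by appending
  pieces instead of listing a partition. Concatenation, splitting and change of parameter become
  inductions.\<close>

inductive pw :: "(real \<Rightarrow> 'a) \<Rightarrow> real \<Rightarrow> real \<Rightarrow> bool" for \<gamma> where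
  base: "a < b \<Longrightarrow> C1_curve_on A {a..b} \<gamma> \<Longrightarrow> pw \<gamma> a b"
| step: "pw \<gamma> a b \<Longrightarrow> b < c \<Longrightarrow> C1_curve_on A {b..c} \<gamma> \<Longrightarrow> pw \<gamma> a c"

lemma pw_less: "pw \<gamma> a b \<Longrightarrow> a < b"
  by (induction rule: pw.induct) auto

lemma pw_trans: "pw \<gamma> b c \<Longrightarrow> pw \<gamma> a b \<Longrightarrow> pw \<gamma> a c"
  by (induction rule: pw.induct) (auto intro: pw.step)

text \<open>The two curves have to agree only on the new interval, so congruence and the gluing of a
  shifted curve are instances.\<close>

lemma pw_affine:
  assumes "pw \<gamma> a b" "0 < k"
  shows "k * a' + m = a \<Longrightarrow> k * b' + m = b \<Longrightarrow>
    (\<And>s. s \<in> {a'..b'} \<Longrightarrow> \<delta> s = \<gamma> (k * s + m)) \<Longrightarrow> pw \<delta> a' b'"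
  using assms(1)
proof (induction arbitrary: b' rule: pw.induct)
  case (base a b)
  have "a' < b'" using base.hyps(1) base.prems(1,2) assms(2)
    by (metis add_less_cancel_right mult_less_cancel_left_pos)
  moreover have "C1_curve_on A {a'..b'} \<delta>"
  proof (rule C1_curve_on_affine[OF base.hyps(2) _ base.prems(3)])
    fix s assume "s \<in> {a'..b'}"
    then have "k * a' \<le> k * s" "k * s \<le> k * b'" using assms(2) by auto
    then show "k * s + m \<in> {a..b}" using base.prems(1,2) by auto
  qed
  ultimately show ?case by (rule pw.base)
next
  case (step a b c)
  define b1 where "b1 = (b - m) / k"
  have b1: "k * b1 + m = b" using assms(2) by (simp add: b1_def)
  have "b1 < b'" using step.hyps(2) step.prems(2) b1 assms(2)
    by (metis add_less_cancel_right mult_less_cancel_left_pos)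
  have "a' < b1" using pw_less[OF step.hyps(1)] step.prems(1) b1 assms(2)
    by (metis add_less_cancel_right mult_less_cancel_left_pos)
  have "pw \<delta> a' b1"
    by (rule step.IH[OF step.prems(1) b1 step.prems(3)]) (use \<open>b1 < b'\<close> in auto)
  moreover have "C1_curve_on A {b1..b'} \<delta>"
  proof (rule C1_curve_on_affine[OF step.hyps(3)])
    fix s assume s: "s \<in> {b1..b'}"
    then have "k * b1 \<le> k * s" "k * s \<le> k * b'" using assms(2) by auto
    then show "k * s + m \<in> {b..c}" using b1 step.prems(2) by auto
    show "\<delta> s = \<gamma> (k * s + m)" using step.prems(3) s \<open>a' < b1\<close> by auto
  qed
  ultimately show ?case using pw.step \<open>b1 < b'\<close> by blast
qed

lemma pw_reverse: "pw \<gamma> a b \<Longrightarrow> pw (\<lambda>s. \<gamma> (- s)) (- b) (- a)"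
proof (induction rule: pw.induct)
  case (base a b)
  have "C1_curve_on A {- b..- a} (\<lambda>s. \<gamma> (- s))"
    by (rule C1_curve_on_affine[OF base(2), where k = "-1" and m = 0]) auto
  then show ?case using base by (intro pw.base) auto
next
  case (step a b c)
  have "C1_curve_on A {- c..- b} (\<lambda>s. \<gamma> (- s))"
    by (rule C1_curve_on_affine[OF step(3), where k = "-1" and m = 0]) auto
  then have "pw (\<lambda>s. \<gamma> (- s)) (- c) (- b)" using step by (intro pw.base) auto
  with step show ?case by (blast intro: pw_trans)
qed

lemma pw_cong:
  assumes "pw \<gamma> a b" "\<And>s. s \<in> {a..b} \<Longrightarrow> \<delta> s = \<gamma> s"
  shows "pw \<delta> a b"
  by (rule pw_affine[OF assms(1), where k = 1 and m = 0]) (use assms(2) in auto)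

lemma pw_split:
  "pw \<gamma> a b \<Longrightarrow> a < s \<Longrightarrow> s < b \<Longrightarrow> pw \<gamma> a s \<and> pw \<gamma> s b"
proof (induction rule: pw.induct)
  case (base a b)
  then show ?case
    using C1_curve_on_subset[OF base(2), of "{a..s}"] C1_curve_on_subset[OF base(2), of "{s..b}"]
    by (auto intro!: pw.base)
next
  case (step a b c)
  consider "s < b" | "s = b" | "b < s" by linarith
  then show ?case
  proof cases
    case 1
    then show ?thesis using step pw.step by blast
  next
    case 2
    then show ?thesis using step pw.base by blast
  next
    case 3
    have "C1_curve_on A {b..s} \<gamma>" "C1_curve_on A {s..c} \<gamma>"
      using C1_curve_on_subset[OF step(3)] 3 step.prems by auto
    then show ?thesis using step 3 pw.base pw.step by blast
  qed
qed

lemma pw_continuous: "pw \<gamma> a b \<Longrightarrow> continuous_on {a..b} \<gamma>"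
proof (induction rule: pw.induct)
  case (step a b c)
  have "continuous_on ({a..b} \<union> {b..c}) \<gamma>"
    using step C1_curve_on_continuous by (intro continuous_on_closed_Un) auto
  then show ?case using step pw_less[OF step(1)] by (simp add: ivl_disj_un_two_touch)
qed (auto intro: C1_curve_on_continuous)

lemma at_within_Icc_nontriv: "a < b \<Longrightarrow> t \<in> {a..b} \<Longrightarrow> at t within {a..b} \<noteq> (bot :: real filter)"
  by (simp add: trivial_limit_within islimpt_Icc)

lemma at_within_Icc_interior: "a < t \<Longrightarrow> t < b \<Longrightarrow> at t within {a..b} = at (t :: real)"
  by (rule at_within_interior) simp

lemma pw_differentiable:
  "pw \<gamma> a b \<Longrightarrow> \<exists>S. finite S \<and> a \<in> S \<and> b \<in> S \<and> (\<forall>t\<in>{a..b} - S. isCont \<gamma> t \<and>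
     (\<forall>c\<in>A. \<gamma> t \<in> chart_dom c \<longrightarrow> (\<exists>x'. ((chart_map c \<circ> \<gamma>) has_vector_derivative x') (at t))))"
proof (induction rule: pw.induct)
  case (base a b)
  have "isCont \<gamma> t \<and> (\<forall>c\<in>A. \<gamma> t \<in> chart_dom c \<longrightarrow>
      (\<exists>x'. ((chart_map c \<circ> \<gamma>) has_vector_derivative x') (at t)))" if t: "a < t" "t < b" for t
    using base(2) t at_within_Icc_interior[OF t] continuous_on_interior[of "{a..b}" \<gamma> t]
    unfolding C1_curve_on_def by (metis atLeastAtMost_iff greaterThanLessThan_iff
        interior_atLeastAtMost_real less_imp_le)
  moreover have "t \<in> {a..b} - {a, b} \<Longrightarrow> a < t \<and> t < b" for t by auto
  ultimately show ?case by (intro exI[of _ "{a, b}"]) blast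
next
  case (step a b c)
  have *: "isCont \<gamma> t \<and> (\<forall>c\<in>A. \<gamma> t \<in> chart_dom c \<longrightarrow>
      (\<exists>x'. ((chart_map c \<circ> \<gamma>) has_vector_derivative x') (at t)))" if t: "b < t" "t < c" for t
    using step(3) t at_within_Icc_interior[OF t] continuous_on_interior[of "{b..c}" \<gamma> t]
    unfolding C1_curve_on_def by (metis atLeastAtMost_iff greaterThanLessThan_iff
        interior_atLeastAtMost_real less_imp_le)
  obtain S where S: "finite S" "a \<in> S" "b \<in> S"
    and d: "\<And>t. t \<in> {a..b} - S \<Longrightarrow> isCont \<gamma> t \<and>
     (\<forall>c\<in>A. \<gamma> t \<in> chart_dom c \<longrightarrow> (\<exists>x'. ((chart_map c \<circ> \<gamma>) has_vector_derivative x') (at t)))"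
    using step.IH by blast
  show ?case
  proof (intro exI[of _ "insert c S"] conjI ballI)
    fix t assume t: "t \<in> {a..c} - insert c S"
    have "t \<noteq> b" using t S by auto
    then have "t \<in> {a..b} - S \<or> b < t \<and> t < c" using t by auto
    then show "isCont \<gamma> t" "\<And>e. e \<in> A \<Longrightarrow> \<gamma> t \<in> chart_dom e \<longrightarrow>
        (\<exists>x'. ((chart_map e \<circ> \<gamma>) has_vector_derivative x') (at t))"
      using d * by blast+
  qed (use S in auto)
qed

lemma C1_speed_continuous:
  assumes ab: "a < b" and \<gamma>: "C1_curve_on A {a..b} \<gamma>"
  shows "continuous_on {a..b} (speed_within {a..b} \<gamma>)"
  unfolding continuous_on_def
proof
  fix t assume t: "t \<in> {a..b}"
  obtain c where c: "c \<in> A" "\<gamma> t \<in> chart_dom c" using chart_exists by blast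
  obtain x' where x': "\<And>t. t \<in> {a..b} \<Longrightarrow> \<gamma> t \<in> chart_dom c \<Longrightarrow>
      ((chart_map c \<circ> \<gamma>) has_vector_derivative x' t) (at t within {a..b})"
    "\<And>t. t \<in> {a..b} \<Longrightarrow> \<gamma> t \<in> chart_dom c \<Longrightarrow> (x' \<longlongrightarrow> x' t) (at t within {a..b})"
    using C1_curve_onD[OF \<gamma> c(1)] by blast
  have cont: "(\<gamma> \<longlongrightarrow> \<gamma> s) (at s within {a..b})" if "s \<in> {a..b}" for s
    using C1_curve_on_continuous[OF \<gamma>] that by (simp add: continuous_on_def)
  have sp: "speed_within {a..b} \<gamma> s = sqrt (G c (chart_map c (\<gamma> s)) (x' s) (x' s))"
    if "s \<in> {a..b}" "\<gamma> s \<in> chart_dom c" for s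
    by (rule speed_eq[OF cont[OF that(1)] c(1) that(2,1) at_within_Icc_nontriv[OF ab that(1)] x'(1)[OF that]])
  have "((\<lambda>s. chart_map c (\<gamma> s)) \<longlongrightarrow> chart_map c (\<gamma> t)) (at t within {a..b})"
    using has_vector_derivative_continuous[OF x'(1)[OF t c(2)]]
    by (simp add: continuous_within comp_def)
  then have "((\<lambda>s. sqrt (G c (chart_map c (\<gamma> s)) (x' s) (x' s))) \<longlongrightarrow>
      sqrt (G c (chart_map c (\<gamma> t)) (x' t) (x' t))) (at t within {a..b})"
    using c by (intro tendsto_real_sqrt G_tendsto x'(2) t) auto
  moreover have "eventually (\<lambda>s. s \<in> {a..b}) (at t within {a..b})"
    by (simp add: eventually_at_filter)
  then have "eventually (\<lambda>s. sqrt (G c (chart_map c (\<gamma> s)) (x' s) (x' s)) = speed_within {a..b} \<gamma> s)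
      (at t within {a..b})"
    using eventually_in_dom[OF cont[OF t] c] by eventually_elim (simp add: sp)
  ultimately show "(speed_within {a..b} \<gamma> \<longlongrightarrow> speed_within {a..b} \<gamma> t) (at t within {a..b})"
    unfolding sp[OF t c(2)] by (rule Lim_transform_eventually)
qed

lemma speed_within_Icc:
  assumes "a < t" "t < b"
  shows "speed_within {a..b} \<gamma> t = speed \<gamma> t"
  by (rule speed_within_cong[of "{a<..<b}"]) (use assms in auto)

lemma C1_speed_has_integral:
  assumes "a < b" "C1_curve_on A {a..b} \<gamma>"
  shows "(speed \<gamma> has_integral integral {a..b} (speed_within {a..b} \<gamma>)) {a..b}"
proof (rule has_integral_spike_finite[of "{a, b}"])
  show "(speed_within {a..b} \<gamma> has_integral integral {a..b} (speed_within {a..b} \<gamma>)) {a..b}"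
    by (intro integrable_integral integrable_continuous_interval C1_speed_continuous assms)
  show "\<And>t. t \<in> {a..b} - {a, b} \<Longrightarrow> speed \<gamma> t = speed_within {a..b} \<gamma> t"
    using speed_within_Icc by auto
qed simp

lemma pw_speed_integrable: "pw \<gamma> a b \<Longrightarrow> speed \<gamma> integrable_on {a..b}"
proof (induction rule: pw.induct)
  case (base a b)
  then show ?case using C1_speed_has_integral by blast
next
  case (step a b c)
  have "speed \<gamma> integrable_on {b..c}" using C1_speed_has_integral step by blast
  with step show ?case
    using pw_less[OF step(1)] by (intro Henstock_Kurzweil_Integration.integrable_combine[of a b c]) auto
qed

section \<open>Length, its additivity and its invariance under affine changes of parameter\<close>

definition len :: "(real \<Rightarrow> 'a) \<Rightarrow> real \<Rightarrow> real \<Rightarrow> real" where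
  "len \<gamma> a b = integral {a..b} (speed \<gamma>)"

lemma speed_eq_at:
  assumes "isCont \<gamma> t" "c \<in> A" "\<gamma> t \<in> chart_dom c"
    "((chart_map c \<circ> \<gamma>) has_vector_derivative x') (at t)"
  shows "speed \<gamma> t = sqrt (G c (chart_map c (\<gamma> t)) x' x')"
  by (rule speed_eq) (use assms in \<open>auto simp: isCont_def\<close>)

lemma len_nonneg:
  assumes "pw \<gamma> a b"
  shows "0 \<le> len \<gamma> a b"
proof -
  obtain S where S: "finite S"
    and d: "\<And>t. t \<in> {a..b} - S \<Longrightarrow> isCont \<gamma> t \<and>
     (\<forall>c\<in>A. \<gamma> t \<in> chart_dom c \<longrightarrow> (\<exists>x'. ((chart_map c \<circ> \<gamma>) has_vector_derivative x') (at t)))"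
    using pw_differentiable[OF assms] by blast
  have "integral {a..b} (\<lambda>_. 0) \<le> integral {a..b} (speed \<gamma>)"
  proof (rule integral_le_off_finite[OF S _ pw_speed_integrable[OF assms]])
    fix t assume t: "t \<in> {a..b} - S"
    obtain c where c: "c \<in> A" "\<gamma> t \<in> chart_dom c" using chart_exists by blast
    then obtain x' where "((chart_map c \<circ> \<gamma>) has_vector_derivative x') (at t)" using d[OF t] by blast
    then show "0 \<le> speed \<gamma> t"
      using speed_eq_at[where \<gamma> = \<gamma> and t = t and c = c and x' = x'] d[OF t] c G_nonneg[OF c(1)] by simp
  qed (rule integrable_0)
  then show ?thesis by (simp add: len_def)
qed

lemma len_combine:
  assumes "pw \<gamma> a b" "a \<le> s" "s \<le> b"
  shows "len \<gamma> a s + len \<gamma> s b = len \<gamma> a b"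
  unfolding len_def
  by (rule Henstock_Kurzweil_Integration.integral_combine[OF assms(2,3) pw_speed_integrable[OF assms(1)]])

lemma len_cong:
  assumes "\<And>s. s \<in> {a<..<b} \<Longrightarrow> \<gamma> s = \<delta> s"
  shows "len \<gamma> a b = len \<delta> a b"
  unfolding len_def
proof (rule integral_spike[of "{a, b}"])
  show "\<And>t. t \<in> {a..b} - {a, b} \<Longrightarrow> speed \<delta> t = speed \<gamma> t"
    by (rule speed_within_cong[of "{a<..<b}"]) (use assms in auto)
qed simp

text \<open>The speed is multiplied by \<open>|k|\<close> and the substitution divides by
  \<open>|k|\<close>. The new interval is given as an image, which leaves the sign of
  \<open>k\<close> open, so the lemma also covers reversal.\<close>

lemma len_affine:
  assumes \<gamma>: "pw \<gamma> a b" and k: "k \<noteq> 0"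
    and ends: "{a'..b'} = (\<lambda>s. (s - m) / k) ` {a..b}"
  shows "len (\<lambda>s. \<gamma> (k * s + m)) a' b' = len \<gamma> a b"
proof -
  obtain S where S: "finite S"
    and d: "\<And>t. t \<in> {a..b} - S \<Longrightarrow> isCont \<gamma> t \<and>
     (\<forall>c\<in>A. \<gamma> t \<in> chart_dom c \<longrightarrow> (\<exists>x'. ((chart_map c \<circ> \<gamma>) has_vector_derivative x') (at t)))"
    using pw_differentiable[OF \<gamma>] by blast
  let ?\<delta> = "\<lambda>s. \<gamma> (k * s + m)"
  have sp: "speed ?\<delta> s = \<bar>k\<bar> * speed \<gamma> (k * s + m)" if s: "k * s + m \<in> {a..b} - S" for s
  proof -
    obtain c where c: "c \<in> A" "\<gamma> (k * s + m) \<in> chart_dom c" using chart_exists by blast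
    then obtain x' where x': "((chart_map c \<circ> \<gamma>) has_vector_derivative x') (at (k * s + m))"
      using d[OF s] by blast
    have f: "((\<lambda>s. k * s + m) has_vector_derivative k) (at s)" by (auto intro!: derivative_eq_intros)
    from vector_diff_chain_at[OF f x']
    have "((chart_map c \<circ> ?\<delta>) has_vector_derivative k *\<^sub>R x') (at s)" by (simp add: comp_def)
    moreover have "isCont ?\<delta> s"
      by (rule isCont_o2[where f = "\<lambda>s. k * s + m"]) (use d[OF s] in \<open>auto intro!: continuous_intros\<close>)
    ultimately have "speed ?\<delta> s = sqrt (G c (chart_map c (\<gamma> (k * s + m))) (k *\<^sub>R x') (k *\<^sub>R x'))"
      using c by (intro speed_eq_at) auto
    also have "\<dots> = sqrt (k\<^sup>2 * G c (chart_map c (\<gamma> (k * s + m))) x' x')"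
      using G_bilinear[OF c(1), of "chart_map c (\<gamma> (k * s + m))"] c
      by (simp add: bilinear_lmul bilinear_rmul power2_eq_square)
    also have "\<dots> = \<bar>k\<bar> * speed \<gamma> (k * s + m)"
      using speed_eq_at[OF _ c x'] d[OF s] by (simp add: real_sqrt_mult)
    finally show ?thesis .
  qed
  have img: "(\<lambda>s. (s - m) / k) ` {a..b} = (\<lambda>x. (1 / k) *\<^sub>R x + - ((1 / k) *\<^sub>R m)) ` cbox a b"
    by (simp add: diff_divide_distrib)
  have "((\<lambda>s. speed \<gamma> (k *\<^sub>R s + m)) has_integral (1 / \<bar>k\<bar> ^ DIM(real)) *\<^sub>R len \<gamma> a b)
      ((\<lambda>x. (1 / k) *\<^sub>R x + - ((1 / k) *\<^sub>R m)) ` cbox a b)"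
    by (rule has_integral_affinity[OF _ k])
      (use pw_speed_integrable[OF \<gamma>] in \<open>simp add: len_def integrable_integral\<close>)
  then have "((\<lambda>s. speed \<gamma> (k * s + m)) has_integral (1 / \<bar>k\<bar>) * len \<gamma> a b) {a'..b'}"
    unfolding ends img by simp
  from has_integral_mult_right[OF this, of "\<bar>k\<bar>"]
  have *: "((\<lambda>s. \<bar>k\<bar> * speed \<gamma> (k * s + m)) has_integral len \<gamma> a b) {a'..b'}" using k by simp
  have "(speed ?\<delta> has_integral len \<gamma> a b) {a'..b'}"
  proof (rule has_integral_spike_finite[OF _ _ *])
    show "finite ((\<lambda>s. (s - m) / k) ` S)" using S by simp
    fix s assume s: "s \<in> {a'..b'} - (\<lambda>s. (s - m) / k) ` S"
    obtain t where "t \<in> {a..b}" "s = (t - m) / k" using s ends by blast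
    then have t: "k * s + m \<in> {a..b}" using k by simp
    have "k * s + m \<notin> S"
    proof
      assume "k * s + m \<in> S"
      then have "(k * s + m - m) / k \<in> (\<lambda>s. (s - m) / k) ` S" by (rule imageI)
      then show False using s k by simp
    qed
    then show "speed ?\<delta> s = \<bar>k\<bar> * speed \<gamma> (k * s + m)" using t by (intro sp) auto
  qed
  then show ?thesis by (simp add: len_def integral_unique)
qed


subsection \<open>The Riemannian distance\<close>

abbreviation "d \<equiv> riemannian_dist A \<gg>"

lemma piecewise_C1_curve_iff_pw: "piecewise_C1_curve A \<gamma> \<longleftrightarrow> pw \<gamma> 0 1"
proof
  assume "piecewise_C1_curve A \<gamma>"
  then obtain n \<tau> where \<tau>: "\<tau> 0 = (0::real)" "\<tau> n = 1"
    and step: "\<forall>i<n. \<tau> i < \<tau> (Suc i) \<and> C1_curve_on A {\<tau> i..\<tau> (Suc i)} \<gamma>"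
    unfolding piecewise_C1_curve_def by (elim exE conjE) (rule that)
  have pws: "Suc k \<le> n \<Longrightarrow> pw \<gamma> (\<tau> 0) (\<tau> (Suc k))" for k
  proof (induction k)
    case 0
    then show ?case using step by (intro pw.base) auto
  next
    case (Suc k)
    then have "pw \<gamma> (\<tau> 0) (\<tau> (Suc k))" by simp
    then show ?case by (rule pw.step) (use step Suc.prems in auto)
  qed
  have "n \<noteq> 0" using \<tau> by (intro notI) simp
  then obtain k where "n = Suc k" using not0_implies_Suc by blast
  then show "pw \<gamma> 0 1" using pws[of k] \<tau> by simp
next
  define P where "P a b n \<tau> \<longleftrightarrow> \<tau> 0 = a \<and> \<tau> n = b \<and>
      (\<forall>i<n. \<tau> i < \<tau> (Suc i) \<and> C1_curve_on A {\<tau> i..\<tau> (Suc i)} \<gamma>)" for a b n and \<tau> :: "nat \<Rightarrow> real"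
  have "\<exists>n \<tau>. P a b n \<tau>" if "pw \<gamma> a b" for a b
    using that
  proof (induction rule: pw.induct)
    case (base a b)
    then have "P a b 1 (\<lambda>i. if i = 0 then a else b)" by (simp add: P_def)
    then show ?case by blast
  next
    case (step a b c)
    then obtain n \<tau> where \<tau>: "P a b n \<tau>" by blast
    let ?\<tau> = "\<tau>(Suc n := c)"
    have "?\<tau> i < ?\<tau> (Suc i) \<and> C1_curve_on A {?\<tau> i..?\<tau> (Suc i)} \<gamma>" if "i < Suc n" for i
      using that \<tau> step unfolding P_def by (cases "i = n") auto
    then have "P a c (Suc n) ?\<tau>" using \<tau> by (simp add: P_def)
    then show ?case by blast
  qed
  moreover assume "pw \<gamma> 0 1"
  ultimately show "piecewise_C1_curve A \<gamma>" unfolding piecewise_C1_curve_def P_def .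
qed

lemma curve_length_eq_len: "curve_length A \<gg> \<gamma> = len \<gamma> 0 1"
  unfolding curve_length_def len_def speed_within_def[symmetric]
proof (rule integral_spike[of "{0, 1}"])
  show "\<And>t. t \<in> {0..1} - {0, 1} \<Longrightarrow> speed \<gamma> t = speed_within {0..1} \<gamma> t"
    using speed_within_Icc by auto
qed simp

definition lengths :: "'a \<Rightarrow> 'a \<Rightarrow> real set" where
  "lengths p q = {len \<gamma> 0 1 | \<gamma>. pw \<gamma> 0 1 \<and> \<gamma> 0 = p \<and> \<gamma> 1 = q}"

lemma rdist_eq: "d p q = Inf (lengths p q)"
  unfolding riemannian_dist_def lengths_def piecewise_C1_curve_iff_pw curve_length_eq_len ..

lemma lengths_nonneg: "l \<in> lengths p q \<Longrightarrow> 0 \<le> l"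
  using len_nonneg by (auto simp: lengths_def)

lemma lengths_bdd_below: "bdd_below (lengths p q)"
  using lengths_nonneg by (rule bdd_belowI)

lemma len_in_lengths:
  assumes \<gamma>: "pw \<gamma> a b"
  shows "len \<gamma> a b \<in> lengths (\<gamma> a) (\<gamma> b)"
proof -
  have ab: "a < b" by (rule pw_less[OF \<gamma>])
  let ?\<delta> = "\<lambda>s. \<gamma> ((b - a) * s + a)"
  have "pw ?\<delta> 0 1"
    by (rule pw_affine[OF \<gamma>, where k = "b - a" and m = a]) (use ab in auto)
  moreover have "len ?\<delta> 0 1 = len \<gamma> a b"
  proof (rule len_affine[OF \<gamma>])
    show "{0..1} = (\<lambda>s. (s - a) / (b - a)) ` {a..b}"
    proof
      show "{0..1} \<subseteq> (\<lambda>s. (s - a) / (b - a)) ` {a..b}"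
      proof
        fix s :: real assume s: "s \<in> {0..1}"
        have "a + (b - a) * s \<le> a + (b - a) * 1" using s ab by (intro add_left_mono mult_left_mono) auto
        then have "a + (b - a) * s \<in> {a..b}" using s ab by auto
        moreover have "s = (a + (b - a) * s - a) / (b - a)" using ab by simp
        ultimately show "s \<in> (\<lambda>s. (s - a) / (b - a)) ` {a..b}" by (rule rev_image_eqI)
      qed
    qed (use ab in auto)
  qed (use ab in simp)
  ultimately have "\<exists>\<delta>. len \<gamma> a b = len \<delta> 0 1 \<and> pw \<delta> 0 1 \<and> \<delta> 0 = \<gamma> a \<and> \<delta> 1 = \<gamma> b"
    by (intro exI[of _ ?\<delta>]) auto
  then show ?thesis unfolding lengths_def by blast
qed

lemma rdist_le_len: "pw \<gamma> a b \<Longrightarrow> d (\<gamma> a) (\<gamma> b) \<le> len \<gamma> a b"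
  unfolding rdist_eq using len_in_lengths lengths_bdd_below by (intro cInf_lower)

lemma lengths_trans:
  assumes "l \<in> lengths p q" "l' \<in> lengths q r"
  shows "l + l' \<in> lengths p r"
proof -
  obtain \<gamma> where \<gamma>: "pw \<gamma> 0 1" "\<gamma> 0 = p" "\<gamma> 1 = q" "l = len \<gamma> 0 1"
    using assms(1) unfolding lengths_def by blast
  obtain \<gamma>' where \<gamma>': "pw \<gamma>' 0 1" "\<gamma>' 0 = q" "\<gamma>' 1 = r" "l' = len \<gamma>' 0 1"
    using assms(2) unfolding lengths_def by blast
  \<comment> \<open>The redundant form \<open>1 * t + (- 1)\<close> matches the shape expected by
    the affine lemmas.\<close>
  define \<delta> where "\<delta> t = (if t \<le> 1 then \<gamma> t else \<gamma>' (1 * t + (- 1)))" for t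
  have 1: "pw \<delta> 0 1" by (rule pw_cong[OF \<gamma>(1)]) (simp add: \<delta>_def)
  have 2: "pw \<delta> 1 2"
  proof (rule pw_affine[OF \<gamma>'(1), where k = 1 and m = "- 1"])
    fix s :: real assume "s \<in> {1..2}"
    then show "\<delta> s = \<gamma>' (1 * s + - 1)"
      using \<gamma>(3) \<gamma>'(2) by (cases "s = 1") (auto simp: \<delta>_def)
  qed auto
  have pw: "pw \<delta> 0 2" by (rule pw_trans[OF 2 1])
  have "len \<delta> 0 1 = l" unfolding \<gamma>(4) by (rule len_cong) (simp add: \<delta>_def)
  moreover have "len \<delta> 1 2 = l'"
  proof -
    have "len \<delta> 1 2 = len (\<lambda>t. \<gamma>' (1 * t + - 1)) 1 2" by (rule len_cong) (simp add: \<delta>_def)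
    also have "\<dots> = len \<gamma>' 0 1" by (rule len_affine[OF \<gamma>'(1)]) (auto simp: image_iff)
    finally show ?thesis using \<gamma>'(4) by simp
  qed
  ultimately have "len \<delta> 0 2 = l + l'" using len_combine[OF pw, of 1] by simp
  moreover have "\<delta> 0 = p" "\<delta> 2 = r" using \<gamma> \<gamma>' by (auto simp: \<delta>_def)
  ultimately show ?thesis using len_in_lengths[OF pw] by simp
qed

lemma lengths_sym: "lengths p q \<subseteq> lengths q p"
proof
  fix l assume "l \<in> lengths p q"
  then obtain \<gamma> where \<gamma>: "pw \<gamma> 0 1" "\<gamma> 0 = p" "\<gamma> 1 = q" "l = len \<gamma> 0 1"
    unfolding lengths_def by blast
  have "len (\<lambda>s. \<gamma> (- s)) (- 1) 0 = len (\<lambda>s. \<gamma> (- 1 * s + 0)) (- 1) 0" by simp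
  also have "\<dots> = len \<gamma> 0 1"
    by (rule len_affine[OF \<gamma>(1)]) (auto simp: image_iff intro!: bexI[of _ "- _"])
  finally have "len (\<lambda>s. \<gamma> (- s)) (- 1) 0 = l" using \<gamma>(4) by simp
  then show "l \<in> lengths q p" using len_in_lengths[OF pw_reverse[OF \<gamma>(1)]] \<gamma> by simp
qed

lemma rdist_sym: "d p q = d q p"
  unfolding rdist_eq using lengths_sym by (metis subset_antisym)


subsection \<open>Curves in a chart\<close>

text \<open>In any other chart the derivative is the derivative of the transition map at
  \<open>x t\<close> applied to \<open>x' t\<close>. It is continuous because transitions are
  smooth, so a \<open>C1\<close> coordinate curve is \<open>C1\<close> in all charts.\<close>

lemma chart_curve:
  assumes c: "c \<in> A" and ab: "a < b"
    and xU: "\<And>t. t \<in> {a..b} \<Longrightarrow> x t \<in> U c"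
    and x': "\<And>t. t \<in> {a..b} \<Longrightarrow> (x has_vector_derivative x' t) (at t within {a..b})"
    and cont: "continuous_on {a..b} x'"
  shows "pw (chart_inv c \<circ> x) a b"
    and "len (chart_inv c \<circ> x) a b = integral {a..b} (\<lambda>t. sqrt (G c (x t) (x' t) (x' t)))"
proof -
  let ?\<gamma> = "chart_inv c \<circ> x"
  have xcont: "continuous_on {a..b} x"
    using x' has_vector_derivative_continuous continuous_on_eq_continuous_within by blast
  have \<gamma>cont: "continuous_on {a..b} ?\<gamma>"
    by (rule continuous_on_compose[OF xcont continuous_on_subset[OF continuous_chart_inv[OF c]]])
      (use xU in blast)
  have dom: "?\<gamma> t \<in> chart_dom c" if "t \<in> {a..b}" for t
    using chart_inv_in[OF c xU[OF that]] by simp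
  have cx: "((chart_map c \<circ> ?\<gamma>) has_vector_derivative x' t) (at t within {a..b})" if t: "t \<in> {a..b}" for t
    by (rule has_vector_derivative_transform[OF t _ x'[OF t]]) (simp add: chart_map_inv[OF c xU])
  have lim: "(?\<gamma> \<longlongrightarrow> ?\<gamma> t) (at t within {a..b})" if "t \<in> {a..b}" for t
    using \<gamma>cont that unfolding continuous_on_def by blast
  have "C1_curve_on A {a..b} ?\<gamma>"
    unfolding C1_curve_on_def
  proof (intro conjI \<gamma>cont ballI)
    fix e assume e: "e \<in> A"
    define y' where "y' t = frechet_derivative (transition c e) (at (x t)) (x' t)" for t
    have y'_eq: "y' t = coord_change c e (?\<gamma> t) (x' t)" if "t \<in> {a..b}" for t
      by (simp add: y'_def coord_change_def chart_map_inv[OF c xU[OF that]])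
    show "\<exists>y'. \<forall>t\<in>{a..b}. ?\<gamma> t \<in> chart_dom e \<longrightarrow>
        ((chart_map e \<circ> ?\<gamma>) has_vector_derivative y' t) (at t within {a..b}) \<and>
        continuous (at t within {a..b}) y'"
    proof (intro exI[of _ y'] ballI impI conjI)
      fix t assume t: "t \<in> {a..b}" and dom_e: "?\<gamma> t \<in> chart_dom e"
      show "((chart_map e \<circ> ?\<gamma>) has_vector_derivative y' t) (at t within {a..b})"
        unfolding y'_eq[OF t]
        by (rule curve_chart_change[where \<gamma> = ?\<gamma>, OF lim[OF t] c dom[OF t] e dom_e t cx[OF t]])
      let ?V = "chart_map c ` (chart_dom c \<inter> chart_dom e)"
      have xV: "x t \<in> ?V"
        using dom[OF t] dom_e chart_map_inv[OF c xU[OF t]]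
        by (intro image_eqI[of _ _ "chart_inv c (x t)"]) auto
      have smooth: "smooth_on ?V (transition c e)" using atlas c e by (simp add: smooth_atlas_def)
      have xlim: "(x \<longlongrightarrow> x t) (at t within {a..b})"
        using xcont t by (simp add: continuous_on_def)
      have lin: "linear (frechet_derivative (transition c e) (at y))" if "y \<in> ?V" for y
        using smooth_on_has_derivative[OF smooth that] by (rule has_derivative_linear)
      show "continuous (at t within {a..b}) y'"
        unfolding continuous_within y'_def
      proof (rule tendsto_linear_family[where L = "\<lambda>y. frechet_derivative (transition c e) (at y)"])
        show "eventually (\<lambda>s. linear (frechet_derivative (transition c e) (at (x s)))) (at t within {a..b})"
          using topological_tendstoD[OF xlim open_overlap[OF c e] xV]
          by (rule eventually_mono) (rule lin)
        show "linear (frechet_derivative (transition c e) (at (x t)))" by (rule lin[OF xV])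
        show "(x' \<longlongrightarrow> x' t) (at t within {a..b})" using cont t by (simp add: continuous_on_def)
        fix i :: 'e
        have "continuous_on ?V (\<lambda>y. frechet_derivative (transition c e) (at y) i)"
          by (rule smooth_on_continuous_on[OF smooth_on_frechet_derivative[OF smooth]])
        then have "isCont (\<lambda>y. frechet_derivative (transition c e) (at y) i) (x t)"
          using xV continuous_on_eq_continuous_at[OF open_overlap[OF c e]] by blast
        from isCont_tendsto_compose[OF this xlim]
        show "((\<lambda>s. frechet_derivative (transition c e) (at (x s)) i) \<longlongrightarrow>
            frechet_derivative (transition c e) (at (x t)) i) (at t within {a..b})" .
      qed
    qed
  qed
  then show pw: "pw ?\<gamma> a b" using ab by (rule pw.base[rotated])
  show "len ?\<gamma> a b = integral {a..b} (\<lambda>t. sqrt (G c (x t) (x' t) (x' t)))"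
    unfolding len_def
  proof (rule integral_spike[of "{a, b}"])
    fix t assume "t \<in> {a..b} - {a, b}"
    then have t: "t \<in> {a..b}" "a < t" "t < b" by auto
    show "sqrt (G c (x t) (x' t) (x' t)) = speed ?\<gamma> t"
      using speed_eq[where \<gamma> = ?\<gamma>, OF lim[OF t(1)] c dom[OF t(1)] t(1) at_within_Icc_nontriv[OF ab t(1)] cx[OF t(1)]]
        speed_within_Icc[OF t(2,3), of ?\<gamma>]
      by (simp add: chart_map_inv[OF c xU[OF t(1)]])
  qed simp
qed

lemma lengths_segment:
  assumes c: "c \<in> A" and seg: "closed_segment x y \<subseteq> U c"
  shows "integral {0..1} (\<lambda>t. sqrt (G c (x + t *\<^sub>R (y - x)) (y - x) (y - x)))
    \<in> lengths (chart_inv c x) (chart_inv c y)"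
proof -
  let ?x = "\<lambda>t. x + t *\<^sub>R (y - x)"
  have "?x t \<in> U c" if "t \<in> {0..1}" for t
  proof -
    have "?x t \<in> closed_segment x y"
      unfolding closed_segment_def using that
      by (intro CollectI exI[of _ t]) (simp add: algebra_simps)
    then show ?thesis using seg by blast
  qed
  moreover have "(?x has_vector_derivative (y - x)) (at t within {0..1})" for t
    by (auto intro!: derivative_eq_intros)
  ultimately have "pw (chart_inv c \<circ> ?x) 0 1"
    "len (chart_inv c \<circ> ?x) 0 1 = integral {0..1} (\<lambda>t. sqrt (G c (?x t) (y - x) (y - x)))"
    using chart_curve[OF c, of 0 1 ?x "\<lambda>_. y - x"] by auto
  then show ?thesis using len_in_lengths[of "chart_inv c \<circ> ?x" 0 1] by simp
qed

section \<open>Joining points by curves, and the pseudometric properties of the distance\<close>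

lemma zero_in_lengths: "0 \<in> lengths p p"
proof -
  obtain c where c: "c \<in> A" "p \<in> chart_dom c" using chart_exists by blast
  then have U: "chart_map c p \<in> U c" by blast
  show ?thesis
    using lengths_segment[OF c(1), of "chart_map c p" "chart_map c p"] U
      bilinear_lzero[OF G_bilinear[OF c(1) U]]
    by (simp add: chart_inv_map c)
qed

text \<open>Being joined by a piecewise \<open>C1\<close> curve is an equivalence relation, and
  segments in a coordinate ball show that each point has a neighbourhood of equivalent points.
  Connectedness leaves one class. Without this fact the infimum defining the distance would carry no
  information.\<close>

lemma lengths_nonempty: "lengths p q \<noteq> {}"
proof -
  have "connected (UNIV :: 'a set)" using manifold by (simp add: riemannian_manifold_def)
  then show ?thesis
  proof (rule connected_equivalence_relation[where R = "\<lambda>p q. lengths p q \<noteq> {}"])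
    show "\<And>p q. lengths p q \<noteq> {} \<Longrightarrow> lengths q p \<noteq> {}" using lengths_sym by blast
    show "\<And>p q r. lengths p q \<noteq> {} \<Longrightarrow> lengths q r \<noteq> {} \<Longrightarrow> lengths p r \<noteq> {}"
      using lengths_trans by blast
    fix p :: 'a
    obtain c where c: "c \<in> A" "p \<in> chart_dom c" using chart_exists by blast
    then obtain R where R: "0 < R" "ball (chart_map c p) R \<subseteq> U c"
      using open_U[OF c(1)] open_contains_ball by blast
    define V where "V = chart_dom c \<inter> chart_map c -` ball (chart_map c p) R"
    have "open V" unfolding V_def
      by (rule continuous_open_preimage[OF continuous_chart_map open_dom open_ball]) (use c in auto)
    moreover have "lengths p q \<noteq> {}" if "q \<in> V" for q
    proof -
      have "closed_segment (chart_map c p) (chart_map c q) \<subseteq> ball (chart_map c p) R"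
        using that R by (intro closed_segment_subset) (auto simp: V_def)
      then show ?thesis
        using lengths_segment[OF c(1), of "chart_map c p" "chart_map c q"] R c that
        by (auto simp: chart_inv_map V_def)
    qed
    ultimately show "\<exists>T. openin (top_of_set UNIV) T \<and> p \<in> T \<and> (\<forall>x\<in>T. lengths p x \<noteq> {})"
      using c R by (intro exI[of _ V]) (auto simp: V_def)
  qed auto
qed

lemma rdist_lessE:
  assumes "d p q < r"
  obtains \<gamma> where "pw \<gamma> 0 1" "\<gamma> 0 = p" "\<gamma> 1 = q" "len \<gamma> 0 1 < r"
  using cInf_lessD[OF lengths_nonempty assms[unfolded rdist_eq]] unfolding lengths_def by blast

lemma rdist_nonneg: "0 \<le> d p q"
  unfolding rdist_eq by (rule cInf_greatest[OF lengths_nonempty lengths_nonneg])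

lemma rdist_self: "d p p = 0"
  using cInf_lower[OF zero_in_lengths lengths_bdd_below, of p] rdist_nonneg[of p p]
  unfolding rdist_eq by (rule order_antisym)

lemma rdist_triangle: "d p r \<le> d p q + d q r"
proof (rule field_le_epsilon)
  fix \<epsilon> :: real assume "0 < \<epsilon>"
  then have "d p q < d p q + \<epsilon> / 2" "d q r < d q r + \<epsilon> / 2" by auto
  then obtain l l' where "l \<in> lengths p q" "l' \<in> lengths q r" "l < d p q + \<epsilon> / 2" "l' < d q r + \<epsilon> / 2"
    using cInf_lessD[OF lengths_nonempty] unfolding rdist_eq by blast
  moreover have "d p r \<le> l + l'"
    unfolding rdist_eq by (rule cInf_lower[OF lengths_trans lengths_bdd_below]) fact+
  ultimately show "d p r \<le> d p q + d q r + \<epsilon>" by linarith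
qed

end


subsection \<open>Uniform bounds near a point of a chart\<close>

lemma linear_abs_bound:
  fixes l :: "'e::euclidean_space \<Rightarrow> real"
  assumes "linear l"
  shows "\<bar>l u\<bar> \<le> (\<Sum>k\<in>Basis. \<bar>l k\<bar>) * norm u"
proof -
  have "l u = l (\<Sum>k\<in>Basis. (u \<bullet> k) *\<^sub>R k)" by (simp add: euclidean_representation)
  also have "\<dots> = (\<Sum>k\<in>Basis. (u \<bullet> k) * l k)"
    by (simp add: linear_sum[OF assms] linear_cmul[OF assms])
  finally have "\<bar>l u\<bar> \<le> (\<Sum>k\<in>Basis. \<bar>(u \<bullet> k) * l k\<bar>)" by (metis sum_abs)
  also have "\<dots> \<le> (\<Sum>k\<in>Basis. \<bar>l k\<bar> * norm u)"
    by (rule sum_mono) (simp add: abs_mult Basis_le_norm mult.commute[of "\<bar>_ \<bullet> _\<bar>"] mult_left_mono)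
  finally show ?thesis by (simp add: sum_distrib_right)
qed

lemma bilinear_abs_bound:
  fixes B :: "'e::euclidean_space \<Rightarrow> 'e \<Rightarrow> real"
  assumes B: "bilinear B"
  shows "\<bar>B v w\<bar> \<le> (\<Sum>i\<in>Basis. \<Sum>j\<in>Basis. \<bar>B i j\<bar>) * norm v * norm w"
proof -
  have l: "linear (B v)" "linear (\<lambda>v. B v w)" for v w using B by (auto simp: bilinear_def)
  have "\<bar>B v w\<bar> \<le> (\<Sum>i\<in>Basis. \<bar>B i w\<bar>) * norm v" by (rule linear_abs_bound[OF l(2)])
  also have "\<dots> \<le> (\<Sum>i\<in>Basis. (\<Sum>j\<in>Basis. \<bar>B i j\<bar>) * norm w) * norm v"
    by (intro mult_right_mono sum_mono linear_abs_bound[OF l(1)]) simp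
  finally show ?thesis unfolding sum_distrib_right[symmetric] by (simp add: mult_ac)
qed

lemma smooth_on_bounded:
  fixes f :: "'e::euclidean_space \<Rightarrow> real"
  assumes "smooth_on U f" "compact K" "K \<subseteq> U"
  shows "\<exists>B\<ge>0. \<forall>x\<in>K. \<bar>f x\<bar> \<le> B"
proof -
  have "compact (f ` K)"
    by (rule compact_continuous_image[OF continuous_on_subset[OF smooth_on_continuous_on[OF assms(1)] assms(3)] assms(2)])
  then obtain B where "\<forall>y\<in>f ` K. norm y \<le> B" using compact_imp_bounded bounded_iff by metis
  then show ?thesis by (intro exI[of _ "max 0 B"]) (auto simp: le_max_iff_disj)
qed

lemma smooth_on_Lipschitz:
  fixes f :: "'e::euclidean_space \<Rightarrow> real"
  assumes f: "smooth_on U f" and K: "compact K" "K \<subseteq> U" "convex K"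
  shows "\<exists>B\<ge>0. \<forall>x\<in>K. \<forall>y\<in>K. \<bar>f x - f y\<bar> \<le> B * norm (x - y)"
proof -
  have "\<forall>k. \<exists>B\<ge>0. \<forall>x\<in>K. \<bar>frechet_derivative f (at x) k\<bar> \<le> B"
    using smooth_on_bounded[OF smooth_on_frechet_derivative[OF f] K(1,2)] by blast
  then obtain B where B: "\<And>k. 0 \<le> B k" "\<And>k x. x \<in> K \<Longrightarrow> \<bar>frechet_derivative f (at x) k\<bar> \<le> B k"
    by metis
  have "\<bar>f x - f y\<bar> \<le> (\<Sum>k\<in>Basis. B k) * norm (x - y)" if xy: "x \<in> K" "y \<in> K" for x y
  proof -
    have "norm (f x - f y) \<le> (\<Sum>k\<in>Basis. B k) * norm (x - y)"
    proof (rule differentiable_bound[OF K(3)])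
      fix z assume z: "z \<in> K"
      have D: "(f has_derivative frechet_derivative f (at z)) (at z)"
        using smooth_on_has_derivative[OF f] z K(2) by blast
      then show "(f has_derivative frechet_derivative f (at z)) (at z within K)"
        by (rule has_derivative_at_withinI)
      show "onorm (frechet_derivative f (at z)) \<le> (\<Sum>k\<in>Basis. B k)"
      proof (rule onorm_le)
        fix u
        have "\<bar>frechet_derivative f (at z) u\<bar> \<le> (\<Sum>k\<in>Basis. \<bar>frechet_derivative f (at z) k\<bar>) * norm u"
          by (rule linear_abs_bound[OF has_derivative_linear[OF D]])
        also have "\<dots> \<le> (\<Sum>k\<in>Basis. B k) * norm u"
          by (intro mult_right_mono sum_mono B z) simp
        finally show "norm (frechet_derivative f (at z) u) \<le> (\<Sum>k\<in>Basis. B k) * norm u" by simp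
      qed
    qed (use xy in auto)
    then show ?thesis by simp
  qed
  moreover have "0 \<le> (\<Sum>k\<in>Basis. B k)" using B by (simp add: sum_nonneg)
  ultimately show ?thesis by blast
qed

context riemannian
begin

definition DG :: "('a, 'e) chart \<Rightarrow> 'e \<Rightarrow> 'e \<Rightarrow> 'e \<Rightarrow> 'e \<Rightarrow> real" where
  "DG c x v w u = frechet_derivative (\<lambda>y. G c y v w) (at x) u"

lemma DG_has_derivative:
  assumes "c \<in> A" "x \<in> U c"
  shows "((\<lambda>y. G c y v w) has_derivative DG c x v w) (at x)"
  using smooth_on_has_derivative[OF G_smooth[OF assms(1)] assms(2), of v w]
  unfolding DG_def[abs_def] .

text \<open>Transfers pointwise identities of the metric to its derivative. Symmetry and bilinearity
  of \<open>DG\<close> are obtained this way.\<close>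

lemma DG_unique:
  assumes c: "c \<in> A" "x \<in> U c" and f: "(f has_derivative f') (at x)"
    and eq: "\<And>y. y \<in> U c \<Longrightarrow> f y = G c y v w"
  shows "DG c x v w = f'"
proof -
  have "((\<lambda>y. G c y v w) has_derivative f') (at x)"
    by (rule has_derivative_transform_within_open[OF f open_U[OF c(1)] c(2) eq])
  then show ?thesis using DG_has_derivative[OF c] has_derivative_unique by blast
qed

lemma DG_sym:
  assumes c: "c \<in> A" "x \<in> U c"
  shows "DG c x v w u = DG c x w v u"
  using DG_unique[OF c DG_has_derivative[OF c, of w v], of v w] G_sym[OF c(1)] by simp

lemma DG_bilinear:
  assumes c: "c \<in> A" "x \<in> U c"
  shows "bilinear (\<lambda>v w. DG c x v w u)"
proof -
  have "DG c x (v + v') w = (\<lambda>u. DG c x v w u + DG c x v' w u)" for v v' w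
    by (rule DG_unique[OF c has_derivative_add[OF DG_has_derivative[OF c] DG_has_derivative[OF c]]])
      (simp add: bilinear_ladd[OF G_bilinear[OF c(1)]])
  moreover have "DG c x (a *\<^sub>R v) w = (\<lambda>u. a * DG c x v w u)" for a v w
    by (rule DG_unique[OF c has_derivative_mult_right[OF DG_has_derivative[OF c]]])
      (simp add: bilinear_lmul[OF G_bilinear[OF c(1)]])
  ultimately have l: "linear (\<lambda>v. DG c x v w u)" for w
    by (intro linearI) auto
  have "(\<lambda>w. DG c x v w u) = (\<lambda>w. DG c x w v u)" for v using DG_sym[OF c] by blast
  then have "linear (\<lambda>w. DG c x v w u)" for v using l by simp
  then show ?thesis using l by (simp add: bilinear_def)
qed

lemma DG_smooth: "c \<in> A \<Longrightarrow> smooth_on (U c) (\<lambda>x. DG c x v w u)"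
  unfolding DG_def by (rule smooth_on_frechet_derivative[OF G_smooth])

text \<open>The constant is the minimum of the metric over \<open>K\<close> times the unit sphere,
  positive by definiteness. Homogeneity extends the bound to all vectors.\<close>

lemma G_coercive_on_compact:
  assumes c: "c \<in> A" and K: "compact K" "K \<subseteq> U c" "K \<noteq> {}"
  shows "\<exists>lam>0. \<forall>x\<in>K. \<forall>v. lam * (norm v)\<^sup>2 \<le> G c x v v"
proof -
  let ?f = "\<lambda>z. G c (fst z) (snd z) (snd z)"
  let ?T = "K \<times> sphere (0::'e) 1"
  have "continuous_on ?T ?f"
    unfolding continuous_on_def
  proof
    fix z assume "z \<in> ?T"
    then show "(?f \<longlongrightarrow> ?f z) (at z within ?T)"
      using K by (intro G_tendsto[OF c] tendsto_intros) auto
  qed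
  moreover have "compact ?T" using K by (intro compact_Times) auto
  moreover have "?T \<noteq> {}"
  proof -
    obtain b :: 'e where "b \<in> Basis" using nonempty_Basis by blast
    then have "b \<in> sphere 0 1" by simp
    then show ?thesis using K(3) by blast
  qed
  ultimately obtain z where z: "z \<in> ?T" "\<And>y. y \<in> ?T \<Longrightarrow> ?f z \<le> ?f y"
    using continuous_attains_inf[of ?T ?f] by blast
  have "0 < ?f z" using z(1) K by (intro G_pos[OF c]) auto
  moreover have "?f z * (norm v)\<^sup>2 \<le> G c x v v" if x: "x \<in> K" for x v
  proof (cases "v = 0")
    case True
    then show ?thesis using bilinear_lzero[OF G_bilinear[OF c]] x K by auto
  next
    case False
    define w where "w = v /\<^sub>R norm v"
    have xU: "x \<in> U c" using x K by blast
    have "(x, w) \<in> ?T" using x False by (simp add: w_def)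
    then have "?f z \<le> G c x w w" using z(2) by fastforce
    then have "?f z * (norm v)\<^sup>2 \<le> G c x w w * (norm v)\<^sup>2" by (rule mult_right_mono) simp
    also have "\<dots> = G c x v v"
      using False unfolding w_def
      by (simp add: bilinear_lmul[OF G_bilinear[OF c xU]] bilinear_rmul[OF G_bilinear[OF c xU]]
          power2_eq_square field_simps)
    finally show ?thesis .
  qed
  ultimately show ?thesis by blast
qed

lemma metric_region_exists:
  assumes c: "c \<in> A" and x0: "x0 \<in> U c"
  obtains R lam M where "0 < R" "cball x0 R \<subseteq> U c" "metric_region (cball x0 R) (G c) (DG c) lam M"
proof -
  obtain R where R: "0 < R" "cball x0 R \<subseteq> U c"
    using open_contains_cball[of "U c"] open_U[OF c] x0 by blast
  define K where "K = cball x0 R"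
  have K: "compact K" "K \<subseteq> U c" "convex K" "K \<noteq> {}" using R by (auto simp: K_def)
  note KU = subsetD[OF K(2)]
  obtain lam where lam: "0 < lam" "\<And>x v. x \<in> K \<Longrightarrow> lam * (norm v)\<^sup>2 \<le> G c x v v"
    using G_coercive_on_compact[OF c K(1,2,4)] by blast
  have "\<forall>i j. \<exists>B\<ge>0. \<forall>x\<in>K. \<bar>G c x i j\<bar> \<le> B"
    using smooth_on_bounded[OF G_smooth[OF c] K(1,2)] by blast
  then obtain B0 where B0: "\<And>i j. 0 \<le> B0 i j" "\<And>i j x. x \<in> K \<Longrightarrow> \<bar>G c x i j\<bar> \<le> B0 i j" by metis
  have "\<forall>i j k. \<exists>B\<ge>0. \<forall>x\<in>K. \<bar>DG c x i j k\<bar> \<le> B"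
    using smooth_on_bounded[OF DG_smooth[OF c] K(1,2)] by blast
  then obtain B1 where B1: "\<And>i j k. 0 \<le> B1 i j k" "\<And>i j k x. x \<in> K \<Longrightarrow> \<bar>DG c x i j k\<bar> \<le> B1 i j k" by metis
  have "\<forall>i j k. \<exists>B\<ge>0. \<forall>x\<in>K. \<forall>y\<in>K. \<bar>DG c x i j k - DG c y i j k\<bar> \<le> B * norm (x - y)"
    using smooth_on_Lipschitz[OF DG_smooth[OF c] K(1,2,3)] by blast
  then obtain B2 where B2: "\<And>i j k. 0 \<le> B2 i j k"
    "\<And>i j k x y. x \<in> K \<Longrightarrow> y \<in> K \<Longrightarrow> \<bar>DG c x i j k - DG c y i j k\<bar> \<le> B2 i j k * norm (x - y)" by metis
  define M0 where "M0 = (\<Sum>i\<in>Basis. \<Sum>j\<in>Basis. B0 i j)"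
  define M1 where "M1 = (\<Sum>i\<in>Basis. \<Sum>j\<in>Basis. \<Sum>k\<in>Basis. B1 i j k)"
  define M2 where "M2 = (\<Sum>i\<in>Basis. \<Sum>j\<in>Basis. \<Sum>k\<in>Basis. B2 i j k)"
  \<comment> \<open>\<open>M0\<close>, \<open>M1\<close> and \<open>M2\<close> sum the bounds on
    basis vectors for the metric, its derivative and the Lipschitz constant of the derivative. The
    summand 1 makes \<open>M\<close> positive.\<close>
  define M where "M = 1 + M0 + M1 + M2"
  have nonneg: "0 \<le> M0" "0 \<le> M1" "0 \<le> M2"
    unfolding M0_def M1_def M2_def by (intro sum_nonneg B0 B1 B2)+
  have tri: "\<bar>T v w u\<bar> \<le> (\<Sum>i\<in>Basis. \<Sum>j\<in>Basis. \<Sum>k\<in>Basis. b i j k) * norm v * norm w * norm u"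
    if T: "bilinear (\<lambda>v w. T v w u)" "\<And>v w. linear (T v w)"
      and b: "\<And>i j k. \<bar>T i j k\<bar> \<le> b i j k" for T :: "'e \<Rightarrow> 'e \<Rightarrow> 'e \<Rightarrow> real" and b v w u
  proof -
    have "\<bar>T v w u\<bar> \<le> (\<Sum>i\<in>Basis. \<Sum>j\<in>Basis. \<bar>T i j u\<bar>) * norm v * norm w"
      by (rule bilinear_abs_bound[OF T(1)])
    also have "\<dots> \<le> (\<Sum>i\<in>Basis. \<Sum>j\<in>Basis. (\<Sum>k\<in>Basis. b i j k) * norm u) * norm v * norm w"
    proof (intro mult_right_mono sum_mono)
      fix i j
      have "\<bar>T i j u\<bar> \<le> (\<Sum>k\<in>Basis. \<bar>T i j k\<bar>) * norm u" by (rule linear_abs_bound[OF T(2)])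
      also have "\<dots> \<le> (\<Sum>k\<in>Basis. b i j k) * norm u" by (intro mult_right_mono sum_mono b) simp
      finally show "\<bar>T i j u\<bar> \<le> (\<Sum>k\<in>Basis. b i j k) * norm u" .
    qed auto
    finally show ?thesis unfolding sum_distrib_right[symmetric] by (simp add: mult_ac)
  qed
  have Dlin: "linear (DG c x v w)" if "x \<in> K" for x v w
    using DG_has_derivative[OF c KU[OF that]] by (rule has_derivative_linear)
  have "metric_region K (G c) (DG c) lam M"
  proof
    show "convex K" by fact
    show "0 < lam" by fact
    show "0 < M" using nonneg by (simp add: M_def)
    fix x v w u assume x: "x \<in> K"
    note xU = KU[OF x]
    show "bilinear (G c x)" by (rule G_bilinear[OF c xU])
    show "G c x v w = G c x w v" by (rule G_sym[OF c xU])
    show "lam * (norm v)\<^sup>2 \<le> G c x v v" by (rule lam(2)[OF x])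
    show "((\<lambda>y. G c y v w) has_derivative DG c x v w) (at x within K)"
      by (rule has_derivative_at_withinI[OF DG_has_derivative[OF c xU]])
    show "bilinear (\<lambda>v w. DG c x v w u)" by (rule DG_bilinear[OF c xU])
    have "\<bar>G c x v w\<bar> \<le> (\<Sum>i\<in>Basis. \<Sum>j\<in>Basis. \<bar>G c x i j\<bar>) * norm v * norm w"
      by (rule bilinear_abs_bound[OF G_bilinear[OF c xU]])
    also have "\<dots> \<le> M * norm v * norm w"
    proof (intro mult_right_mono)
      have "(\<Sum>i\<in>Basis. \<Sum>j\<in>Basis. \<bar>G c x i j\<bar>) \<le> M0"
        unfolding M0_def by (intro sum_mono B0(2) x)
      then show "(\<Sum>i\<in>Basis. \<Sum>j\<in>Basis. \<bar>G c x i j\<bar>) \<le> M" using nonneg by (simp add: M_def)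
    qed auto
    finally show "\<bar>G c x v w\<bar> \<le> M * norm v * norm w" .
    have "\<bar>DG c x v w u\<bar> \<le> M1 * norm v * norm w * norm u"
      unfolding M1_def by (rule tri[OF DG_bilinear[OF c xU] Dlin[OF x] B1(2)[OF x]])
    also have "\<dots> \<le> M * norm v * norm w * norm u"
      by (intro mult_right_mono) (use nonneg in \<open>auto simp: M_def\<close>)
    finally show "\<bar>DG c x v w u\<bar> \<le> M * norm v * norm w * norm u" .
    fix y assume y: "y \<in> K"
    have "\<bar>DG c x v w u - DG c y v w u\<bar>
        \<le> (\<Sum>i\<in>Basis. \<Sum>j\<in>Basis. \<Sum>k\<in>Basis. B2 i j k * norm (x - y)) * norm v * norm w * norm u"
    proof (rule tri[of "\<lambda>v w u. DG c x v w u - DG c y v w u"])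
      show "bilinear (\<lambda>v w. DG c x v w u - DG c y v w u)"
        using DG_bilinear[OF c xU] DG_bilinear[OF c KU[OF y]]
        by (simp add: bilinear_def linear_compose_sub)
      show "\<And>v w. linear (\<lambda>u. DG c x v w u - DG c y v w u)"
        by (intro linear_compose_sub Dlin x y)
    qed (rule B2(2)[OF x y])
    also have "\<dots> = M2 * norm (x - y) * norm v * norm w * norm u"
      by (simp add: M2_def sum_distrib_right)
    also have "\<dots> \<le> M * norm (x - y) * norm v * norm w * norm u"
      by (intro mult_right_mono) (use nonneg in \<open>auto simp: M_def\<close>)
    finally show "\<bar>DG c x v w u - DG c y v w u\<bar> \<le> M * norm (x - y) * norm v * norm w * norm u" .
  qed
  then show thesis using that R unfolding K_def by blast
qed

text \<open>\<open>spray\<close> keeps the two equal terms of the Koszul formula apart, so both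
  descriptions unfold to the same predicate. This links the equation solved in coordinates to
  \<open>geodesic_on\<close>.\<close>

lemma spray_eq_christoffel: "metric_region.spray (G c) (DG c) x u = christoffel A \<gg> c x u u"
  if "metric_region K (G c) (DG c) lam M"
  unfolding metric_region.spray_def[OF that] christoffel_def DG_def by simp

end


subsection \<open>The distance inside a chart\<close>

text \<open>The one-sided chart derivative is continuous on the closed piece, hence bounded by
  compactness. In the interior it agrees with the two-sided derivative \<open>D\<close>, which
  inherits continuity and bound.\<close>

lemma (in riemannian) C1_curve_chart_derivative:
  assumes ab: "a < b" and \<gamma>: "C1_curve_on A {a..b} \<gamma>" and c: "c \<in> A" "\<gamma> ` {a..b} \<subseteq> chart_dom c"
  defines "D \<equiv> \<lambda>t. vector_derivative (chart_map c \<circ> \<gamma>) (at t)"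
  shows "\<exists>B. \<forall>t\<in>{a<..<b}. ((chart_map c \<circ> \<gamma>) has_vector_derivative D t) (at t) \<and>
    isCont D t \<and> norm (D t) \<le> B"
proof -
  obtain x' where x': "\<And>t. t \<in> {a..b} \<Longrightarrow> \<gamma> t \<in> chart_dom c \<Longrightarrow>
      ((chart_map c \<circ> \<gamma>) has_vector_derivative x' t) (at t within {a..b})"
    "\<And>t. t \<in> {a..b} \<Longrightarrow> \<gamma> t \<in> chart_dom c \<Longrightarrow> (x' \<longlongrightarrow> x' t) (at t within {a..b})"
    using C1_curve_onD[OF \<gamma> c(1)] by blast
  have dom: "\<gamma> t \<in> chart_dom c" if "t \<in> {a..b}" for t using c(2) that by blast
  have cont: "continuous_on {a..b} x'"
    unfolding continuous_on_def using x'(2) dom by blast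
  then have "compact (x' ` {a..b})" by (rule compact_continuous_image) simp
  then obtain B where B: "\<forall>y\<in>x' ` {a..b}. norm y \<le> B" using compact_imp_bounded bounded_iff by metis
  have der: "((chart_map c \<circ> \<gamma>) has_vector_derivative x' t) (at t)" if "t \<in> {a<..<b}" for t
  proof -
    have "t \<in> {a..b}" "a < t" "t < b" using that by auto
    then show ?thesis using x'(1)[OF _ dom, of t] has_vector_derivative_within_interior_ivl by blast
  qed
  then have D: "D t = x' t" if "t \<in> {a<..<b}" for t
    unfolding D_def using that by (blast intro: vector_derivative_at)
  have "isCont D t" if t: "t \<in> {a<..<b}" for t
  proof -
    have "isCont x' t" by (rule continuous_on_interior[OF cont]) (use t in simp)
    moreover have "eventually (\<lambda>s. x' s = D s) (nhds t)"
      using t D by (auto simp: eventually_nhds intro!: exI[of _ "{a<..<b}"])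
    ultimately show ?thesis using isCont_cong by blast
  qed
  then show ?thesis using der D B by (intro exI[of _ B]) auto
qed

lemma (in riemannian) pw_chart_derivative:
  assumes c: "c \<in> A"
  defines "D \<equiv> \<lambda>\<gamma> t. vector_derivative (chart_map c \<circ> \<gamma>) (at t)"
  shows "pw \<gamma> a b \<Longrightarrow> \<gamma> ` {a..b} \<subseteq> chart_dom c \<Longrightarrow>
    \<exists>S B. finite S \<and> a \<in> S \<and> b \<in> S \<and> (\<forall>t\<in>{a..b} - S.
      ((chart_map c \<circ> \<gamma>) has_vector_derivative D \<gamma> t) (at t) \<and> isCont (D \<gamma>) t \<and> norm (D \<gamma> t) \<le> B)"
proof (induction rule: pw.induct)
  case (base a b)
  obtain B where B: "\<forall>t\<in>{a<..<b}. ((chart_map c \<circ> \<gamma>) has_vector_derivative D \<gamma> t) (at t) \<and>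
      isCont (D \<gamma>) t \<and> norm (D \<gamma> t) \<le> B"
    unfolding D_def using C1_curve_chart_derivative[OF base(1,2) c base(3)] by blast
  have eq: "{a..b} - {a, b} = {a<..<b}" by auto
  show ?case by (intro exI[of _ "{a, b}"] exI[of _ B] conjI B[folded eq]) simp_all
next
  case (step a b e)
  have ab: "a < b" using pw_less step(1) by blast
  obtain S B where S: "finite S" "a \<in> S" "b \<in> S" and B: "\<forall>t\<in>{a..b} - S.
      ((chart_map c \<circ> \<gamma>) has_vector_derivative D \<gamma> t) (at t) \<and> isCont (D \<gamma>) t \<and> norm (D \<gamma> t) \<le> B"
  proof -
    have "\<gamma> ` {a..b} \<subseteq> chart_dom c" using step.prems step.hyps(2) by (auto simp: image_subset_iff)
    then show ?thesis using step.IH that by blast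
  qed
  have "\<gamma> ` {b..e} \<subseteq> chart_dom c" using step.prems ab by (auto simp: image_subset_iff)
  then obtain B' where B': "\<forall>t\<in>{b<..<e}. ((chart_map c \<circ> \<gamma>) has_vector_derivative D \<gamma> t) (at t) \<and>
      isCont (D \<gamma>) t \<and> norm (D \<gamma> t) \<le> B'"
    unfolding D_def using C1_curve_chart_derivative[OF step(2,3) c] by blast
  have *: "\<forall>t\<in>{a..e} - insert e S. ((chart_map c \<circ> \<gamma>) has_vector_derivative D \<gamma> t) (at t) \<and>
      isCont (D \<gamma>) t \<and> norm (D \<gamma> t) \<le> max B B'"
  proof
    fix t assume t: "t \<in> {a..e} - insert e S"
    then have "t \<noteq> b" using S by auto
    then have "t \<in> {a..b} - S \<or> t \<in> {b<..<e}" using t by auto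
    then show "((chart_map c \<circ> \<gamma>) has_vector_derivative D \<gamma> t) (at t) \<and>
      isCont (D \<gamma>) t \<and> norm (D \<gamma> t) \<le> max B B'"
      using B B' by (metis le_max_iff_disj)
  qed
  show ?case by (intro exI[of _ "insert e S"] exI[of _ "max B B'"] conjI *) (use S in simp_all)
qed

section \<open>Lengths and distances measured in a closed coordinate ball\<close>

locale chart_region = riemannian A \<gg>
  for A :: "('a::{t2_space, second_countable_topology}, 'e::euclidean_space) chart set"
    and \<gg> :: "('a, 'e) metric_field" +
  fixes c :: "('a, 'e) chart" and x0 :: 'e and R lam M :: real
  assumes c: "c \<in> A" and R: "0 < R" and K_sub: "cball x0 R \<subseteq> U c"
    and region: "metric_region (cball x0 R) (G c) (DG c) lam M"
begin

sublocale R: metric_region "cball x0 R" "G c" "DG c" lam M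
  by (rule region)

abbreviation "\<Phi> \<equiv> chart_inv c"
abbreviation "\<xi> \<equiv> chart_map c"

lemma KU: "x \<in> cball x0 R \<Longrightarrow> x \<in> U c" using K_sub by blast

lemma \<xi>\<Phi>: "x \<in> cball x0 R \<Longrightarrow> \<xi> (\<Phi> x) = x"
  using chart_map_inv[OF c] KU by blast

lemma \<Phi>\<xi>: "p \<in> chart_dom c \<Longrightarrow> \<Phi> (\<xi> p) = p"
  using chart_inv_map[OF c] by blast

lemma \<Phi>_dom: "x \<in> cball x0 R \<Longrightarrow> \<Phi> x \<in> chart_dom c"
  using chart_inv_in[OF c] KU by blast

lemma open_\<Phi>_ball:
  assumes "\<rho> \<le> R"
  shows "open (\<Phi> ` ball x0 \<rho>)"
proof -
  have sub: "ball x0 \<rho> \<subseteq> cball x0 R" using assms by auto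
  have "\<Phi> ` ball x0 \<rho> = chart_dom c \<inter> \<xi> -` ball x0 \<rho>"
  proof
    show "\<Phi> ` ball x0 \<rho> \<subseteq> chart_dom c \<inter> \<xi> -` ball x0 \<rho>"
      using \<Phi>_dom \<xi>\<Phi> sub by auto
    show "chart_dom c \<inter> \<xi> -` ball x0 \<rho> \<subseteq> \<Phi> ` ball x0 \<rho>"
    proof
      fix p assume "p \<in> chart_dom c \<inter> \<xi> -` ball x0 \<rho>"
      then show "p \<in> \<Phi> ` ball x0 \<rho>" by (intro image_eqI[of _ _ "\<xi> p"]) (auto simp: \<Phi>\<xi>)
    qed
  qed
  then show ?thesis
    using continuous_open_preimage[OF continuous_chart_map[OF c] open_dom[OF c] open_ball, of x0 \<rho>] by simp
qed

text \<open>Closedness in the whole manifold, not merely in the chart domain: a compact set in a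
  Hausdorff space is closed.\<close>

lemma closed_\<Phi>_cball:
  assumes "\<rho> \<le> R"
  shows "closed (\<Phi> ` cball x0 \<rho>)"
proof (rule compact_imp_closed[OF compact_continuous_image])
  show "continuous_on (cball x0 \<rho>) \<Phi>"
    by (rule continuous_on_subset[OF continuous_chart_inv[OF c]]) (use assms KU in auto)
qed simp

text \<open>\<open>T\<close> is the infimum of the closed set of times spent outside the open ball.
  Before \<open>T\<close> the curve is in the open ball, so at \<open>T\<close> it is in the image
  of the closed ball by closedness, but no longer in the open one.\<close>

lemma first_exit:
  fixes \<gamma> :: "real \<Rightarrow> 'a"
  assumes \<gamma>: "continuous_on {a..b} \<gamma>" and \<rho>: "\<rho> \<le> R"
    and start: "\<gamma> a \<in> \<Phi> ` ball x0 \<rho>" and t: "t \<in> {a..b}" "\<gamma> t \<notin> \<Phi> ` ball x0 \<rho>"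
  obtains T z where "a < T" "T \<le> b" "\<gamma> ` {a..T} \<subseteq> \<Phi> ` cball x0 \<rho>" "\<gamma> T = \<Phi> z" "dist x0 z = \<rho>"
proof -
  define N where "N = {a..b} \<inter> \<gamma> -` (- (\<Phi> ` ball x0 \<rho>))"
  have "closed N" unfolding N_def
    by (rule continuous_closed_preimage[OF \<gamma>]) (use open_\<Phi>_ball[OF \<rho>] in auto)
  moreover have "t \<in> N" using t by (simp add: N_def)
  moreover have bdd: "bdd_below N" unfolding N_def by (rule bdd_belowI[of _ a]) auto
  ultimately have T: "Inf N \<in> N" by (intro closed_contains_Inf) auto
  define T where "T = Inf N"
  have TN: "T \<in> {a..b}" "\<gamma> T \<notin> \<Phi> ` ball x0 \<rho>" using T by (auto simp: N_def T_def)
  have aT: "a < T" using TN start by (cases "T = a") auto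
  have before: "\<gamma> s \<in> \<Phi> ` ball x0 \<rho>" if "a \<le> s" "s < T" for s
  proof (rule ccontr)
    assume "\<gamma> s \<notin> \<Phi> ` ball x0 \<rho>"
    then have "s \<in> N" using that TN by (auto simp: N_def)
    then show False using cInf_lower[OF _ bdd, of s] that by (simp add: T_def)
  qed
  have b_sub: "\<Phi> ` ball x0 \<rho> \<subseteq> \<Phi> ` cball x0 \<rho>" by auto
  have "closed ({a..T} \<inter> \<gamma> -` (\<Phi> ` cball x0 \<rho>))"
    by (rule continuous_closed_preimage[OF continuous_on_subset[OF \<gamma>]])
      (use closed_\<Phi>_cball[OF \<rho>] TN in auto)
  moreover have "{a..<T} \<subseteq> {a..T} \<inter> \<gamma> -` (\<Phi> ` cball x0 \<rho>)"
  proof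
    fix s assume "s \<in> {a..<T}"
    then show "s \<in> {a..T} \<inter> \<gamma> -` (\<Phi> ` cball x0 \<rho>)"
      using subsetD[OF b_sub before[of s]] by simp
  qed
  ultimately have "closure {a..<T} \<subseteq> {a..T} \<inter> \<gamma> -` (\<Phi> ` cball x0 \<rho>)" by (rule closure_minimal[rotated])
  then have img: "\<gamma> ` {a..T} \<subseteq> \<Phi> ` cball x0 \<rho>" using aT by auto
  moreover have "T \<in> {a..T}" using aT by simp
  ultimately obtain z where z: "z \<in> cball x0 \<rho>" "\<gamma> T = \<Phi> z" by blast
  have "z \<notin> ball x0 \<rho>" using TN z by blast
  then have "dist x0 z = \<rho>" using z by simp
  then show thesis using that[OF aT _ img z(2)] TN by simp
qed

text \<open>Collects what turns a curve on the manifold into a \<open>piecewise_curve\<close> in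
  coordinates with the same speed off a finite set.\<close>

lemma piecewise_in_chart:
  assumes \<gamma>: "pw \<gamma> a b" and K': "\<gamma> ` {a..b} \<subseteq> \<Phi> ` cball x0 R"
  obtains S B where "finite S" "a \<in> S" "b \<in> S"
    "\<And>t. t \<in> {a..b} - S \<Longrightarrow>
      ((\<xi> \<circ> \<gamma>) has_vector_derivative vector_derivative (\<xi> \<circ> \<gamma>) (at t)) (at t)"
    "\<And>t. t \<in> {a..b} - S \<Longrightarrow> isCont (\<lambda>t. vector_derivative (\<xi> \<circ> \<gamma>) (at t)) t"
    "\<And>t. t \<in> {a..b} - S \<Longrightarrow> norm (vector_derivative (\<xi> \<circ> \<gamma>) (at t)) \<le> B"
    "\<And>t. t \<in> {a..b} - S \<Longrightarrow> speed \<gamma> t = sqrt (G c (\<xi> (\<gamma> t))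
      (vector_derivative (\<xi> \<circ> \<gamma>) (at t)) (vector_derivative (\<xi> \<circ> \<gamma>) (at t)))"
    "continuous_on {a..b} (\<xi> \<circ> \<gamma>)" "\<And>t. t \<in> {a..b} \<Longrightarrow> (\<xi> \<circ> \<gamma>) t \<in> cball x0 R"
proof -
  have "\<Phi> ` cball x0 R \<subseteq> chart_dom c" using \<Phi>_dom by (rule image_subsetI)
  then have dom: "\<gamma> ` {a..b} \<subseteq> chart_dom c" by (rule order_trans[OF K'])
  obtain S B where S: "finite S" "a \<in> S" "b \<in> S" and D: "\<forall>t\<in>{a..b} - S.
      ((\<xi> \<circ> \<gamma>) has_vector_derivative vector_derivative (\<xi> \<circ> \<gamma>) (at t)) (at t) \<and>
      isCont (\<lambda>t. vector_derivative (\<xi> \<circ> \<gamma>) (at t)) t \<and> norm (vector_derivative (\<xi> \<circ> \<gamma>) (at t)) \<le> B"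
    using pw_chart_derivative[OF c \<gamma> dom] by (elim exE conjE) (rule that)
  have cont: "continuous_on {a..b} \<gamma>" by (rule pw_continuous[OF \<gamma>])
  have sp: "speed \<gamma> t = sqrt (G c (\<xi> (\<gamma> t))
      (vector_derivative (\<xi> \<circ> \<gamma>) (at t)) (vector_derivative (\<xi> \<circ> \<gamma>) (at t)))" if t: "t \<in> {a..b} - S" for t
  proof (rule speed_eq_at[OF _ c])
    have "t \<noteq> a" "t \<noteq> b" using t S by blast+
    then have "t \<in> {a<..<b}" using t by simp
    then show "isCont \<gamma> t" by (intro continuous_on_interior[OF cont]) simp
    show "\<gamma> t \<in> chart_dom c" using t dom by blast
    show "((\<xi> \<circ> \<gamma>) has_vector_derivative vector_derivative (\<xi> \<circ> \<gamma>) (at t)) (at t)"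
      using D t by blast
  qed
  have ccont: "continuous_on {a..b} (\<xi> \<circ> \<gamma>)"
    by (rule continuous_on_compose[OF cont continuous_on_subset[OF continuous_chart_map[OF c] dom]])
  have inK: "(\<xi> \<circ> \<gamma>) t \<in> cball x0 R" if "t \<in> {a..b}" for t
  proof -
    have "\<gamma> t \<in> \<Phi> ` cball x0 R" using K' that by (simp add: image_subset_iff)
    then obtain z where "\<gamma> t = \<Phi> z" "z \<in> cball x0 R" by (rule imageE)
    then show ?thesis by (simp add: \<xi>\<Phi>)
  qed
  show thesis
    by (rule that[OF S D[rule_format, THEN conjunct1] D[rule_format, THEN conjunct2, THEN conjunct1]
          D[rule_format, THEN conjunct2, THEN conjunct2] sp ccont inK])
qed

text \<open>Coercivity bounds the speed below by \<open>sqrt lam\<close> times the Euclidean speed,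
  whose integral is at least the displacement by the fundamental theorem.\<close>

lemma len_ge_chart_displacement:
  assumes \<gamma>: "pw \<gamma> a b" and K': "\<gamma> ` {a..b} \<subseteq> \<Phi> ` cball x0 R"
  shows "sqrt lam * norm (\<xi> (\<gamma> b) - \<xi> (\<gamma> a)) \<le> len \<gamma> a b"
proof -
  let ?D = "\<lambda>t. vector_derivative (\<xi> \<circ> \<gamma>) (at t)"
  obtain S B where S: "finite S" "a \<in> S" "b \<in> S"
    and D: "\<And>t. t \<in> {a..b} - S \<Longrightarrow> ((\<xi> \<circ> \<gamma>) has_vector_derivative ?D t) (at t)"
    "\<And>t. t \<in> {a..b} - S \<Longrightarrow> isCont ?D t" "\<And>t. t \<in> {a..b} - S \<Longrightarrow> norm (?D t) \<le> B"
    and sp: "\<And>t. t \<in> {a..b} - S \<Longrightarrow> speed \<gamma> t = sqrt (G c (\<xi> (\<gamma> t)) (?D t) (?D t))"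
    and cont: "continuous_on {a..b} (\<xi> \<circ> \<gamma>)" and inK: "\<And>t. t \<in> {a..b} \<Longrightarrow> (\<xi> \<circ> \<gamma>) t \<in> cball x0 R"
    using piecewise_in_chart[OF assms] by blast
  have ab: "a < b" by (rule pw_less[OF \<gamma>])
  have int: "(?D has_integral (\<xi> \<circ> \<gamma>) b - (\<xi> \<circ> \<gamma>) a) {a..b}"
    by (rule fundamental_theorem_of_calculus_interior_strong[OF S(1) _ _ cont]) (use ab D(1) in auto)
  have "continuous_on ({a..b} - S) ?D" using D(2) by (intro continuous_at_imp_continuous_on) blast
  then have nint: "(\<lambda>t. norm (?D t)) integrable_on {a..b}"
    by (intro integrable_bounded_off_finite[OF S(1), where B = B] continuous_on_norm) (use D(3) in auto)
  have "sqrt lam * norm ((\<xi> \<circ> \<gamma>) b - (\<xi> \<circ> \<gamma>) a) \<le> sqrt lam * integral {a..b} (\<lambda>t. norm (?D t))"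
    using Henstock_Kurzweil_Integration.integral_norm_bound_integral[OF has_integral_integrable[OF int] nint]
      integral_unique[OF int] R.lam by (intro mult_left_mono) auto
  also have "\<dots> = integral {a..b} (\<lambda>t. sqrt lam * norm (?D t))"
    by simp
  also have "\<dots> \<le> len \<gamma> a b"
    unfolding len_def
  proof (rule integral_le_off_finite[OF S(1) _ pw_speed_integrable[OF \<gamma>]])
    show "(\<lambda>t. sqrt lam * norm (?D t)) integrable_on {a..b}"
      using integrable_on_cmult_left[OF nint, of "sqrt lam"] by simp
    fix t assume t: "t \<in> {a..b} - S"
    have "lam * (norm (?D t))\<^sup>2 \<le> G c (\<xi> (\<gamma> t)) (?D t) (?D t)"
      using R.coercive inK[of t] t by simp
    then have "sqrt (lam * (norm (?D t))\<^sup>2) \<le> speed \<gamma> t" unfolding sp[OF t] by simp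
    then show "sqrt lam * norm (?D t) \<le> speed \<gamma> t" by (simp add: real_sqrt_mult)
  qed
  finally show ?thesis by simp
qed

lemma len_ge_exit:
  assumes \<gamma>: "pw \<gamma> a b" and \<rho>: "\<rho> \<le> R" and x: "x \<in> ball x0 \<rho>" "\<gamma> a = \<Phi> x"
    and t: "t \<in> {a..b}" "\<gamma> t \<notin> \<Phi> ` ball x0 \<rho>"
  shows "sqrt lam * (\<rho> - dist x0 x) \<le> len \<gamma> a b"
proof -
  obtain T z where T: "a < T" "T \<le> b" "\<gamma> ` {a..T} \<subseteq> \<Phi> ` cball x0 \<rho>" "\<gamma> T = \<Phi> z" "dist x0 z = \<rho>"
    using first_exit[OF pw_continuous[OF \<gamma>] \<rho> _ t] x by blast
  have pwT: "pw \<gamma> a T" using T \<gamma> pw_split[OF \<gamma> T(1)] by (cases "T = b") auto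
  have z: "z \<in> cball x0 R" "x \<in> cball x0 R" using T \<rho> x by auto
  have "\<rho> - dist x0 x \<le> norm (z - x)"
    using dist_triangle2[of x0 z x] T(5) by (simp add: dist_norm norm_minus_commute)
  then have "sqrt lam * (\<rho> - dist x0 x) \<le> sqrt lam * norm (z - x)"
    using R.lam by (intro mult_left_mono) auto
  also have "\<dots> \<le> len \<gamma> a T"
  proof -
    have "\<Phi> ` cball x0 \<rho> \<subseteq> \<Phi> ` cball x0 R" using \<rho> by auto
    from len_ge_chart_displacement[OF pwT order_trans[OF T(3) this]]
    show ?thesis unfolding T(4) x(2) \<xi>\<Phi>[OF z(1)] \<xi>\<Phi>[OF z(2)] .
  qed
  also have "\<dots> \<le> len \<gamma> a b"
  proof (cases "T = b")
    case False
    then have "pw \<gamma> T b" using pw_split[OF \<gamma> T(1)] T(2) by simp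
    then show ?thesis using len_combine[OF \<gamma>, of T] len_nonneg[of \<gamma> T b] T by simp
  qed simp
  finally show ?thesis .
qed

text \<open>Leaving a coordinate ball has a positive price. Hence distinct points have positive
  distance, and points close in the distance lie in a common coordinate ball.\<close>

lemma rdist_ge_exit:
  assumes \<rho>: "\<rho> \<le> R" and x: "x \<in> ball x0 \<rho>" and q: "q \<notin> \<Phi> ` ball x0 \<rho>"
  shows "sqrt lam * (\<rho> - dist x0 x) \<le> d (\<Phi> x) q"
proof (rule ccontr)
  assume "\<not> ?thesis"
  then obtain \<gamma> where "pw \<gamma> 0 1" "\<gamma> 0 = \<Phi> x" "\<gamma> 1 = q" "len \<gamma> 0 1 < sqrt lam * (\<rho> - dist x0 x)"
    using rdist_lessE[of "\<Phi> x" q "sqrt lam * (\<rho> - dist x0 x)"] by force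
  then show False using len_ge_exit[of \<gamma> 0 1 \<rho> x 1] \<rho> x q by auto
qed

lemma rdist_le_chart:
  assumes x: "x \<in> cball x0 R" and y: "y \<in> cball x0 R"
  shows "d (\<Phi> x) (\<Phi> y) \<le> sqrt M * norm (x - y)"
proof -
  have seg: "closed_segment x y \<subseteq> cball x0 R" by (rule closed_segment_subset[OF x y]) simp
  let ?f = "\<lambda>t. sqrt (G c (x + t *\<^sub>R (y - x)) (y - x) (y - x))"
  have inK: "x + t *\<^sub>R (y - x) \<in> cball x0 R" if "t \<in> {0..1}" for t
  proof -
    have "x + t *\<^sub>R (y - x) \<in> closed_segment x y"
      unfolding closed_segment_def using that
      by (intro CollectI exI[of _ t]) (simp add: algebra_simps)
    then show ?thesis using seg by blast
  qed
  have "d (\<Phi> x) (\<Phi> y) \<le> integral {0..1} ?f"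
    unfolding rdist_eq
    by (rule cInf_lower[OF lengths_segment[OF c order_trans[OF seg K_sub]] lengths_bdd_below])
  also have "\<dots> \<le> integral {0..1} (\<lambda>t::real. sqrt M * norm (x - y))"
  proof (rule integral_le)
    show "?f integrable_on {0..1}"
      by (intro integrable_continuous_interval continuous_on_real_sqrt R.G_continuous continuous_intros inK)
    fix t :: real assume t: "t \<in> {0..1}"
    have "G c (x + t *\<^sub>R (y - x)) (y - x) (y - x) \<le> M * norm (y - x) * norm (y - x)"
      using R.bound[OF inK[OF t], of "y - x" "y - x"] by linarith
    also have "\<dots> = M * (norm (x - y))\<^sup>2" by (simp add: power2_eq_square norm_minus_commute)
    finally have "?f t \<le> sqrt (M * (norm (x - y))\<^sup>2)" by simp
    then show "?f t \<le> sqrt M * norm (x - y)" by (simp add: real_sqrt_mult)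
  qed (rule integrable_const_ivl)
  finally show ?thesis by simp
qed

text \<open>Two points of the ball of radius \<open>r\<close> have coordinate distance
  \<open>n < 2 * r\<close>, and the geodesic between them has velocity bound
  \<open>h = 2 * n < 4 * r\<close>. The conditions express in turn: the ball of radius
  \<open>2 * n\<close> around one of them stays in the region (\<open>r + 4 * r\<close>),
  \<open>h <= 1\<close>, the contraction condition \<open>48 * spray_const * n <= 1\<close>, the
  comparison condition \<open>6 * M * h <= lam\<close>, and that this geodesic is shorter than any
  curve leaving the region.\<close>

definition small :: "real \<Rightarrow> bool" where
  "small r \<longleftrightarrow> 0 < r \<and> 5 * r \<le> R \<and> 4 * r \<le> 1 \<and> 96 * R.spray_const * r \<le> 1 \<and> 24 * M * r \<le> lam \<and>
     4 * sqrt M * r < sqrt lam * (R - r)"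

lemma small_exists: obtains r where "small r"
proof -
  have lim: "((\<lambda>r. a * r) \<longlongrightarrow> 0) (at_right 0)" for a :: real
    using tendsto_mult_left[OF tendsto_ident_at, of a 0 "{0<..}"] by simp
  have "((\<lambda>r. sqrt lam * (R - r) - 4 * sqrt M * r) \<longlongrightarrow> sqrt lam * (R - 0) - 4 * sqrt M * 0) (at_right 0)"
    by (intro tendsto_intros)
  moreover have "0 < sqrt lam * (R - 0) - 4 * sqrt M * 0" using R R.lam by simp
  ultimately have "eventually (\<lambda>r. 0 < sqrt lam * (R - r) - 4 * sqrt M * r) (at_right 0)"
    by (rule order_tendstoD(1))
  then have "eventually small (at_right 0)"
    using order_tendstoD(2)[OF lim R, of 5] order_tendstoD(2)[OF lim zero_less_one, of 4]
      order_tendstoD(2)[OF lim zero_less_one, of "96 * R.spray_const"]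
      order_tendstoD(2)[OF lim R.lam, of "24 * M"] eventually_at_right_less[of 0]
    by eventually_elim (simp add: small_def)
  then show thesis using eventually_happens[of small "at_right (0::real)"] that by fastforce
qed

section \<open>Short geodesics realise the distance, and they do so uniquely\<close>

lemma len_ge_short_geodesic:
  assumes q: "R.short_geodesic q q' h" and h: "0 \<le> h" "h \<le> 1" "6 * M * h \<le> lam"
    and \<gamma>: "pw \<gamma> 0 1" "\<gamma> 0 = \<Phi> (q 0)" "\<gamma> 1 = \<Phi> (q 1)" and sub: "\<gamma> ` {0..1} \<subseteq> \<Phi> ` cball x0 R"
  shows "sqrt (G c (q 0) (q' 0) (q' 0)) \<le> len \<gamma> 0 1"
proof -
  let ?D = "\<lambda>t. vector_derivative (\<xi> \<circ> \<gamma>) (at t)"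
  have qK: "q 0 \<in> cball x0 R" "q 1 \<in> cball x0 R" using q by (simp_all add: R.short_geodesic_def)
  obtain S B where S: "finite S" and "0 \<in> S" "1 \<in> S"
    and D: "\<And>t. t \<in> {0..1} - S \<Longrightarrow> ((\<xi> \<circ> \<gamma>) has_vector_derivative ?D t) (at t)"
      "\<And>t. t \<in> {0..1} - S \<Longrightarrow> isCont ?D t" "\<And>t. t \<in> {0..1} - S \<Longrightarrow> norm (?D t) \<le> B"
    and sp: "\<And>t. t \<in> {0..1} - S \<Longrightarrow> speed \<gamma> t = sqrt (G c (\<xi> (\<gamma> t)) (?D t) (?D t))"
    and cont: "continuous_on {0..1} (\<xi> \<circ> \<gamma>)" and inK: "\<And>t. t \<in> {0..1} \<Longrightarrow> (\<xi> \<circ> \<gamma>) t \<in> cball x0 R"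
    by (rule piecewise_in_chart[OF \<gamma>(1) sub]) (rule that)
  have "R.piecewise_curve (\<xi> \<circ> \<gamma>) ?D S B"
    unfolding R.piecewise_curve_def
  proof (intro conjI S cont ballI)
    show "(\<xi> \<circ> \<gamma>) ` {0..1} \<subseteq> cball x0 R" by (rule image_subsetI[OF inK])
    show "continuous_on ({0..1} - S) ?D"
      by (rule continuous_at_imp_continuous_on) (intro ballI D(2))
    show "((\<xi> \<circ> \<gamma>) has_vector_derivative ?D t) (at t)" if "t \<in> {0<..<1} - S" for t
      by (rule D(1)) (use that in simp)
    show "norm (?D t) \<le> B" if "t \<in> {0..1} - S" for t by (rule D(3)[OF that])
  qed
  then have "sqrt (G c (q 0) (q' 0) (q' 0)) \<le>
      integral {0..1} (\<lambda>s. sqrt (G c ((\<xi> \<circ> \<gamma>) s) (?D s) (?D s)))"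
    by (rule R.length_comparison[OF q h]) (simp_all add: \<gamma> \<xi>\<Phi>[OF qK(1)] \<xi>\<Phi>[OF qK(2)])
  also have "\<dots> = len \<gamma> 0 1"
    unfolding len_def by (rule integral_spike[of S]) (use S sp in auto)
  finally show ?thesis .
qed

lemma short_geodesic_len:
  assumes q: "R.short_geodesic q q' h" and st: "0 \<le> s" "s \<le> t" "t \<le> 1"
  shows "d (\<Phi> (q s)) (\<Phi> (q t)) \<le> (t - s) * sqrt (G c (q 0) (q' 0) (q' 0))"
proof (cases "s = t")
  case True
  then show ?thesis by (simp add: rdist_self)
next
  case False
  then have st': "s < t" using st by simp
  have in01: "u \<in> {0..1}" if "u \<in> {s..t}" for u using that st by simp
  have qU: "q u \<in> U c" if "u \<in> {s..t}" for u
    using q in01[OF that] by (intro KU) (simp add: R.short_geodesic_def)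
  have der: "(q has_vector_derivative q' u) (at u within {s..t})" if "u \<in> {s..t}" for u
  proof (rule has_vector_derivative_within_subset)
    show "(q has_vector_derivative q' u) (at u within {0..1})"
      using q in01[OF that] by (simp add: R.short_geodesic_def)
  qed (use st in auto)
  have cont: "continuous_on {s..t} q'"
    by (rule continuous_on_subset[OF R.short_geodesic_continuous(2)[OF q]]) (use st in auto)
  note cc = chart_curve[OF c st' qU der cont]
  have "integral {s..t} (\<lambda>u. sqrt (G c (q u) (q' u) (q' u))) =
      integral {s..t} (\<lambda>u. sqrt (G c (q 0) (q' 0) (q' 0)))"
    by (rule integral_cong) (simp add: R.short_geodesic_speed[OF q in01])
  then show ?thesis using rdist_le_len[OF cc(1)] cc(2) st by simp
qed

text \<open>A competitor on the manifold either stays in the coordinate ball, where the length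
  comparison applies, or leaves it, and then the price of leaving exceeds the length of the geodesic
  by the last condition in \<open>small\<close>. So the constant speed of \<open>q\<close> equals
  the distance of its ends.\<close>

lemma local_geodesic:
  assumes r: "small r" and x: "x \<in> ball x0 r" and y: "y \<in> ball x0 r"
  obtains q q' h where "R.short_geodesic q q' h" "q 0 = x" "q 1 = y" "0 \<le> h" "h \<le> 1" "6 * M * h \<le> lam"
    "\<And>s. s \<in> {0..1} \<Longrightarrow> G c (q s) (q' s) (q' s) = (d (\<Phi> x) (\<Phi> y))\<^sup>2"
    "\<And>s t. 0 \<le> s \<Longrightarrow> s \<le> t \<Longrightarrow> t \<le> 1 \<Longrightarrow> d (\<Phi> (q s)) (\<Phi> (q t)) \<le> (t - s) * d (\<Phi> x) (\<Phi> y)"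
proof -
  have r': "0 < r" "5 * r \<le> R" "4 * r \<le> 1" "96 * R.spray_const * r \<le> 1" "24 * M * r \<le> lam"
    "4 * sqrt M * r < sqrt lam * (R - r)"
    using r by (simp_all add: small_def)
  define n where "n = norm (y - x)"
  have nr: "n < 2 * r"
  proof -
    have "dist y x \<le> dist x0 y + dist x0 x" by (rule dist_triangle3)
    then show ?thesis using x y by (simp add: n_def dist_norm)
  qed
  have n0: "0 \<le> n" by (simp add: n_def)
  have "48 * R.spray_const * n \<le> 48 * R.spray_const * (2 * r)"
    using nr R.spray_const_pos by (intro mult_left_mono) auto
  also have "\<dots> = 96 * R.spray_const * r" by simp
  finally have n: "n \<le> 1" "48 * R.spray_const * n \<le> 1" using nr r' by linarith+
  have "cball x (2 * n) \<subseteq> cball x0 R"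
    unfolding cball_subset_cball_iff using x nr r' by (simp add: dist_commute)
  then obtain q q' where q: "R.short_geodesic q q' (2 * n)" and q0: "q 0 = x" and q1: "q 1 = y"
    using R.short_geodesic_exists[of y x] n unfolding n_def by blast
  have h: "0 \<le> 2 * n" "2 * n \<le> 1" using n0 nr r' by auto
  have h6: "6 * M * (2 * n) \<le> lam"
  proof -
    have "12 * M * n \<le> 12 * M * (2 * r)" using nr R.M by (intro mult_left_mono) auto
    then show ?thesis using r' by simp
  qed
  define E where "E = G c (q 0) (q' 0) (q' 0)"
  have K01: "q 0 \<in> cball x0 R" "norm (q' 0) \<le> 2 * n" using q by (simp_all add: R.short_geodesic_def)
  have E0: "0 \<le> E" unfolding E_def by (rule R.G_nonneg[OF K01(1)])
  have up: "d (\<Phi> (q s)) (\<Phi> (q t)) \<le> (t - s) * sqrt E" if "0 \<le> s" "s \<le> t" "t \<le> 1" for s t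
    unfolding E_def by (rule short_geodesic_len[OF q that])
  have "sqrt E \<le> d (\<Phi> x) (\<Phi> y)"
    unfolding rdist_eq
  proof (rule cInf_greatest[OF lengths_nonempty])
    fix l assume "l \<in> lengths (\<Phi> x) (\<Phi> y)"
    then obtain \<gamma> where \<gamma>: "pw \<gamma> 0 1" "\<gamma> 0 = \<Phi> x" "\<gamma> 1 = \<Phi> y" "l = len \<gamma> 0 1"
      unfolding lengths_def by blast
    show "sqrt E \<le> l"
    proof (cases "\<forall>t\<in>{0..1}. \<gamma> t \<in> \<Phi> ` ball x0 R")
      case True
      have "\<Phi> ` ball x0 R \<subseteq> \<Phi> ` cball x0 R" by (rule image_mono[OF ball_subset_cball])
      then have "\<gamma> ` {0..1} \<subseteq> \<Phi> ` cball x0 R" using True by (meson image_subsetI subsetD)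
      then show ?thesis
        unfolding E_def \<gamma>(4) using \<gamma> q0 q1 by (intro len_ge_short_geodesic[OF q h h6]) auto
    next
      case False
      then obtain t where t: "t \<in> {0..1}" "\<gamma> t \<notin> \<Phi> ` ball x0 R" by blast
      have "E \<le> M * norm (q' 0) * norm (q' 0)"
        using R.bound[OF K01(1), of "q' 0" "q' 0"] unfolding E_def by linarith
      also have "\<dots> \<le> M * (4 * r) * (4 * r)"
        using K01(2) nr R.M r' by (intro mult_mono mult_left_mono) auto
      also have "\<dots> = (4 * sqrt M * r)\<^sup>2"
        using R.M by (simp add: power_mult_distrib) (simp add: power2_eq_square)
      finally have "E \<le> (4 * sqrt M * r)\<^sup>2" .
      then have "sqrt E \<le> 4 * sqrt M * r" using r' R.M by (intro real_le_lsqrt E0) auto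
      also have "\<dots> \<le> sqrt lam * (R - dist x0 x)"
      proof -
        have "sqrt lam * (R - r) \<le> sqrt lam * (R - dist x0 x)"
          using x R.lam by (intro mult_left_mono) auto
        then show ?thesis using r' by linarith
      qed
      also have "\<dots> \<le> l"
        unfolding \<gamma>(4) by (rule len_ge_exit[OF \<gamma>(1) order_refl _ \<gamma>(2) t]) (use x r' in auto)
      finally show ?thesis .
    qed
  qed
  moreover have "d (\<Phi> x) (\<Phi> y) \<le> sqrt E" using up[of 0 1] q0 q1 by simp
  ultimately have dE: "sqrt E = d (\<Phi> x) (\<Phi> y)" by simp
  show thesis
  proof (rule that[OF q q0 q1 h h6])
    show "G c (q s) (q' s) (q' s) = (d (\<Phi> x) (\<Phi> y))\<^sup>2" if "s \<in> {0..1}" for s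
      using R.short_geodesic_speed[OF q that] E0 unfolding dE[symmetric] by (simp add: E_def)
    show "d (\<Phi> (q s)) (\<Phi> (q t)) \<le> (t - s) * d (\<Phi> x) (\<Phi> y)" if "0 \<le> s" "s \<le> t" "t \<le> 1" for s t
      using up[OF that] by (simp add: dE)
  qed
qed

text \<open>The two short geodesics through an intermediate point \<open>z\<close>, run with the right speeds, form a
  curve of the same energy as \<open>q\<close>.\<close>

lemma short_geodesic_unique:
  assumes r: "small r" and xyz: "x \<in> ball x0 r" "y \<in> ball x0 r" "z \<in> ball x0 r"
    and q: "R.short_geodesic q q' h" "q 0 = x" "q 1 = y" and h: "0 \<le> h" "h \<le> 1" "6 * M * h \<le> lam"
    and E: "G c (q 0) (q' 0) (q' 0) = (d (\<Phi> x) (\<Phi> y))\<^sup>2"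
    and \<sigma>: "0 < \<sigma>" "\<sigma> < 1" and dxz: "d (\<Phi> x) (\<Phi> z) = \<sigma> * d (\<Phi> x) (\<Phi> y)"
    and dzy: "d (\<Phi> z) (\<Phi> y) = (1 - \<sigma>) * d (\<Phi> x) (\<Phi> y)"
  shows "z = q \<sigma>"
proof -
  let ?D = "d (\<Phi> x) (\<Phi> y)"
  obtain a a' ha where a: "R.short_geodesic a a' ha" "a 0 = x" "a 1 = z"
    and Ea: "\<And>s. s \<in> {0..1} \<Longrightarrow> G c (a s) (a' s) (a' s) = (\<sigma> * ?D)\<^sup>2"
    using local_geodesic[OF r xyz(1,3)] unfolding dxz by metis
  obtain b b' hb where b: "R.short_geodesic b b' hb" "b 0 = z" "b 1 = y"
    and Eb: "\<And>s. s \<in> {0..1} \<Longrightarrow> G c (b s) (b' s) (b' s) = ((1 - \<sigma>) * ?D)\<^sup>2"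
    using local_geodesic[OF r xyz(3,2)] unfolding dzy by metis
  define f where "f s = s / \<sigma>" for s
  define g where "g s = (s - \<sigma>) / (1 - \<sigma>)" for s
  define e where "e s = (if s \<le> \<sigma> then a (f s) else b (g s))" for s
  define e' where "e' s = (if s \<le> \<sigma> then (1 / \<sigma>) *\<^sub>R a' (f s) else (1 / (1 - \<sigma>)) *\<^sub>R b' (g s))" for s
  define S where "S = {0, \<sigma>, 1}"
  have f01: "f s \<in> {0..1}" if "s \<in> {0..\<sigma>}" for s using that \<sigma> by (simp add: f_def)
  have g01: "g s \<in> {0..1}" if "s \<in> {\<sigma>..1}" for s using that \<sigma> by (simp add: g_def)
  have aK: "a s \<in> cball x0 R" "norm (a' s) \<le> ha" if "s \<in> {0..1}" for s
    using a(1) that by (simp_all add: R.short_geodesic_def)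
  have bK: "b s \<in> cball x0 R" "norm (b' s) \<le> hb" if "s \<in> {0..1}" for s
    using b(1) that by (simp_all add: R.short_geodesic_def)
  have fcont: "continuous_on T f" and gcont: "continuous_on T g" for T
    unfolding f_def g_def using \<sigma> by (auto intro!: continuous_intros)
  have e_eq: "e s = b (g s)" if "s \<in> {\<sigma>..1}" for s
    using that a b \<sigma> by (cases "s = \<sigma>") (auto simp: e_def f_def g_def)
  have econt: "continuous_on {0..1} e"
  proof -
    have "continuous_on {0..\<sigma>} (\<lambda>s. a (f s))"
      by (rule continuous_on_compose2[OF R.short_geodesic_continuous(1)[OF a(1)] fcont]) (use f01 in blast)
    then have 1: "continuous_on {0..\<sigma>} e" by (rule continuous_on_eq) (simp add: e_def)
    have "continuous_on {\<sigma>..1} (\<lambda>s. b (g s))"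
      by (rule continuous_on_compose2[OF R.short_geodesic_continuous(1)[OF b(1)] gcont]) (use g01 in blast)
    then have 2: "continuous_on {\<sigma>..1} e" by (rule continuous_on_eq) (simp add: e_eq)
    have "{0..\<sigma>} \<union> {\<sigma>..1} = {0..1}" using \<sigma> by auto
    then show ?thesis using continuous_on_closed_Un[OF _ _ 1 2] by simp
  qed
  have eK: "e s \<in> cball x0 R" if "s \<in> {0..1}" for s
    unfolding e_def using aK(1)[OF f01[of s]] bK(1)[OF g01[of s]] that by simp
  have e'E: "G c (e s) (e' s) (e' s) = ?D\<^sup>2" if s: "s \<in> {0..1}" for s
  proof (cases "s \<le> \<sigma>")
    case True
    then have fs: "f s \<in> {0..1}" using s by (intro f01) simp
    then have "G c (e s) (e' s) (e' s) = (1 / \<sigma>)\<^sup>2 * G c (a (f s)) (a' (f s)) (a' (f s))"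
      using True by (simp add: e_def e'_def bilinear_lmul[OF R.bil[OF aK(1)[OF fs]]]
          bilinear_rmul[OF R.bil[OF aK(1)[OF fs]]] power2_eq_square)
    then show ?thesis using \<sigma> by (simp add: Ea[OF fs] power2_eq_square)
  next
    case False
    then have gs: "g s \<in> {0..1}" using s by (intro g01) simp
    then have "G c (e s) (e' s) (e' s) = (1 / (1 - \<sigma>))\<^sup>2 * G c (b (g s)) (b' (g s)) (b' (g s))"
      using False by (simp add: e_def e'_def bilinear_lmul[OF R.bil[OF bK(1)[OF gs]]]
          bilinear_rmul[OF R.bil[OF bK(1)[OF gs]]] power2_eq_square)
    then show ?thesis using \<sigma> by (simp add: Eb[OF gs] power2_eq_square)
  qed
  have eder: "(e has_vector_derivative e' s) (at s)" if s: "s \<in> {0<..<1} - S" for s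
  proof (cases "s < \<sigma>")
    case True
    have fs: "0 < f s" "f s < 1" using s True \<sigma> by (auto simp: f_def S_def)
    have "(a has_vector_derivative a' (f s)) (at (f s))"
      by (rule has_vector_derivative_within_interior_ivl[OF _ fs])
        (use a(1) fs in \<open>simp add: R.short_geodesic_def\<close>)
    moreover have "(f has_vector_derivative 1 / \<sigma>) (at s)"
      unfolding f_def using \<sigma> by (auto intro!: derivative_eq_intros simp: has_real_derivative_iff_has_vector_derivative[symmetric])
    ultimately have "(a \<circ> f has_vector_derivative (1 / \<sigma>) *\<^sub>R a' (f s)) (at s)"
      by (rule vector_diff_chain_at[rotated])
    then have "(e has_vector_derivative (1 / \<sigma>) *\<^sub>R a' (f s)) (at s)"
      by (rule has_vector_derivative_transform_within_open[of _ _ _ "{..<\<sigma>}"]) (use True in \<open>auto simp: e_def\<close>)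
    then show ?thesis using True by (simp add: e'_def)
  next
    case False
    have gs: "0 < g s" "g s < 1" using s False \<sigma> by (auto simp: g_def S_def)
    have "(b has_vector_derivative b' (g s)) (at (g s))"
      by (rule has_vector_derivative_within_interior_ivl[OF _ gs])
        (use b(1) gs in \<open>simp add: R.short_geodesic_def\<close>)
    moreover have "(g has_vector_derivative 1 / (1 - \<sigma>)) (at s)"
      unfolding g_def using \<sigma> by (auto intro!: derivative_eq_intros simp: has_real_derivative_iff_has_vector_derivative[symmetric])
    ultimately have "(b \<circ> g has_vector_derivative (1 / (1 - \<sigma>)) *\<^sub>R b' (g s)) (at s)"
      by (rule vector_diff_chain_at[rotated])
    then have "(e has_vector_derivative (1 / (1 - \<sigma>)) *\<^sub>R b' (g s)) (at s)"
      by (rule has_vector_derivative_transform_within_open[of _ _ _ "{\<sigma><..}"])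
        (use False s in \<open>auto simp: e_def S_def\<close>)
    then show ?thesis using False s by (simp add: e'_def S_def)
  qed
  have e'cont: "continuous_on ({0..1} - S) e'"
  proof -
    have 1: "continuous_on {0..<\<sigma>} e'"
    proof (rule continuous_on_eq)
      show "continuous_on {0..<\<sigma>} (\<lambda>s. (1 / \<sigma>) *\<^sub>R a' (f s))"
        by (intro continuous_on_scaleR continuous_on_const
            continuous_on_compose2[OF R.short_geodesic_continuous(2)[OF a(1)] fcont])
          (use f01 in force)
    qed (simp add: e'_def)
    have 2: "continuous_on {\<sigma><..1} e'"
    proof (rule continuous_on_eq)
      show "continuous_on {\<sigma><..1} (\<lambda>s. (1 / (1 - \<sigma>)) *\<^sub>R b' (g s))"
        by (intro continuous_on_scaleR continuous_on_const
            continuous_on_compose2[OF R.short_geodesic_continuous(2)[OF b(1)] gcont])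
          (use g01 in force)
    qed (simp add: e'_def)
    show ?thesis
    proof (rule continuous_at_imp_continuous_on, rule ballI)
      fix s assume s: "s \<in> {0..1} - S"
      then consider "s \<in> {0<..<\<sigma>}" | "s \<in> {\<sigma><..<1}" by (fastforce simp: S_def)
      then show "isCont e' s"
      proof cases
        case 1
        then show ?thesis
          using continuous_on_subset[OF \<open>continuous_on {0..<\<sigma>} e'\<close>, of "{0<..<\<sigma>}"]
          by (simp add: continuous_on_eq_continuous_at subset_iff)
      next
        case 2
        then show ?thesis
          using continuous_on_subset[OF \<open>continuous_on {\<sigma><..1} e'\<close>, of "{\<sigma><..<1}"]
          by (simp add: continuous_on_eq_continuous_at subset_iff)
      qed
    qed
  qed
  have e'B: "norm (e' s) \<le> max (ha / \<sigma>) (hb / (1 - \<sigma>))" if s: "s \<in> {0..1} - S" for s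
  proof (cases "s \<le> \<sigma>")
    case True
    then have "norm (a' (f s)) \<le> ha" using s by (intro aK(2) f01) simp
    then show ?thesis using True \<sigma> by (simp add: e'_def le_max_iff_disj divide_right_mono)
  next
    case False
    then have "norm (b' (g s)) \<le> hb" using s by (intro bK(2) g01) simp
    then show ?thesis using False \<sigma> by (simp add: e'_def le_max_iff_disj divide_right_mono)
  qed
  have "R.piecewise_curve e e' S (max (ha / \<sigma>) (hb / (1 - \<sigma>)))"
    unfolding R.piecewise_curve_def
    by (intro conjI ballI econt eder e'cont e'B image_subsetI[OF eK]) (simp_all add: S_def)
  moreover have "e 0 = q 0" "e 1 = q 1" using q a b \<sigma> by (simp_all add: e_def f_def g_def)
  moreover have "\<sigma> \<in> {0..1}" using \<sigma> by simp
  ultimately have "G c (q 0) (q' 0) (q' 0) + lam / 2 * (norm (e \<sigma> - q \<sigma>))\<^sup>2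
      \<le> integral {0..1} (\<lambda>s. G c (e s) (e' s) (e' s))"
    by (rule R.energy_comparison[OF q(1) h])
  also have "\<dots> = integral {0..1::real} (\<lambda>s. ?D\<^sup>2)" by (rule integral_cong[OF e'E])
  \<comment> \<open>The composite curve \<open>e\<close> has constant squared speed
    \<open>?D^2\<close>, which is also the energy of \<open>q\<close>. Nothing is left for the
    excess term, so \<open>e\<close> and \<open>q\<close> agree at time
    \<open>\<sigma>\<close>.\<close>
  finally have "lam / 2 * (norm (e \<sigma> - q \<sigma>))\<^sup>2 \<le> 0" using E by simp
  then have "e \<sigma> = q \<sigma>" using R.lam by (simp add: mult_le_0_iff)
  moreover have "e \<sigma> = z" using a \<sigma> by (simp add: e_def f_def)
  ultimately show ?thesis by simp
qed

end

context riemannian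
begin

lemma chart_region_exists:
  assumes "c \<in> A" "x0 \<in> U c"
  obtains R lam M where "chart_region A \<gg> c x0 R lam M"
  using metric_region_exists[OF assms] assms
  by (metis chart_region.intro chart_region_axioms.intro riemannian_axioms)

text \<open>A point \<open>q\<close> other than \<open>p\<close> lies outside some coordinate ball
  of positive radius around \<open>p\<close>: outside the full ball, or else outside the ball whose
  radius is its own coordinate distance. Reaching it therefore has a positive price.\<close>

lemma rdist_eq_0_imp_eq:
  assumes "d p q = 0"
  shows "p = q"
proof (rule ccontr)
  assume "p \<noteq> q"
  obtain c where c: "c \<in> A" "p \<in> chart_dom c" using chart_exists by blast
  then have "chart_map c p \<in> U c" by blast
  then obtain R lam M where "chart_region A \<gg> c (chart_map c p) R lam M"
    using chart_region_exists[OF c(1)] by blast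
  then interpret C: chart_region A \<gg> c "chart_map c p" R lam M .
  let ?x0 = "chart_map c p"
  have p: "chart_inv c ?x0 = p" by (rule chart_inv_map[OF c])
  have far: False if \<rho>: "0 < \<rho>" "\<rho> \<le> R" and q: "q \<notin> chart_inv c ` ball ?x0 \<rho>" for \<rho>
  proof -
    have "sqrt lam * (\<rho> - dist ?x0 ?x0) \<le> d (chart_inv c ?x0) q"
      by (rule C.rdist_ge_exit[OF \<rho>(2) _ q]) (use \<rho> in simp)
    then have "sqrt lam * \<rho> \<le> 0" unfolding p assms by simp
    then show False using C.R.lam \<rho> by (simp add: mult_le_0_iff)
  qed
  then have "q \<in> chart_inv c ` ball ?x0 R" using C.R by blast
  then obtain y where y: "q = chart_inv c y" "y \<in> ball ?x0 R" by (rule imageE)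
  have "y \<noteq> ?x0" using y p \<open>p \<noteq> q\<close> by metis
  then have "0 < dist ?x0 y" "dist ?x0 y \<le> R" using y by auto
  moreover have "q \<notin> chart_inv c ` ball ?x0 (dist ?x0 y)"
  proof
    assume "q \<in> chart_inv c ` ball ?x0 (dist ?x0 y)"
    then obtain z where z: "q = chart_inv c z" "z \<in> ball ?x0 (dist ?x0 y)" by (rule imageE)
    have "z \<in> cball ?x0 R" "y \<in> cball ?x0 R" using y z by auto
    then have "z = y" using C.\<xi>\<Phi> y(1) z(1) by metis
    then show False using z by simp
  qed
  ultimately show False by (rule far)
qed

lemma Metric_space_rdist: "Metric_space UNIV d"
proof
  show "\<And>p q. 0 \<le> d p q" by (rule rdist_nonneg)
  show "\<And>p q. d p q = d q p" by (rule rdist_sym)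
  show "\<And>p q. d p q = 0 \<longleftrightarrow> p = q" using rdist_self rdist_eq_0_imp_eq by metis
  show "\<And>p q r. d p r \<le> d p q + d q r" by (rule rdist_triangle)
qed


subsection \<open>Minimising curves\<close>

lemma continuous_on_rdist:
  assumes Lip: "\<And>x y. x \<in> S \<Longrightarrow> y \<in> S \<Longrightarrow> d (f x) (f y) \<le> C * norm (x - y)" and C: "0 \<le> C"
  shows "continuous_on S (\<lambda>x. d r (f x))"
proof -
  have "\<bar>d r (f x) - d r (f y)\<bar> \<le> C * dist x y" if xy: "x \<in> S" "y \<in> S" for x y
    using rdist_triangle[of r "f x" "f y"] rdist_triangle[of r "f y" "f x"] rdist_sym[of "f x" "f y"]
      Lip[OF xy] unfolding dist_norm by linarith
  then have "C-lipschitz_on S (\<lambda>x. d r (f x))"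
    using C by (intro lipschitz_onI) (simp_all add: dist_real_def)
  then show ?thesis by (rule lipschitz_on_continuous_on)
qed

text \<open>The point \<open>z\<close> minimises \<open>d r z + d z q\<close> over a small compact sphere around \<open>r\<close> in a chart.\<close>

lemma minimizing_start:
  assumes "r \<noteq> q"
  obtains z \<zeta> where "0 < d r z" "d r z + d z q = d r q" "\<zeta> 0 = r" "\<zeta> (d r z) = z"
    "\<And>s t. 0 \<le> s \<Longrightarrow> s \<le> t \<Longrightarrow> t \<le> d r z \<Longrightarrow> d (\<zeta> s) (\<zeta> t) \<le> t - s"
proof -
  obtain c where c: "c \<in> A" "r \<in> chart_dom c" using chart_exists by blast
  then have "chart_map c r \<in> U c" by blast
  then obtain R lam M where "chart_region A \<gg> c (chart_map c r) R lam M"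
    using chart_region_exists[OF c(1)] by blast
  then interpret C: chart_region A \<gg> c "chart_map c r" R lam M .
  let ?x0 = "chart_map c r" and ?\<Phi> = "chart_inv c"
  have r: "?\<Phi> ?x0 = r" by (rule chart_inv_map[OF c])
  have dpos: "0 < d r q" using rdist_nonneg[of r q] rdist_eq_0_imp_eq[of r q] assms by force
  obtain r0 where r0: "C.small r0" using C.small_exists by blast
  then have r0': "0 < r0" "5 * r0 \<le> R" by (simp_all add: C.small_def)
  \<comment> \<open>The first bound puts the sphere inside a \<open>small\<close> ball, so its
    points are joined to \<open>r\<close> by short geodesics. The second keeps \<open>q\<close> out
    of the open ball of radius \<open>\<rho>\<close>, so every curve from \<open>r\<close> to
    \<open>q\<close> meets the sphere.\<close>
  define \<rho> where "\<rho> = min (r0 / 2) (d r q / sqrt M)"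
  have M: "0 < sqrt M" using C.R.M by simp
  have \<rho>: "0 < \<rho>" "\<rho> < r0" "\<rho> \<le> R"
  proof -
    have "0 < d r q / sqrt M" using dpos M by simp
    then show "0 < \<rho>" using r0' by (simp add: \<rho>_def)
    have "\<rho> \<le> r0 / 2" unfolding \<rho>_def by (rule min.cobounded1)
    then show "\<rho> < r0" "\<rho> \<le> R" using r0' by auto
  qed
  have \<rho>q: "sqrt M * \<rho> \<le> d r q"
  proof -
    have "sqrt M * \<rho> \<le> sqrt M * (d r q / sqrt M)" using M by (intro mult_left_mono) (auto simp: \<rho>_def)
    then show ?thesis using M by simp
  qed
  have x0K: "?x0 \<in> cball ?x0 R" using C.R by simp
  have q_far: "q \<notin> ?\<Phi> ` ball ?x0 \<rho>"
  proof
    assume "q \<in> ?\<Phi> ` ball ?x0 \<rho>"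
    then obtain y where y: "q = ?\<Phi> y" "y \<in> ball ?x0 \<rho>" by (rule imageE)
    have "y \<in> cball ?x0 R" using y \<rho> by simp
    from C.rdist_le_chart[OF x0K this] have "d r q \<le> sqrt M * norm (?x0 - y)" unfolding r y(1) .
    also have "\<dots> < sqrt M * \<rho>" using y M by (simp add: dist_norm)
    finally show False using \<rho>q by simp
  qed
  let ?S = "sphere ?x0 \<rho>"
  have SK: "y \<in> cball ?x0 R" if "y \<in> ?S" for y using that \<rho> by simp
  let ?f = "\<lambda>y. d r (?\<Phi> y) + d q (?\<Phi> y)"
  have cont: "continuous_on ?S ?f"
    by (intro continuous_on_add continuous_on_rdist[where C = "sqrt M"] C.rdist_le_chart)
      (use SK M in auto)
  \<comment> \<open>The witness is the first point where a nearly shortest curve meets the sphere.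
    Splitting the curve there bounds the sum of the two distances by its length.\<close>
  have approx: "\<exists>y\<in>?S. ?f y \<le> d r q + e" if "0 < e" for e
  proof -
    have "d r q < d r q + e" using that by simp
    then obtain \<gamma> where \<gamma>: "pw \<gamma> 0 1" "\<gamma> 0 = r" "\<gamma> 1 = q" "len \<gamma> 0 1 < d r q + e"
      by (rule rdist_lessE)
    have start: "\<gamma> 0 \<in> ?\<Phi> ` ball ?x0 \<rho>"
      unfolding \<gamma>(2) by (rule image_eqI[of _ _ ?x0]) (use r \<rho> in simp_all)
    have one: "(1::real) \<in> {0..1}" by simp
    obtain T y where T: "0 < T" "T \<le> 1" "\<gamma> T = ?\<Phi> y" "dist ?x0 y = \<rho>"
      using C.first_exit[OF pw_continuous[OF \<gamma>(1)] \<rho>(3) start one] q_far \<gamma>(3) by metis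
    have "d r (?\<Phi> y) + d (?\<Phi> y) q \<le> len \<gamma> 0 1"
    proof (cases "T = 1")
      case True
      then have "?\<Phi> y = q" using T \<gamma> by simp
      then show ?thesis using rdist_le_len[OF \<gamma>(1)] \<gamma> rdist_self[of q] by simp
    next
      case False
      then have "pw \<gamma> 0 T" "pw \<gamma> T 1" using pw_split[OF \<gamma>(1) T(1)] T(2) by auto
      from rdist_le_len[OF this(1)] rdist_le_len[OF this(2)] len_combine[OF \<gamma>(1), of T]
      show ?thesis using T \<gamma> by simp
    qed
    moreover have "y \<in> ?S" using T by simp
    ultimately show ?thesis using \<gamma>(4) rdist_sym[of q] by (intro bexI[of _ y]) auto
  qed
  have "?S \<noteq> {}" using approx[OF zero_less_one] by blast
  then obtain y where y: "y \<in> ?S" and min: "\<And>y'. y' \<in> ?S \<Longrightarrow> ?f y \<le> ?f y'"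
    using continuous_attains_inf[OF compact_sphere _ cont] by blast
  define z where "z = ?\<Phi> y"
  have "?f y \<le> d r q"
  proof (rule field_le_epsilon)
    fix e :: real assume "0 < e"
    then obtain y' where "y' \<in> ?S" "?f y' \<le> d r q + e" using approx by blast
    then show "?f y \<le> d r q + e" using min by (meson order_trans)
  qed
  then have sum: "d r z + d z q = d r q"
    using rdist_triangle[of r q z] rdist_sym[of q z] by (simp add: z_def)
  have "r \<noteq> z"
  proof
    assume "r = z"
    then have "?x0 = y" using C.\<xi>\<Phi>[OF SK[OF y]] by (simp add: z_def)
    then show False using y \<rho> by simp
  qed
  then have pos: "0 < d r z" using rdist_nonneg[of r z] rdist_eq_0_imp_eq[of r z] by force
  have balls: "?x0 \<in> ball ?x0 r0" "y \<in> ball ?x0 r0" using r0' y \<rho> by auto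
  obtain k k' h where k: "C.R.short_geodesic k k' h" "k 0 = ?x0" "k 1 = y"
    and kd: "\<And>s t. 0 \<le> s \<Longrightarrow> s \<le> t \<Longrightarrow> t \<le> 1 \<Longrightarrow>
      d (?\<Phi> (k s)) (?\<Phi> (k t)) \<le> (t - s) * d (?\<Phi> ?x0) (?\<Phi> y)"
    by (rule C.local_geodesic[OF r0 balls]) (rule that)
  \<comment> \<open>The short geodesic \<open>k\<close> is Lipschitz with constant
    \<open>d r z\<close> on \<open>[0,1]\<close>; dividing the time by this number gives Lipschitz
    constant 1.\<close>
  define \<zeta> where "\<zeta> s = ?\<Phi> (k (s / d r z))" for s
  show thesis
  proof (rule that[OF pos sum, of \<zeta>])
    show "\<zeta> 0 = r" "\<zeta> (d r z) = z" using k r pos by (simp_all add: \<zeta>_def z_def)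
    fix s t assume st: "0 \<le> s" "s \<le> t" "t \<le> d r z"
    have "d (\<zeta> s) (\<zeta> t) \<le> (t / d r z - s / d r z) * d (?\<Phi> ?x0) (?\<Phi> y)"
      unfolding \<zeta>_def by (rule kd) (use st pos in \<open>auto simp: divide_right_mono\<close>)
    also have "\<dots> = t - s" using pos by (simp add: r z_def[symmetric] left_diff_distrib)
    finally show "d (\<zeta> s) (\<zeta> t) \<le> t - s" .
  qed
qed

section \<open>Distance-realising curves as maximal partial rays\<close>

lemma rdist_limit:
  assumes complete: "Metric_space.mcomplete UNIV d"
    and Cauchy: "\<And>e. 0 < e \<Longrightarrow> \<exists>N. \<forall>n\<ge>N. \<forall>m\<ge>N. d (\<sigma> n) (\<sigma> m) < e"
  obtains x where "(\<lambda>n. d (\<sigma> n) x) \<longlonglongrightarrow> 0"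
proof -
  interpret MS: Metric_space UNIV d by (rule Metric_space_rdist)
  have "MS.MCauchy \<sigma>" unfolding MS.MCauchy_def using Cauchy by (meson subset_UNIV)
  then obtain x where "limitin MS.mtopology \<sigma> x sequentially"
    using complete unfolding MS.mcomplete_def by blast
  then show thesis using that unfolding MS.limitin_metric_dist_null by blast
qed

text \<open>A minimising curve from \<open>p\<close> to \<open>q\<close> is a maximal element among the graphs of partial
  1-Lipschitz curves starting in \<open>p\<close> along which the distance to \<open>q\<close> decreases at unit speed.\<close>

definition ray_graphs :: "'a \<Rightarrow> 'a \<Rightarrow> (real \<times> 'a) set set" where
  "ray_graphs p q = {H. (0, p) \<in> H \<and>
     (\<forall>s x. (s, x) \<in> H \<longrightarrow> 0 \<le> s \<and> s \<le> d p q \<and> d x q \<le> d p q - s \<and>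
        (\<forall>t. 0 \<le> t \<and> t \<le> s \<longrightarrow> (\<exists>y. (t, y) \<in> H)) \<and>
        (\<forall>t y. (t, y) \<in> H \<longrightarrow> d x y \<le> \<bar>s - t\<bar>))}"

lemma ray_graphsD:
  assumes "H \<in> ray_graphs p q"
  shows "(0, p) \<in> H"
    and "(s, x) \<in> H \<Longrightarrow> 0 \<le> s" "(s, x) \<in> H \<Longrightarrow> s \<le> d p q" "(s, x) \<in> H \<Longrightarrow> d x q \<le> d p q - s"
    and "(s, x) \<in> H \<Longrightarrow> 0 \<le> t \<Longrightarrow> t \<le> s \<Longrightarrow> \<exists>y. (t, y) \<in> H"
    and "(s, x) \<in> H \<Longrightarrow> (t, y) \<in> H \<Longrightarrow> d x y \<le> \<bar>s - t\<bar>"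
  using assms unfolding ray_graphs_def by blast+

lemma ray_graphsI:
  assumes "(0, p) \<in> H"
    and "\<And>s x. (s, x) \<in> H \<Longrightarrow> 0 \<le> s \<and> s \<le> d p q \<and> d x q \<le> d p q - s"
    and "\<And>s x t. (s, x) \<in> H \<Longrightarrow> 0 \<le> t \<Longrightarrow> t \<le> s \<Longrightarrow> \<exists>y. (t, y) \<in> H"
    and "\<And>s x t y. (s, x) \<in> H \<Longrightarrow> (t, y) \<in> H \<Longrightarrow> d x y \<le> \<bar>s - t\<bar>"
  shows "H \<in> ray_graphs p q"
  using assms unfolding ray_graphs_def by blast

lemma ray_graphs_maximal:
  obtains H where "H \<in> ray_graphs p q" "\<And>H'. H' \<in> ray_graphs p q \<Longrightarrow> H \<subseteq> H' \<Longrightarrow> H' = H"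
proof -
  have "{(0, p)} \<in> ray_graphs p q"
    by (rule ray_graphsI) (auto simp: rdist_self rdist_nonneg)
  moreover have "\<Union>\<C> \<in> ray_graphs p q" if \<C>: "\<C> \<noteq> {}" "subset.chain (ray_graphs p q) \<C>" for \<C>
  proof -
    have sub: "\<And>H. H \<in> \<C> \<Longrightarrow> H \<in> ray_graphs p q"
      and chain: "\<And>H H'. H \<in> \<C> \<Longrightarrow> H' \<in> \<C> \<Longrightarrow> H \<subseteq> H' \<or> H' \<subseteq> H"
      using \<C>(2) by (auto simp: subset_chain_def)
    show ?thesis
    proof (rule ray_graphsI)
      show "(0, p) \<in> \<Union>\<C>" using \<C>(1) ray_graphsD(1)[OF sub] by blast
      fix s x assume "(s, x) \<in> \<Union>\<C>"
      then obtain H where H: "H \<in> \<C>" "(s, x) \<in> H" by blast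
      show "0 \<le> s \<and> s \<le> d p q \<and> d x q \<le> d p q - s"
        using ray_graphsD(2-4)[OF sub[OF H(1)] H(2)] by blast
      show "\<exists>y. (t, y) \<in> \<Union>\<C>" if "0 \<le> t" "t \<le> s" for t
        using ray_graphsD(5)[OF sub[OF H(1)] H(2) that] H(1) by blast
      fix t y assume "(t, y) \<in> \<Union>\<C>"
      then obtain H' where H': "H' \<in> \<C>" "(t, y) \<in> H'" by blast
      obtain K where "K \<in> \<C>" "(s, x) \<in> K" "(t, y) \<in> K" using chain[OF H(1) H'(1)] H H' by blast
      then show "d x y \<le> \<bar>s - t\<bar>" using ray_graphsD(6)[OF sub] by blast
    qed
  qed
  ultimately have "\<exists>H\<in>ray_graphs p q. \<forall>H'\<in>ray_graphs p q. H \<subseteq> H' \<longrightarrow> H' = H"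
    by (intro subset_Zorn_nonempty) blast+
  then show thesis using that by blast
qed

text \<open>Completeness enters here. Points of the graph at times tending to the supremum form a
  Cauchy sequence because the graph is 1-Lipschitz. The conditions on a ray are closed, so they hold
  for the limit point.\<close>

lemma ray_graphs_closed:
  assumes complete: "Metric_space.mcomplete UNIV d" and H: "H \<in> ray_graphs p q"
  obtains x where "insert (Sup (fst ` H), x) H \<in> ray_graphs p q"
proof -
  define T where "T = Sup (fst ` H)"
  have bdd: "bdd_above (fst ` H)"
    by (rule bdd_aboveI[of _ "d p q"]) (use ray_graphsD(3)[OF H] in auto)
  have le_T: "t \<le> T" if "(t, y) \<in> H" for t y
    unfolding T_def by (rule cSup_upper[OF _ bdd]) (use that in force)
  have T: "0 \<le> T" by (rule le_T[OF ray_graphsD(1)[OF H]])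
  have "T \<le> d p q"
    unfolding T_def by (rule cSup_least) (use ray_graphsD(1,3)[OF H] in auto)
  have "\<exists>t x. (t, x) \<in> H \<and> T - e < t" if "0 < e" for e
  proof -
    have "T - e < Sup (fst ` H)" using that by (simp add: T_def)
    then obtain t where "t \<in> fst ` H" "T - e < t" using less_cSupD[of "fst ` H"] ray_graphsD(1)[OF H] by blast
    then show ?thesis by force
  qed
  then have "\<forall>n. \<exists>t x. (t, x) \<in> H \<and> T - 1 / real (Suc n) < t" by simp
  then obtain \<tau> \<sigma> where \<tau>: "\<And>n. (\<tau> n, \<sigma> n) \<in> H" "\<And>n. T - 1 / real (Suc n) < \<tau> n" by metis
  have close: "\<bar>\<tau> n - T\<bar> \<le> 1 / real (Suc n)" for n using \<tau>(2)[of n] le_T[OF \<tau>(1), of n] by linarith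
  have "(\<lambda>n. \<tau> n - T) \<longlonglongrightarrow> 0"
    by (rule Lim_null_comparison[OF _ LIMSEQ_Suc[OF lim_1_over_n]]) (use close in simp)
  then have \<tau>_lim: "\<tau> \<longlonglongrightarrow> T" by (simp add: LIM_zero_iff)
  have "\<exists>N. \<forall>n\<ge>N. \<forall>m\<ge>N. d (\<sigma> n) (\<sigma> m) < e" if "0 < e" for e
  proof -
    have "Cauchy \<tau>" using \<tau>_lim LIMSEQ_imp_Cauchy by blast
    then obtain N where N: "\<And>m n. N \<le> m \<Longrightarrow> N \<le> n \<Longrightarrow> dist (\<tau> m) (\<tau> n) < e"
      using \<open>0 < e\<close> unfolding Cauchy_def by metis
    have "d (\<sigma> n) (\<sigma> m) < e" if "N \<le> n" "N \<le> m" for n m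
      using ray_graphsD(6)[OF H \<tau>(1)[of n] \<tau>(1)[of m]] N[OF that] by (simp add: dist_real_def)
    then show ?thesis by blast
  qed
  then obtain x where x: "(\<lambda>n. d (\<sigma> n) x) \<longlonglongrightarrow> 0" using rdist_limit[OF complete] by blast
  have x_y: "d x y \<le> T - t" if ty: "(t, y) \<in> H" for t y
  proof -
    have "(\<lambda>n. d (\<sigma> n) x + \<bar>\<tau> n - t\<bar>) \<longlonglongrightarrow> 0 + \<bar>T - t\<bar>" by (intro tendsto_intros x \<tau>_lim)
    moreover have "\<forall>n. d x y \<le> d (\<sigma> n) x + \<bar>\<tau> n - t\<bar>"
    proof
      fix n
      show "d x y \<le> d (\<sigma> n) x + \<bar>\<tau> n - t\<bar>"
        using rdist_triangle[of x y "\<sigma> n"] rdist_sym[of x "\<sigma> n"] ray_graphsD(6)[OF H \<tau>(1) ty, of n]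
        by linarith
    qed
    ultimately have "d x y \<le> 0 + \<bar>T - t\<bar>" by (intro LIMSEQ_le_const) auto
    then show ?thesis using le_T[OF ty] by simp
  qed
  have x_q: "d x q \<le> d p q - T"
  proof -
    have "(\<lambda>n. d (\<sigma> n) x + (d p q - \<tau> n)) \<longlonglongrightarrow> 0 + (d p q - T)" by (intro tendsto_intros x \<tau>_lim)
    moreover have "\<forall>n. d x q \<le> d (\<sigma> n) x + (d p q - \<tau> n)"
    proof
      fix n
      show "d x q \<le> d (\<sigma> n) x + (d p q - \<tau> n)"
        using rdist_triangle[of x q "\<sigma> n"] rdist_sym[of x "\<sigma> n"] ray_graphsD(4)[OF H \<tau>(1), of n]
        by linarith
    qed
    ultimately have "d x q \<le> 0 + (d p q - T)" by (intro LIMSEQ_le_const) auto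
    then show ?thesis by simp
  qed
  have "insert (T, x) H \<in> ray_graphs p q"
  proof (rule ray_graphsI)
    show "(0, p) \<in> insert (T, x) H" using ray_graphsD(1)[OF H] by simp
    fix s y assume sy: "(s, y) \<in> insert (T, x) H"
    show "0 \<le> s \<and> s \<le> d p q \<and> d y q \<le> d p q - s"
      using sy T \<open>T \<le> d p q\<close> x_q ray_graphsD(2-4)[OF H, of s y] by auto
    show "\<exists>y. (t, y) \<in> insert (T, x) H" if t: "0 \<le> t" "t \<le> s" for t
    proof (cases "(s, y) \<in> H")
      case True
      then show ?thesis using ray_graphsD(5)[OF H _ t] by blast
    next
      case False
      then have "s = T" using sy by simp
      show ?thesis
      proof (cases "t = T")
        case False
        then have "\<tau> \<longlonglongrightarrow> T" "t < T" using \<tau>_lim t \<open>s = T\<close> by auto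
        then obtain n where "t < \<tau> n" using order_tendstoD(1) eventually_happens'
          by (metis sequentially_bot)
        then show ?thesis using ray_graphsD(5)[OF H \<tau>(1)[of n] t(1)] by auto
      qed auto
    qed
    fix t w assume tw: "(t, w) \<in> insert (T, x) H"
    show "d y w \<le> \<bar>s - t\<bar>"
      using sy tw x_y le_T ray_graphsD(6)[OF H, of s y t w] rdist_self[of x] rdist_sym[of y x]
      by (fastforce simp: abs_minus_commute)
  qed
  then show thesis using that unfolding T_def by blast
qed

text \<open>The start of a minimising curve from the last point \<open>x\<close> is attached.
  Additivity \<open>d x z + d z q = d x q\<close> makes the distance to \<open>q\<close> continue to
  decrease at unit speed, and distances to older points are controlled by passing through
  \<open>x\<close>.\<close>

lemma ray_graphs_extend:
  assumes H: "H \<in> ray_graphs p q" and T: "(T, x) \<in> H" "\<And>t y. (t, y) \<in> H \<Longrightarrow> t \<le> T" and less: "T < d p q"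
  obtains H' where "H' \<in> ray_graphs p q" "H \<subseteq> H'" "H' \<noteq> H"
proof -
  have "x \<noteq> q"
  proof
    assume "x = q"
    then have "d p q \<le> \<bar>0 - T\<bar>" using ray_graphsD(6)[OF H ray_graphsD(1)[OF H] T(1)] by simp
    then show False using less ray_graphsD(2)[OF H T(1)] by simp
  qed
  then obtain z \<zeta> where z: "0 < d x z" "d x z + d z q = d x q" and \<zeta>: "\<zeta> 0 = x" "\<zeta> (d x z) = z"
    and Lip: "\<And>s t. 0 \<le> s \<Longrightarrow> s \<le> t \<Longrightarrow> t \<le> d x z \<Longrightarrow> d (\<zeta> s) (\<zeta> t) \<le> t - s"
    using minimizing_start by blast
  define \<delta> where "\<delta> = d x z"
  define N where "N = (\<lambda>s. (T + s, \<zeta> s)) ` {0..\<delta>}"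
  have T0: "0 \<le> T" by (rule ray_graphsD(2)[OF H T(1)])
  have xq: "d x q \<le> d p q - T" by (rule ray_graphsD(4)[OF H T(1)])
  have HN: "d (\<zeta> s) y \<le> T + s - t" if "(t, y) \<in> H" "s \<in> {0..\<delta>}" for t y s
    using rdist_triangle[of "\<zeta> s" y x] Lip[of 0 s] that ray_graphsD(6)[OF H T(1) that(1)] T(2)[OF that(1)]
      rdist_sym[of x "\<zeta> s"] \<zeta>(1) by (simp add: \<delta>_def)
  have NN: "d (\<zeta> s) (\<zeta> t) \<le> \<bar>s - t\<bar>" if "s \<in> {0..\<delta>}" "t \<in> {0..\<delta>}" for s t
    using Lip[of s t] Lip[of t s] that rdist_sym[of "\<zeta> s" "\<zeta> t"]
    by (cases "s \<le> t") (simp_all add: \<delta>_def)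
  have "H \<union> N \<in> ray_graphs p q"
  proof (rule ray_graphsI)
    show "(0, p) \<in> H \<union> N" using ray_graphsD(1)[OF H] by simp
    fix s y assume sy: "(s, y) \<in> H \<union> N"
    show "0 \<le> s \<and> s \<le> d p q \<and> d y q \<le> d p q - s"
    proof (cases "(s, y) \<in> H")
      case True
      then show ?thesis using ray_graphsD(2-4)[OF H, of s y] by blast
    next
      case False
      then obtain u where u: "u \<in> {0..\<delta>}" "s = T + u" "y = \<zeta> u" using sy by (auto simp: N_def)
      have "d y q \<le> d (\<zeta> u) z + d z q" unfolding u(3) by (rule rdist_triangle)
      moreover have "d (\<zeta> u) z \<le> \<delta> - u" using Lip[of u \<delta>] u \<zeta>(2) by (simp add: \<delta>_def)
      ultimately show ?thesis using u z xq T0 rdist_nonneg[of z q] by (simp add: \<delta>_def)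
    qed
    show "\<exists>y. (t, y) \<in> H \<union> N" if t: "0 \<le> t" "t \<le> s" for t
    proof (cases "t \<le> T")
      case True
      then show ?thesis using ray_graphsD(5)[OF H T(1) t(1)] by blast
    next
      case False
      then have "(s, y) \<notin> H" using T(2)[of s y] t by auto
      then obtain u where u: "u \<in> {0..\<delta>}" "s = T + u" using sy by (auto simp: N_def)
      then have "(t, \<zeta> (t - T)) \<in> N"
        unfolding N_def using False t by (intro image_eqI[of _ _ "t - T"]) auto
      then show ?thesis by blast
    qed
    fix t w assume tw: "(t, w) \<in> H \<union> N"
    consider "(s, y) \<in> H" "(t, w) \<in> H" | "(s, y) \<in> H" "(t, w) \<in> N" | "(s, y) \<in> N" "(t, w) \<in> H"
      | "(s, y) \<in> N" "(t, w) \<in> N" using sy tw by blast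
    then show "d y w \<le> \<bar>s - t\<bar>"
    proof cases
      case 1
      then show ?thesis by (rule ray_graphsD(6)[OF H])
    next
      case 2
      then obtain u where "u \<in> {0..\<delta>}" "t = T + u" "w = \<zeta> u" by (auto simp: N_def)
      then show ?thesis using HN[OF 2(1)] rdist_sym[of y w] by fastforce
    next
      case 3
      then obtain u where "u \<in> {0..\<delta>}" "s = T + u" "y = \<zeta> u" by (auto simp: N_def)
      then show ?thesis using HN[OF 3(2)] by fastforce
    next
      case 4
      then obtain u v where "u \<in> {0..\<delta>}" "s = T + u" "y = \<zeta> u" "v \<in> {0..\<delta>}" "t = T + v" "w = \<zeta> v"
        by (auto simp: N_def)
      then show ?thesis using NN[of u v] by simp
    qed
  qed
  moreover have "(T + \<delta>, z) \<in> N"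
    unfolding N_def using z \<zeta> by (intro image_eqI[of _ _ \<delta>]) (auto simp: \<delta>_def)
  then have "H \<union> N \<noteq> H" using T(2)[of "T + \<delta>" z] z by (auto simp: \<delta>_def)
  ultimately show thesis using that by blast
qed

text \<open>A maximal graph contains its end by \<open>ray_graphs_closed\<close>, and this end is at
  time \<open>d p q\<close> by \<open>ray_graphs_extend\<close>, so the ray reaches
  \<open>q\<close>. The Lipschitz condition makes the graph single-valued.\<close>

lemma minimizing_curve_exists:
  assumes complete: "Metric_space.mcomplete UNIV d"
  obtains \<gamma> where "\<gamma> 0 = p" "\<gamma> (d p q) = q"
    "\<And>s t. s \<in> {0..d p q} \<Longrightarrow> t \<in> {0..d p q} \<Longrightarrow> d (\<gamma> s) (\<gamma> t) = \<bar>s - t\<bar>"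
proof -
  obtain H where H: "H \<in> ray_graphs p q" and max: "\<And>H'. H' \<in> ray_graphs p q \<Longrightarrow> H \<subseteq> H' \<Longrightarrow> H' = H"
    using ray_graphs_maximal by blast
  define T where "T = Sup (fst ` H)"
  obtain x where "insert (T, x) H \<in> ray_graphs p q"
    unfolding T_def using ray_graphs_closed[OF complete H] by blast
  then have TH: "(T, x) \<in> H" using max by blast
  have bdd: "bdd_above (fst ` H)"
    by (rule bdd_aboveI[of _ "d p q"]) (use ray_graphsD(3)[OF H] in auto)
  have le_T: "t \<le> T" if "(t, y) \<in> H" for t y
    unfolding T_def by (rule cSup_upper[OF _ bdd]) (use that in force)
  have "\<not> T < d p q"
  proof
    assume less: "T < d p q"
    show False by (rule ray_graphs_extend[OF H TH _ less]) (use le_T max in metis)+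
  qed
  then have T: "T = d p q" using ray_graphsD(3)[OF H TH] by simp
  have "d x q \<le> 0" using ray_graphsD(4)[OF H TH] T by simp
  then have "x = q" using rdist_nonneg[of x q] rdist_eq_0_imp_eq[of x q] by simp
  have dom: "\<exists>y. (t, y) \<in> H" if "t \<in> {0..d p q}" for t
    using ray_graphsD(5)[OF H TH, of t] that T by simp
  define \<gamma> where "\<gamma> t = (SOME y. (t, y) \<in> H)" for t
  have \<gamma>H: "(t, \<gamma> t) \<in> H" if "t \<in> {0..d p q}" for t
    unfolding \<gamma>_def using dom[OF that] by (rule someI_ex)
  have unique: "y = \<gamma> t" if "(t, y) \<in> H" for t y
  proof -
    have "t \<in> {0..d p q}" using ray_graphsD(2,3)[OF H that] by simp
    then have "d y (\<gamma> t) \<le> \<bar>t - t\<bar>" by (rule ray_graphsD(6)[OF H that \<gamma>H])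
    then show ?thesis using rdist_nonneg[of y "\<gamma> t"] rdist_eq_0_imp_eq[of y "\<gamma> t"] by simp
  qed
  have ends: "\<gamma> 0 = p" "\<gamma> (d p q) = q"
    using unique[OF ray_graphsD(1)[OF H]] unique[OF TH] T \<open>x = q\<close> by simp_all
  have Lip: "d (\<gamma> s) (\<gamma> t) \<le> \<bar>s - t\<bar>" if "s \<in> {0..d p q}" "t \<in> {0..d p q}" for s t
    by (rule ray_graphsD(6)[OF H \<gamma>H[OF that(1)] \<gamma>H[OF that(2)]])
  \<comment> \<open>The parts before \<open>s\<close> and after \<open>t\<close> cover at most
    \<open>s\<close> and \<open>d p q - t\<close> of the total distance, so the triangle inequality
    leaves at least \<open>t - s\<close> for the middle part.\<close>
  have ge: "t - s \<le> d (\<gamma> s) (\<gamma> t)" if st: "0 \<le> s" "s \<le> t" "t \<le> d p q" for s t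
  proof -
    have "d p q \<le> d p (\<gamma> s) + d (\<gamma> s) (\<gamma> t) + d (\<gamma> t) q"
      using rdist_triangle[of p q "\<gamma> s"] rdist_triangle[of "\<gamma> s" q "\<gamma> t"] by linarith
    moreover have "d p (\<gamma> s) \<le> s" "d (\<gamma> t) q \<le> d p q - t"
      using Lip[of 0 s] Lip[of t "d p q"] ends st by simp_all
    ultimately show ?thesis by linarith
  qed
  have "d (\<gamma> s) (\<gamma> t) = \<bar>s - t\<bar>" if "s \<in> {0..d p q}" "t \<in> {0..d p q}" for s t
    using Lip[OF that] ge[of s t] ge[of t s] that rdist_sym[of "\<gamma> s" "\<gamma> t"]
    by (cases "s \<le> t") auto
  then show thesis using that ends by blast
qed

end


subsection \<open>Minimising curves are geodesics\<close>

text \<open>Moves a geodesic from \<open>[0,1]\<close> to a subinterval of the time of the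
  minimising curve. The acceleration gains the factor \<open>k^2\<close>, as does the spray.\<close>

lemma (in metric_region) short_geodesic_rescale:
  assumes q: "short_geodesic q q' h" and ab: "a < b" and s: "s \<in> {a..b}"
  defines "k \<equiv> 1 / (b - a)"
  defines "X \<equiv> \<lambda>s. q (k * (s - a))" and "X' \<equiv> \<lambda>s. k *\<^sub>R q' (k * (s - a))"
  shows "X s \<in> K" "(X has_vector_derivative X' s) (at s within {a..b})"
    "(X' has_vector_derivative - spray (X s) (X' s)) (at s within {a..b})"
proof -
  let ?f = "\<lambda>s. k * (s - a)"
  have k: "0 < k" using ab by (simp add: k_def)
  have f01: "?f u \<in> {0..1}" if "u \<in> {a..b}" for u
    using that ab by (simp add: k_def)
  have f: "(?f has_vector_derivative k) (at s within {a..b})" by (auto intro!: derivative_eq_intros)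
  have K01: "q (?f s) \<in> K" using q f01[OF s] by (simp add: short_geodesic_def)
  then show "X s \<in> K" by (simp add: X_def)
  have sub: "?f ` {a..b} \<subseteq> {0..1}" by (rule image_subsetI[OF f01])
  have "(q has_vector_derivative q' (?f s)) (at (?f s) within {0..1})"
    and "(q' has_vector_derivative - spray (q (?f s)) (q' (?f s))) (at (?f s) within {0..1})"
    using q f01[OF s] by (simp_all add: short_geodesic_def)
  then have q1: "(q has_vector_derivative q' (?f s)) (at (?f s) within ?f ` {a..b})"
    and q2: "(q' has_vector_derivative - spray (q (?f s)) (q' (?f s))) (at (?f s) within ?f ` {a..b})"
    using has_vector_derivative_within_subset[OF _ sub] by blast+
  show "(X has_vector_derivative X' s) (at s within {a..b})"
    using vector_diff_chain_within[OF f q1] by (simp add: X_def X'_def comp_def)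
  have "(X' has_vector_derivative k *\<^sub>R (k *\<^sub>R (- spray (q (?f s)) (q' (?f s))))) (at s within {a..b})"
    unfolding X'_def
    by (rule bounded_linear.has_vector_derivative[OF bounded_linear_scaleR_right])
      (use vector_diff_chain_within[OF f q2] in \<open>simp add: comp_def\<close>)
  then show "(X' has_vector_derivative - spray (X s) (X' s)) (at s within {a..b})"
    by (simp add: X_def X'_def spray_scaleR[OF K01] power2_eq_square)
qed

context riemannian
begin

text \<open>Two points of the curve just before and after \<open>t0\<close> are joined by a short
  geodesic. Each point of the curve between them divides their distance in the ratio of the times,
  so by uniqueness it lies on that geodesic at the corresponding time. Differentiability of the
  curve is a result of this.\<close>

lemma minimizing_curve_local:
  assumes \<gamma>: "\<And>s t. s \<in> {0..1} \<Longrightarrow> t \<in> {0..1} \<Longrightarrow> d (\<gamma> s) (\<gamma> t) = L * \<bar>s - t\<bar>" and L: "0 < L"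
    and t0: "t0 \<in> {0..1}" and c: "c \<in> A" "\<gamma> t0 \<in> chart_dom c"
  obtains X X' \<eta> where "0 < \<eta>"
    "\<And>s. s \<in> {0..1} \<Longrightarrow> dist s t0 < \<eta> \<Longrightarrow> \<gamma> s = chart_inv c (X s) \<and> X s \<in> U c \<and>
      (X has_vector_derivative X' s) (at s within {0..1}) \<and>
      (X' has_vector_derivative - christoffel A \<gg> c (X s) (X' s) (X' s)) (at s within {0..1})"
proof -
  have "chart_map c (\<gamma> t0) \<in> U c" using c(2) by (rule imageI)
  then obtain R lam M where "chart_region A \<gg> c (chart_map c (\<gamma> t0)) R lam M"
    using chart_region_exists[OF c(1)] by blast
  then interpret C: chart_region A \<gg> c "chart_map c (\<gamma> t0)" R lam M .
  let ?x0 = "chart_map c (\<gamma> t0)" and ?\<Phi> = "chart_inv c"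
  have \<Phi>x0: "?\<Phi> ?x0 = \<gamma> t0" by (rule chart_inv_map[OF c])
  obtain r where r: "C.small r" using C.small_exists by blast
  then have r': "0 < r" "r \<le> R" by (simp_all add: C.small_def)
  \<comment> \<open>Within time \<open>\<eta>\<close> of \<open>t0\<close> the curve moves by less
    than \<open>sqrt lam * r\<close>, the price of leaving the coordinate ball of radius
    \<open>r\<close>.\<close>
  define \<eta> where "\<eta> = sqrt lam * r / L"
  have \<eta>: "0 < \<eta>" using r' L C.R.lam by (simp add: \<eta>_def)
  have near: "\<gamma> s \<in> ?\<Phi> ` ball ?x0 r" if s: "s \<in> {0..1}" "dist s t0 < \<eta>" for s
  proof (rule ccontr)
    assume "\<gamma> s \<notin> ?\<Phi> ` ball ?x0 r"
    then have "sqrt lam * (r - dist ?x0 ?x0) \<le> d (?\<Phi> ?x0) (\<gamma> s)"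
      by (rule C.rdist_ge_exit[OF r'(2), rotated]) (use r' in simp)
    also have "\<dots> = L * dist s t0" unfolding \<Phi>x0 using \<gamma>[OF t0 s(1)] by (simp add: dist_real_def abs_minus_commute)
    also have "\<dots> < L * \<eta>" using s L by simp
    also have "\<dots> = sqrt lam * r" using L by (simp add: \<eta>_def)
    finally show False by simp
  qed
  define a where "a = max 0 (t0 - \<eta> / 2)"
  define b where "b = min 1 (t0 + \<eta> / 2)"
  have ab: "a < b" using t0 \<eta> by (auto simp: a_def b_def)
  have ab01: "s \<in> {0..1} \<and> dist s t0 < \<eta>" if "s \<in> {a..b}" for s
    using that \<eta> by (auto simp: a_def b_def dist_real_def)
  have "\<gamma> a \<in> ?\<Phi> ` ball ?x0 r" "\<gamma> b \<in> ?\<Phi> ` ball ?x0 r"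
    using near ab01[of a] ab01[of b] ab by auto
  then obtain x y where x: "\<gamma> a = ?\<Phi> x" "x \<in> ball ?x0 r" and y: "\<gamma> b = ?\<Phi> y" "y \<in> ball ?x0 r" by blast
  obtain q q' h where q: "C.R.short_geodesic q q' h" "q 0 = x" "q 1 = y"
    and h: "0 \<le> h" "h \<le> 1" "6 * M * h \<le> lam"
    and E: "\<And>s. s \<in> {0..1} \<Longrightarrow> G c (q s) (q' s) (q' s) = (d (?\<Phi> x) (?\<Phi> y))\<^sup>2"
    by (rule C.local_geodesic[OF r x(2) y(2)]) (rule that)
  define k where "k = 1 / (b - a)"
  have \<gamma>q: "\<gamma> s = ?\<Phi> (q (k * (s - a)))" if s: "s \<in> {a..b}" for s
  proof -
    consider "s = a" | "s = b" | "a < s" "s < b" using s by fastforce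
    then show ?thesis
    proof cases
      case 1
      then show ?thesis using q x by simp
    next
      case 2
      then show ?thesis using q y ab by (simp add: k_def)
    next
      case 3
      obtain z where z: "\<gamma> s = ?\<Phi> z" "z \<in> ball ?x0 r" using near ab01[OF s] by blast
      define \<sigma> where "\<sigma> = k * (s - a)"
      have \<sigma>: "0 < \<sigma>" "\<sigma> < 1" using 3 by (auto simp: \<sigma>_def k_def)
      have \<sigma>1: "\<sigma> * (b - a) = s - a" using ab by (simp add: \<sigma>_def k_def)
      have in01: "a \<in> {0..1}" "b \<in> {0..1}" "s \<in> {0..1}" using ab01[of a] ab01[of b] ab01[OF s] ab by auto
      have D: "d (?\<Phi> x) (?\<Phi> y) = L * (b - a)"
        unfolding x(1)[symmetric] y(1)[symmetric] using \<gamma>[OF in01(1,2)] ab by simp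
      have "d (?\<Phi> x) (?\<Phi> z) = L * (s - a)"
        unfolding x(1)[symmetric] z(1)[symmetric] using \<gamma>[OF in01(1,3)] 3 by simp
      then have "d (?\<Phi> x) (?\<Phi> z) = \<sigma> * d (?\<Phi> x) (?\<Phi> y)"
        unfolding D using \<sigma>1 by (metis mult.left_commute)
      moreover have "d (?\<Phi> z) (?\<Phi> y) = L * (b - s)"
        unfolding z(1)[symmetric] y(1)[symmetric] using \<gamma>[OF in01(3,2)] 3 by simp
      then have "d (?\<Phi> z) (?\<Phi> y) = (1 - \<sigma>) * d (?\<Phi> x) (?\<Phi> y)"
      proof -
        have "(1 - \<sigma>) * (b - a) = b - s" using \<sigma>1 by (simp add: left_diff_distrib)
        then show ?thesis unfolding D \<open>d (?\<Phi> z) (?\<Phi> y) = L * (b - s)\<close> by (metis mult.left_commute)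
      qed
      ultimately have "z = q \<sigma>"
        by (rule C.short_geodesic_unique[OF r x(2) y(2) z(2) q h E[of 0, simplified] \<sigma>])
      then show ?thesis using z by (simp add: \<sigma>_def)
    qed
  qed
  define X where "X s = q (k * (s - a))" for s
  define X' where "X' s = k *\<^sub>R q' (k * (s - a))" for s
  note resc = C.R.short_geodesic_rescale[OF q(1) ab, folded k_def, folded X_def X'_def]
  show thesis
  proof (rule that)
    show "0 < \<eta> / 2" using \<eta> by simp
    fix s assume s: "s \<in> {0..1}" "dist s t0 < \<eta> / 2"
    have sub: "u \<in> {a..b}" if u: "u \<in> {0..1}" "dist u t0 < \<eta> / 2" for u
    proof -
      have "u - t0 < \<eta> / 2" "t0 - u < \<eta> / 2" using u(2) unfolding dist_real_def by linarith+
      then show ?thesis using u(1) by (auto simp: a_def b_def)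
    qed
    note s_ab = sub[OF s]
    \<comment> \<open>Near \<open>t0\<close> the intervals \<open>[a,b]\<close> and
      \<open>[0,1]\<close> coincide, also when \<open>t0\<close> is an end of \<open>[0,1]\<close>,
      so one-sided derivatives agree. Restricting to \<open>\<eta> / 2\<close> ensures this.\<close>
    have at: "at s within {a..b} = at s within {0..1}"
    proof (rule at_within_nhd[of _ "ball t0 (\<eta> / 2)"])
      have "u \<in> {a..b} \<longleftrightarrow> u \<in> {0..1}" if "u \<in> ball t0 (\<eta> / 2)" for u
        using sub[of u] ab01[of u] that by (metis dist_commute mem_ball)
      then show "{a..b} \<inter> ball t0 (\<eta> / 2) - {s} = {0..1} \<inter> ball t0 (\<eta> / 2) - {s}" by blast
    qed (use s in \<open>auto simp: dist_commute\<close>)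
    show "\<gamma> s = ?\<Phi> (X s) \<and> X s \<in> U c \<and>
      (X has_vector_derivative X' s) (at s within {0..1}) \<and>
      (X' has_vector_derivative - christoffel A \<gg> c (X s) (X' s) (X' s)) (at s within {0..1})"
    proof (intro conjI)
      show "\<gamma> s = ?\<Phi> (X s)" using \<gamma>q[OF s_ab] by (simp add: X_def)
      show "X s \<in> U c" by (rule C.KU[OF resc(1)[OF s_ab]])
      show "(X has_vector_derivative X' s) (at s within {0..1})"
        using resc(2)[OF s_ab] unfolding at .
      show "(X' has_vector_derivative - christoffel A \<gg> c (X s) (X' s) (X' s)) (at s within {0..1})"
        using resc(3)[OF s_ab] unfolding at spray_eq_christoffel[OF C.region] .
    qed
  qed
qed

lemma minimizing_curve_geodesic:
  assumes \<gamma>: "\<And>s t. s \<in> {0..1} \<Longrightarrow> t \<in> {0..1} \<Longrightarrow> d (\<gamma> s) (\<gamma> t) = L * \<bar>s - t\<bar>" and L: "0 < L"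
  shows "geodesic_on A \<gg> {0..1} \<gamma>"
  unfolding geodesic_on_def
proof (intro conjI ballI)
  show "is_interval {0..1::real}" by (rule is_interval_cc)
  show "continuous_on {0..1} \<gamma>"
    unfolding continuous_on_eq_continuous_within
  proof
    fix t :: real assume t: "t \<in> {0..1}"
    obtain c where c: "c \<in> A" "\<gamma> t \<in> chart_dom c" using chart_exists by blast
    obtain X X' \<eta> where \<eta>: "0 < \<eta>"
      and loc: "\<And>s. s \<in> {0..1} \<Longrightarrow> dist s t < \<eta> \<Longrightarrow> \<gamma> s = chart_inv c (X s) \<and> X s \<in> U c \<and>
      (X has_vector_derivative X' s) (at s within {0..1}) \<and>
      (X' has_vector_derivative - christoffel A \<gg> c (X s) (X' s) (X' s)) (at s within {0..1})"
      by (rule minimizing_curve_local[OF \<gamma> L t c]) (assumption | rule that)+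
    have Xt: "X t \<in> U c" "(X has_vector_derivative X' t) (at t within {0..1})"
      using loc[OF t] \<eta> by auto
    have "isCont (chart_inv c) (X t)"
      using continuous_chart_inv[OF c(1)] Xt(1) continuous_on_eq_continuous_at[OF open_U[OF c(1)]] by blast
    then have "continuous (at t within {0..1}) (\<lambda>s. chart_inv c (X s))"
      by (rule continuous_within_compose3[OF _ has_vector_derivative_continuous[OF Xt(2)]])
    then show "continuous (at t within {0..1}) \<gamma>"
      by (rule continuous_transform_within[OF _ \<eta> t]) (use loc in simp)
  qed
  fix c assume c: "c \<in> A"
  \<comment> \<open>\<open>geodesic_on\<close> asks for one pair of functions per chart, valid at
    all times spent in it, while \<open>X'\<close> is only local. Hence \<open>x'\<close> is fixed
    globally as a derivative and \<open>x''\<close> by the equation, and both are compared with the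
    local data.\<close>
  define x' where "x' t = vector_derivative (chart_map c \<circ> \<gamma>) (at t within {0..1})" for t
  define x'' where "x'' t = - christoffel A \<gg> c (chart_map c (\<gamma> t)) (x' t) (x' t)" for t
  show "\<exists>x' x''. \<forall>t\<in>{0..1}. \<gamma> t \<in> chart_dom c \<longrightarrow>
      ((chart_map c \<circ> \<gamma>) has_vector_derivative x' t) (at t within {0..1}) \<and>
      (x' has_vector_derivative x'' t) (at t within {0..1}) \<and>
      x'' t + christoffel A \<gg> c (chart_map c (\<gamma> t)) (x' t) (x' t) = 0"
  proof (rule exI[of _ x'], rule exI[of _ x''], intro ballI impI)
    fix t :: real assume t: "t \<in> {0..1}" and dom: "\<gamma> t \<in> chart_dom c"
    obtain X X' \<eta> where \<eta>: "0 < \<eta>"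
      and loc: "\<And>s. s \<in> {0..1} \<Longrightarrow> dist s t < \<eta> \<Longrightarrow> \<gamma> s = chart_inv c (X s) \<and> X s \<in> U c \<and>
      (X has_vector_derivative X' s) (at s within {0..1}) \<and>
      (X' has_vector_derivative - christoffel A \<gg> c (X s) (X' s) (X' s)) (at s within {0..1})"
      by (rule minimizing_curve_local[OF \<gamma> L t c dom]) (assumption | rule that)+
    have \<xi>: "(chart_map c \<circ> \<gamma>) s = X s" if "s \<in> {0..1}" "dist s t < \<eta>" for s
      using loc[OF that] chart_map_inv[OF c] by auto
    have der: "((chart_map c \<circ> \<gamma>) has_vector_derivative X' s) (at s within {0..1})"
      if s: "s \<in> {0..1}" "dist s t < \<eta>" for s
    proof (rule has_vector_derivative_transform_within[where d = "\<eta> - dist s t"])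
      show "(X has_vector_derivative X' s) (at s within {0..1})" using loc[OF s] by blast
      show "0 < \<eta> - dist s t" using s by simp
      fix u assume "u \<in> {0..1}" "dist u s < \<eta> - dist s t"
      then show "X u = (chart_map c \<circ> \<gamma>) u"
        using \<xi>[of u] dist_triangle[of u t s] by simp
    qed (rule s)
    have x'X': "x' s = X' s" if s: "s \<in> {0..1}" "dist s t < \<eta>" for s
      unfolding x'_def
      by (rule vector_derivative_within[OF at_within_Icc_nontriv[OF zero_less_one s(1)] der[OF s]])
    have tt: "dist t t < \<eta>" using \<eta> by simp
    have "(X' has_vector_derivative - christoffel A \<gg> c (X t) (X' t) (X' t)) (at t within {0..1})"
      using loc[OF t tt] by blast
    also have "- christoffel A \<gg> c (X t) (X' t) (X' t) = x'' t"
      using \<xi>[OF t tt] x'X'[OF t tt] by (simp add: x''_def)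
    finally have X'': "(X' has_vector_derivative x'' t) (at t within {0..1})" .
    have "(x' has_vector_derivative x'' t) (at t within {0..1})"
      by (rule has_vector_derivative_transform_within[OF X'' \<eta> t]) (simp add: x'X')
    moreover have "((chart_map c \<circ> \<gamma>) has_vector_derivative x' t) (at t within {0..1})"
      using der[OF t tt] x'X'[OF t tt] by simp
    ultimately show "((chart_map c \<circ> \<gamma>) has_vector_derivative x' t) (at t within {0..1}) \<and>
      (x' has_vector_derivative x'' t) (at t within {0..1}) \<and>
      x'' t + christoffel A \<gg> c (chart_map c (\<gamma> t)) (x' t) (x' t) = 0"
      by (simp add: x''_def)
  qed
qed

theorem geodesic_exists:
  assumes complete: "Metric_space.mcomplete UNIV d" and "p \<noteq> q"
  obtains \<gamma> where "geodesic_on A \<gg> {0..1} \<gamma>" "\<gamma> 0 = p" "\<gamma> 1 = q"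
proof -
  define L where "L = d p q"
  have L: "0 < L" using rdist_nonneg[of p q] rdist_eq_0_imp_eq[of p q] assms(2) by (force simp: L_def)
  obtain \<gamma> where \<gamma>: "\<gamma> 0 = p" "\<gamma> L = q"
    and iso: "\<And>s t. s \<in> {0..L} \<Longrightarrow> t \<in> {0..L} \<Longrightarrow> d (\<gamma> s) (\<gamma> t) = \<bar>s - t\<bar>"
    by (rule minimizing_curve_exists[OF complete, of p q, folded L_def]) (rule that)
  have "geodesic_on A \<gg> {0..1} (\<lambda>s. \<gamma> (L * s))"
  proof (rule minimizing_curve_geodesic[OF _ L])
    fix s t :: real assume "s \<in> {0..1}" "t \<in> {0..1}"
    then have "d (\<gamma> (L * s)) (\<gamma> (L * t)) = \<bar>L * s - L * t\<bar>" using L by (intro iso) auto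
    then show "d (\<gamma> (L * s)) (\<gamma> (L * t)) = L * \<bar>s - t\<bar>"
      using L by (simp add: right_diff_distrib[symmetric] abs_mult)
  qed
  then show thesis using that \<gamma> by simp
qed

end


subsection \<open>Sufficiency of the Karush-Kuhn-Tucker conditions\<close>

lemma abs_ctr_diff_le: "\<bar>ctr S - ctr T\<bar> \<le> hausdorff_dist S T"
  unfolding ctr_def hausdorff_dist_def by (simp add: abs_if max_def field_simps)

lemma interval_tendsto_ctr:
  assumes "interval_tendsto F L net"
  shows "((\<lambda>x. ctr (F x)) \<longlongrightarrow> ctr L) net"
  unfolding tendsto_iff dist_real_def
proof (intro allI impI)
  fix e :: real assume "0 < e"
  with assms have "eventually (\<lambda>x. dist (hausdorff_dist (F x) L) 0 < e) net"
    unfolding interval_tendsto_def by (rule tendstoD)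
  then show "eventually (\<lambda>x. \<bar>ctr (F x) - ctr L\<bar> < e) net"
  proof eventually_elim
    case (elim x)
    then show ?case using abs_ctr_diff_le[of "F x" L] by simp
  qed
qed

lemma interval_tendsto_unique:
  assumes "interval_tendsto F L net" "interval_tendsto F L' net" "net \<noteq> bot"
  shows "L = L'"
proof -
  have "hausdorff_dist L L' \<le> hausdorff_dist (F x) L + hausdorff_dist (F x) L'" for x
    unfolding hausdorff_dist_def by linarith
  moreover have "((\<lambda>x. hausdorff_dist (F x) L + hausdorff_dist (F x) L') \<longlongrightarrow> 0 + 0) net"
    using assms(1,2) unfolding interval_tendsto_def by (rule tendsto_add)
  ultimately have "hausdorff_dist L L' \<le> 0 + 0"
    using assms(3) by (intro tendsto_lowerbound) auto
  then have "lower L = lower L'" "upper L = upper L'" unfolding hausdorff_dist_def by linarith+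
  then show ?thesis by (simp add: interval_eq_iff)
qed

lemma ctr_sum: "ctr (\<Sum>i\<in>I. F i) = (\<Sum>i\<in>I. ctr (F i))"
  using sum_comp_morphism[of ctr F I] by (simp add: ctr_zero ctr_add comp_def)

text \<open>\<open>has_dir_deriv\<close> quantifies over all geodesics in the given direction, so
  its value is unique once such a geodesic exists. The last assumption provides one, and the
  definite description then denotes the limit.\<close>

lemma has_dir_deriv_dir_deriv:
  assumes "dir_differentiable A \<gg> E h p0" "Y \<in> tangent_directions A \<gg> E p0"
    "geodesic_in_direction A \<gg> E p0 Y I \<gamma>"
  shows "((\<lambda>s. (h (\<gamma> s) - h p0) / s) \<longlongrightarrow> dir_deriv A \<gg> E h p0 Y) (at_right 0)"
proof -
  obtain L where L: "has_dir_deriv A \<gg> E h p0 Y L"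
    using assms(1,2) by (auto simp: dir_differentiable_def)
  have "dir_deriv A \<gg> E h p0 Y = L"
    unfolding dir_deriv_def
  proof (rule the_equality, rule L)
    fix L' assume "has_dir_deriv A \<gg> E h p0 Y L'"
    then show "L' = L"
      using L assms(3) unfolding has_dir_deriv_def
      by (blast intro: tendsto_unique[OF trivial_limit_at_right_real])
  qed
  then show ?thesis using L assms(3) unfolding has_dir_deriv_def by blast
qed

lemma has_gH_dir_deriv_gH_dir_deriv:
  assumes "gH_dir_differentiable A \<gg> E h p0" "Y \<in> tangent_directions A \<gg> E p0"
    "geodesic_in_direction A \<gg> E p0 Y I \<gamma>"
  shows "interval_tendsto (\<lambda>s. interval_of (1 / s) * (h (\<gamma> s) \<ominus>\<^sub>g\<^sub>H h p0))
    (gH_dir_deriv A \<gg> E h p0 Y) (at_right 0)"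
proof -
  obtain L where L: "has_gH_dir_deriv A \<gg> E h p0 Y L"
    using assms(1,2) by (auto simp: gH_dir_differentiable_def)
  have "gH_dir_deriv A \<gg> E h p0 Y = L"
    unfolding gH_dir_deriv_def
  proof (rule the_equality, rule L)
    fix L' assume "has_gH_dir_deriv A \<gg> E h p0 Y L'"
    then show "L' = L"
      using L assms(3) unfolding has_gH_dir_deriv_def
      by (blast intro: interval_tendsto_unique[OF _ _ trivial_limit_at_right_real])
  qed
  then show ?thesis using L assms(3) unfolding has_gH_dir_deriv_def by blast
qed

lemma convex_quotient_limit_le:
  assumes h: "convex_at A \<gg> E h p0" and p: "p \<in> E"
    and \<gamma>: "geodesic_on A \<gg> {0..1} \<gamma>" "\<gamma> 0 = p0" "\<gamma> 1 = p"
    and lim: "((\<lambda>s. (h (\<gamma> s) - h p0) / s) \<longlongrightarrow> l) (at_right 0)"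
  shows "l \<le> h p - h p0"
proof (rule tendsto_upperbound[OF lim _ trivial_limit_at_right_real])
  show "eventually (\<lambda>s. (h (\<gamma> s) - h p0) / s \<le> h p - h p0) (at_right 0)"
    unfolding eventually_at_right_field
  proof (intro exI[of _ "1::real"] conjI allI impI)
    fix s :: real assume s: "0 < s" "s < 1"
    then have "h (\<gamma> s) \<le> (1 - s) * h p0 + s * h p"
      using h p \<gamma> unfolding convex_at_def by simp
    then have "h (\<gamma> s) - h p0 \<le> (h p - h p0) * s" by (simp add: algebra_simps)
    then show "(h (\<gamma> s) - h p0) / s \<le> h p - h p0" using s by (simp add: pos_divide_le_eq)
  qed simp
qed

text \<open>Star-shapedness covers the interior times and the end points lie in \<open>E\<close>, so
  all of \<open>[0,1]\<close> can serve as the parameter set of an admissible geodesic.\<close>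

lemma (in riemannian) geodesic_direction:
  assumes star: "star_shaped_at A \<gg> E p0" and p: "p \<in> E"
    and \<gamma>: "geodesic_on A \<gg> {0..1} \<gamma>" "\<gamma> 0 = p0" "\<gamma> 1 = p"
  defines "Y \<equiv> velocity A {0..1} \<gamma> 0"
  shows "geodesic_in_direction A \<gg> E p0 Y {0..1} \<gamma>" and "Y \<in> tangent_directions A \<gg> E p0"
proof -
  have "\<gamma> s \<in> E" if "s \<in> {0..1}" for s
  proof -
    have "s = 0 \<or> s = 1 \<or> s \<in> {0<..<1}" using that by auto
    then show ?thesis using star p \<gamma> unfolding star_shaped_at_def by blast
  qed
  then have "\<gamma> ` {0..1} \<subseteq> E" by blast
  moreover have "\<exists>\<epsilon>>0. {0..<\<epsilon>} \<subseteq> {0..1::real}" by (intro exI[of _ 1]) auto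
  ultimately show dir: "geodesic_in_direction A \<gg> E p0 Y {0..1} \<gamma>"
    using \<gamma> by (simp add: geodesic_in_direction_def Y_def)
  obtain c where c: "c \<in> A" "\<gamma> 0 \<in> chart_dom c" using chart_exists by blast
  have zero: "(0::real) \<in> {0..1}" by simp
  obtain x' where x': "((chart_map c \<circ> \<gamma>) has_vector_derivative x') (at 0 within {0..1})"
    using \<gamma>(1) c zero unfolding geodesic_on_def by blast
  have "(\<gamma> \<longlongrightarrow> \<gamma> 0) (at 0 within {0..1})"
    using \<gamma>(1) zero unfolding geodesic_on_def continuous_on_def by blast
  from velocity_in_tangent_space[OF this c zero at_within_Icc_nontriv[OF zero_less_one zero] x']
  have "Y \<in> tangent_space A p0" unfolding Y_def \<gamma>(2) .
  then show "Y \<in> tangent_directions A \<gg> E p0"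
    unfolding tangent_directions_def using dir by blast
qed

text \<open>Stated for a real function \<open>h\<close>, so that the same argument serves the center
  of \<open>f\<close> in the first claim and its half-width in the second.\<close>

lemma (in riemannian) KKT_minimum:
  assumes complete: "Metric_space.mcomplete UNIV d" and star: "star_shaped_at A \<gg> E p0"
    and X: "X = feasible_set E m g"
    and cw: "\<And>i. i \<in> {1..m} \<Longrightarrow> g i p0 = 0 \<Longrightarrow> cw_convex_at A \<gg> E (g i) p0"
    and gH: "\<And>i. i \<in> {1..m} \<Longrightarrow> gH_dir_differentiable A \<gg> E (g i) p0"
    and h: "dir_differentiable A \<gg> E h p0" "convex_at A \<gg> E h p0"
    and \<mu>: "\<forall>i\<in>{1..m}. 0 \<le> \<mu> i"
    and stat: "\<forall>Y\<in>tangent_directions A \<gg> E p0. 0 \<le>\<^sub>m\<^sub>i\<^sub>n interval_of (dir_deriv A \<gg> E h p0 Y)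
        + (\<Sum>i\<in>{1..m}. interval_of (\<mu> i) * gH_dir_deriv A \<gg> E (g i) p0 Y)"
    and slack: "\<forall>i\<in>{1..m}. interval_of (\<mu> i) * g i p0 = 0"
    and p: "p \<in> X"
  shows "h p0 \<le> h p"
proof (cases "p0 = p")
  case False
  have pE: "p \<in> E" and feasible: "\<And>i. i \<in> {1..m} \<Longrightarrow> g i p \<le>\<^sub>m\<^sub>i\<^sub>n 0"
    using p by (auto simp: X feasible_set_def)
  obtain \<gamma> where \<gamma>: "geodesic_on A \<gg> {0..1} \<gamma>" "\<gamma> 0 = p0" "\<gamma> 1 = p"
    using geodesic_exists[OF complete False] by blast
  define Y where "Y = velocity A {0..1} \<gamma> 0"
  have dir: "geodesic_in_direction A \<gg> E p0 Y {0..1} \<gamma>" and Y: "Y \<in> tangent_directions A \<gg> E p0"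
    unfolding Y_def by (rule geodesic_direction[OF star pE \<gamma>])+
  have Dh: "dir_deriv A \<gg> E h p0 Y \<le> h p - h p0"
    by (rule convex_quotient_limit_le[OF h(2) pE \<gamma> has_dir_deriv_dir_deriv[OF h(1) Y dir]])
  have Dg: "\<mu> i * ctr (gH_dir_deriv A \<gg> E (g i) p0 Y) \<le> 0" if i: "i \<in> {1..m}" for i
  proof (cases "g i p0 = 0")
    case True
    have "((\<lambda>s. ctr (interval_of (1 / s) * (g i (\<gamma> s) \<ominus>\<^sub>g\<^sub>H g i p0))) \<longlongrightarrow>
        ctr (gH_dir_deriv A \<gg> E (g i) p0 Y)) (at_right 0)"
      by (rule interval_tendsto_ctr[OF has_gH_dir_deriv_gH_dir_deriv[OF gH[OF i] Y dir]])
    then have "((\<lambda>s. (ctr (g i (\<gamma> s)) - ctr (g i p0)) / s) \<longlongrightarrow>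
        ctr (gH_dir_deriv A \<gg> E (g i) p0 Y)) (at_right 0)"
      by (simp add: ctr_mult gH_diff_def ctr_cw_interval)
    moreover have "convex_at A \<gg> E (\<lambda>p. ctr (g i p)) p0"
      using cw[OF i True] by (simp add: cw_convex_at_def)
    ultimately have "ctr (gH_dir_deriv A \<gg> E (g i) p0 Y) \<le> ctr (g i p) - ctr (g i p0)"
      using convex_quotient_limit_le[OF _ pE \<gamma>] by blast
    also have "\<dots> \<le> 0" using feasible[OF i] True by (auto simp: le_min_def ctr_zero)
    finally show ?thesis using \<mu> i by (simp add: mult_nonneg_nonpos)
  next
    case False
    \<comment> \<open>A nonzero interval has nonzero center or nonzero half-width, so one of the two
      equations forces the multiplier to vanish.\<close>
    have "\<mu> i * ctr (g i p0) = 0" "\<bar>\<mu> i\<bar> * hw (g i p0) = 0"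
      using slack i by (metis ctr_mult ctr_zero, metis hw_mult hw_zero)
    then have "\<mu> i = 0" using False by (auto simp: interval_eq_iff_ctr_hw ctr_zero hw_zero)
    then show ?thesis by simp
  qed
  \<comment> \<open>Either clause of the order yields a nonnegative center, which turns stationarity
    into a real inequality that can be added to \<open>Dh\<close> and \<open>Dg\<close>.\<close>
  have "0 \<le> ctr (interval_of (dir_deriv A \<gg> E h p0 Y)
      + (\<Sum>i\<in>{1..m}. interval_of (\<mu> i) * gH_dir_deriv A \<gg> E (g i) p0 Y))"
    using stat Y by (auto simp: le_min_def ctr_zero)
  also have "\<dots> = dir_deriv A \<gg> E h p0 Y + (\<Sum>i\<in>{1..m}. \<mu> i * ctr (gH_dir_deriv A \<gg> E (g i) p0 Y))"
    by (simp add: ctr_add ctr_sum ctr_mult ctr_interval_of)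
  also have "\<dots> \<le> (h p - h p0) + 0" by (intro add_mono Dh sum_nonpos Dg)
  finally show ?thesis by simp
qed simp

theorem theorem6p4:
  fixes A :: "('a::{t2_space, second_countable_topology}, 'e::euclidean_space) chart set"
    and \<gg> :: "('a, 'e) metric_field"
    and E X :: "'a set"
    and p0 :: 'a
    and f :: "'a \<Rightarrow> real interval"
    and g :: "nat \<Rightarrow> 'a \<Rightarrow> real interval"
    and m :: nat
    and J :: "nat set"
  assumes M: "complete_riemannian_manifold A \<gg>"
    and star: "star_shaped_at A \<gg> E p0"
    and X: "X = feasible_set E m g"
    and p0: "p0 \<in> X"
    and J: "J = {i \<in> {1..m}. g i p0 = 0}"
    and hw_mono: "\<And>I \<gamma> i. geodesic_on A \<gg> I \<gamma> \<Longrightarrow> 0 \<in> I \<Longrightarrow> \<gamma> ` I \<subseteq> E \<Longrightarrow> \<gamma> 0 = p0 \<Longrightarrow>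
      i \<in> {1..m} \<Longrightarrow> mono_on (I \<inter> {0..}) (\<lambda>t. hw (g i (\<gamma> t)))"
    and cw: "\<And>i. i \<in> J \<Longrightarrow> cw_convex_at A \<gg> E (g i) p0"
    and gH: "\<And>i. i \<in> {1..m} \<Longrightarrow> gH_dir_differentiable A \<gg> E (g i) p0"
  shows
    "(dir_differentiable A \<gg> E (\<lambda>p. ctr (f p)) p0 \<and> convex_at A \<gg> E (\<lambda>p. ctr (f p)) p0 \<and>
      nonconstant_on (\<lambda>p. ctr (f p)) X \<and>
      (\<exists>\<mu> :: nat \<Rightarrow> real. (\<forall>i\<in>{1..m}. 0 \<le> \<mu> i) \<and>
         (\<forall>Y\<in>tangent_directions A \<gg> E p0.
            0 \<le>\<^sub>m\<^sub>i\<^sub>n interval_of (dir_deriv A \<gg> E (\<lambda>p. ctr (f p)) p0 Y)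
                   + (\<Sum>i\<in>{1..m}. interval_of (\<mu> i) * gH_dir_deriv A \<gg> E (g i) p0 Y)) \<and>
         (\<forall>i\<in>{1..m}. interval_of (\<mu> i) * g i p0 = 0))
      \<longrightarrow> strict_optimal_solution f X p0)
   \<and>
     ((\<lambda>p. ctr (f p)) constant_on X \<and>
      dir_differentiable A \<gg> E (\<lambda>p. hw (f p)) p0 \<and> convex_at A \<gg> E (\<lambda>p. hw (f p)) p0 \<and>
      (\<exists>\<mu> :: nat \<Rightarrow> real. (\<forall>i\<in>{1..m}. 0 \<le> \<mu> i) \<and>
         (\<forall>Y\<in>tangent_directions A \<gg> E p0.
            0 \<le>\<^sub>m\<^sub>i\<^sub>n interval_of (dir_deriv A \<gg> E (\<lambda>p. hw (f p)) p0 Y)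
                   + (\<Sum>i\<in>{1..m}. interval_of (\<mu> i) * gH_dir_deriv A \<gg> E (g i) p0 Y)) \<and>
         (\<forall>i\<in>{1..m}. interval_of (\<mu> i) * g i p0 = 0))
      \<longrightarrow> optimal_solution f X p0 \<and>
          (nonconstant_on (\<lambda>p. hw (f p)) X \<longrightarrow> strict_optimal_solution f X p0))"
proof -
  interpret riemannian A \<gg>
    using M by unfold_locales (simp add: complete_riemannian_manifold_def)
  have complete: "Metric_space.mcomplete UNIV (riemannian_dist A \<gg>)"
    using M by (simp add: complete_riemannian_manifold_def)
  have cw': "cw_convex_at A \<gg> E (g i) p0" if "i \<in> {1..m}" "g i p0 = 0" for i
    by (rule cw) (use that in \<open>simp add: J\<close>)
  show ?thesis
  proof (intro conjI impI; elim conjE exE)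
    fix \<mu> :: "nat \<Rightarrow> real"
    assume nc: "nonconstant_on (\<lambda>p. ctr (f p)) X"
      and h: "dir_differentiable A \<gg> E (\<lambda>p. ctr (f p)) p0" "convex_at A \<gg> E (\<lambda>p. ctr (f p)) p0"
        "\<forall>i\<in>{1..m}. 0 \<le> \<mu> i"
        "\<forall>Y\<in>tangent_directions A \<gg> E p0.
            0 \<le>\<^sub>m\<^sub>i\<^sub>n interval_of (dir_deriv A \<gg> E (\<lambda>p. ctr (f p)) p0 Y)
                   + (\<Sum>i\<in>{1..m}. interval_of (\<mu> i) * gH_dir_deriv A \<gg> E (g i) p0 Y)"
        "\<forall>i\<in>{1..m}. interval_of (\<mu> i) * g i p0 = 0"
    have "\<not> f p \<le>\<^sub>m\<^sub>i\<^sub>n f p0" if p: "p \<in> X" "p \<noteq> p0" for p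
    proof -
      have "ctr (f p0) \<le> ctr (f p)" 
        by (rule KKT_minimum[OF complete star X _ _ h p(1)]) (use cw' gH in auto)
      moreover have "ctr (f p) \<noteq> ctr (f p0)" using nc p p0 by (simp add: nonconstant_on_def)
      ultimately show ?thesis by (simp add: le_min_def)
    qed
    then show "strict_optimal_solution f X p0" using p0 by (auto simp: strict_optimal_solution_def)
  next
    fix \<mu> :: "nat \<Rightarrow> real"
    assume const: "(\<lambda>p. ctr (f p)) constant_on X"
      and h: "dir_differentiable A \<gg> E (\<lambda>p. hw (f p)) p0" "convex_at A \<gg> E (\<lambda>p. hw (f p)) p0"
        "\<forall>i\<in>{1..m}. 0 \<le> \<mu> i"
        "\<forall>Y\<in>tangent_directions A \<gg> E p0.
            0 \<le>\<^sub>m\<^sub>i\<^sub>n interval_of (dir_deriv A \<gg> E (\<lambda>p. hw (f p)) p0 Y)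
                   + (\<Sum>i\<in>{1..m}. interval_of (\<mu> i) * gH_dir_deriv A \<gg> E (g i) p0 Y)"
        "\<forall>i\<in>{1..m}. interval_of (\<mu> i) * g i p0 = 0"
    have ctr: "ctr (f p) = ctr (f p0)" if "p \<in> X" for p
      using const that p0 by (auto simp: constant_on_def)
    have hw: "hw (f p0) \<le> hw (f p)" if "p \<in> X" for p
      by (rule KKT_minimum[OF complete star X _ _ h that]) (use cw' gH in auto)
    \<comment> \<open>All centers on \<open>X\<close> agree, so the order compares half-widths
      there. A strictly smaller value would need a smaller half-width than that of
      \<open>f p0\<close>.\<close>
    have "\<not> f p <\<^sub>m\<^sub>i\<^sub>n f p0" if "p \<in> X" for p
      using ctr[OF that] hw[OF that] by (auto simp: less_min_def le_min_def interval_eq_iff_ctr_hw)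
    then show "optimal_solution f X p0" using p0 by (auto simp: optimal_solution_def)
    assume nc: "nonconstant_on (\<lambda>p. hw (f p)) X"
    have "\<not> f p \<le>\<^sub>m\<^sub>i\<^sub>n f p0" if p: "p \<in> X" "p \<noteq> p0" for p
    proof -
      have "hw (f p) \<noteq> hw (f p0)" using nc p p0 by (simp add: nonconstant_on_def)
      then show ?thesis using ctr[OF p(1)] hw[OF p(1)] by (simp add: le_min_def)
    qed
    then show "strict_optimal_solution f X p0" using p0 by (auto simp: strict_optimal_solution_def)
  qed
qed

end
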